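(* Let $d\ge2$, $\alpha=d/2$ and $\beta>1/2$. There is a constant $c>0$ independent of $n$ such that for all $n\ge2$, $$e_n\big(\mathrm{H}^{d/2,\beta}(\mathbb{S}^d)\big)\ge c\, n^{-1/2}(\ln n)^{-\beta+1/2}.$$
   Context: Let $d\ge2$, let $\mathbb{S}^d$ be the unit sphere in $\mathbb{R}^{d+1}$, and let $\sigma_d$ be its normalized surface measure. Let $L_2=L_2(\mathbb{S}^d,\sigma_d)$. Let $H_\ell(f)$ be the $L_2$-orthogonal projection of $f$ onto the space $\mathcal{H}^d_\ell$ of spherical harmonics of degree $\ell$. For $\alpha>0$ and $\beta\in\mathbb{R}$ let $\lambda^{(\alpha,\beta)}_\ell=(1+\ell(\ell+d-1))^{-\alpha/2}(\ln(3+\ell(\ell+d-1)))^{-\beta}$. Define $$\mathrm{H}^{\alpha,\beta}(\mathbb{S}^d)=\Big\{f\in L_2:\ \sum_{\ell\ge0}(\lambda^{(\alpha,\beta)}_\ell)^{-2}\|H_\ell(f)\|_{L_2}^2<\infty\Big\}$$ with norm the square root of that sum. For $\alpha=d/2$ and $\beta>1/2$ this is a reproducing kernel Hilbert space of continuous functions. For such a space $H$, the optimal quadrature error is $$e_n(H)=\inf_{c\in\mathbb{R}^n,\ x_1,\dots,x_n\in\mathbb{S}^d}\sup_{\|f\|_H\le1}\Big|\int f\,d\sigma_d-\sum_{j=1}^nc_jf(x_j)\Big|.$$ *)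

theory Defs
  imports "HOL-Analysis.Analysis"
begin

text \<open>Ambient space R^(d+1) = real^'n with CARD('n) = d+1; the unit sphere is sphere 0 1.\<close>

definition sdim :: "'n::finite itself \<Rightarrow> nat" where
  "sdim _ = CARD('n) - 1"

text \<open>Normalized surface measure on the unit sphere, realised as the (normalized) cone measure:
  sigma(A) = vol{t x : 0 < t < 1, x in A} / vol(unit ball), i.e. push-forward of normalized
  Lebesgue measure on the punctured unit ball under x / |x|.\<close>

definition sphere_measure :: "(real^'n::finite) measure" where
  "sphere_measure =
     scale_measure (inverse (emeasure lborel (ball (0::real^'n) 1)))
       (distr (restrict_space lborel (ball 0 1 - {0}))
              (restrict_space borel (sphere (0::real^'n) 1))
              (\<lambda>x. x /\<^sub>R norm x))"

definition monom :: "('n::finite \<Rightarrow> nat) \<Rightarrow> real^'n \<Rightarrow> real" where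
  "monom k x = (\<Prod>i\<in>UNIV. (x $ i) ^ k i)"

definition hom_poly :: "nat \<Rightarrow> (real^'n::finite \<Rightarrow> real) \<Rightarrow> bool" where
  "hom_poly l p \<longleftrightarrow> (\<exists>S c. finite S \<and> (\<forall>k\<in>S. sum k UNIV = l) \<and>
       p = (\<lambda>x. \<Sum>k\<in>S. c k * monom k x))"

definition laplacian :: "(real^'n::finite \<Rightarrow> real) \<Rightarrow> real^'n \<Rightarrow> real" where
  "laplacian p x = (\<Sum>i\<in>UNIV. deriv (\<lambda>s. deriv (\<lambda>t. p (x + t *\<^sub>R axis i 1)) s) 0)"

definition sph_harm :: "nat \<Rightarrow> (real^'n::finite \<Rightarrow> real) set" where
  "sph_harm l = {p. hom_poly l p \<and> (\<forall>x. laplacian p x = 0)}"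

definition is_Hproj :: "nat \<Rightarrow> (real^'n::finite \<Rightarrow> real) \<Rightarrow> (real^'n \<Rightarrow> real) \<Rightarrow> bool" where
  "is_Hproj l f g \<longleftrightarrow> g \<in> sph_harm l \<and>
     (\<forall>v\<in>sph_harm l. (\<integral>x. (f x - g x) * v x \<partial>sphere_measure) = 0)"

definition Hproj_norm2 :: "nat \<Rightarrow> (real^'n::finite \<Rightarrow> real) \<Rightarrow> real" where
  "Hproj_norm2 l f = (THE r. \<exists>g. is_Hproj l f g \<and> r = (\<integral>x. (g x)\<^sup>2 \<partial>sphere_measure))"

definition lam :: "'n::finite itself \<Rightarrow> real \<Rightarrow> real \<Rightarrow> nat \<Rightarrow> real" where
  "lam T \<alpha> \<beta> l =
     (1 + real l * (real l + real (sdim T) - 1)) powr (-\<alpha>/2) *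
     (ln (3 + real l * (real l + real (sdim T) - 1))) powr (-\<beta>)"

text \<open>Unit ball of H^{alpha,beta}(S^d), consisting of the continuous representatives
  (values only matter on the sphere).\<close>

definition Hball :: "real \<Rightarrow> real \<Rightarrow> (real^'n::finite \<Rightarrow> real) set" where
  "Hball \<alpha> \<beta> = {f. continuous_on (sphere 0 1) f \<and>
      summable (\<lambda>l. Hproj_norm2 l f / (lam TYPE('n) \<alpha> \<beta> l)\<^sup>2) \<and>
      (\<Sum>l. Hproj_norm2 l f / (lam TYPE('n) \<alpha> \<beta> l)\<^sup>2) \<le> 1}"

definition quad_err :: "(real^'n::finite \<Rightarrow> real) set \<Rightarrow> nat \<Rightarrow> ereal" where
  "quad_err B n =
     (INF cx \<in> {(c, x). \<forall>j<n. x j \<in> sphere (0::real^'n) 1}.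
        SUP f \<in> B. ereal \<bar>(\<integral>y. f y \<partial>sphere_measure) - (\<Sum>j<n. fst cx j * f (snd cx j))\<bar>)"

end

theory Submission
  imports Defs
begin

text \<open>
  Given nodes \<open>x\<^sub>1, \<dots>, x\<^sub>n\<close>, take the weighted harmonic features
  \<open>\<phi>\<^sub>(\<^sub>k\<^sub>,\<^sub>i\<^sub>) = k\<^bsup>-d/2\<^esup> Y\<^sub>k\<^sub>,\<^sub>i\<close> with degrees \<open>N \<le> k \<le> N\<^sup>2\<close>, where \<open>N\<close> is a large multiple of \<open>n\<close>, and let
  \<open>P\<close> be the orthogonal projection onto the span of the vectors \<open>\<phi>(x\<^sub>j)\<close>. By the addition theorem
  \<open>|\<phi>(x)|\<^sup>2 = m\<close> is constant, so \<open>f(x) = m - |P \<phi>(x)|\<^sup>2\<close> vanishes at all nodes; its integral is at least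
  \<open>m - n N\<^bsup>-d\<^esup> \<ge> m/2\<close>, and \<open>m\<close> is at least a multiple of \<open>ln n\<close> because \<open>dim \<H>\<^sub>k\<close> is at least a multiple of \<open>k\<^bsup>d-1\<^esup>\<close>.
  The norm of \<open>f\<close> is controlled by duality: \<open>|P \<phi>|\<^sup>2\<close> is the pairing of \<open>P\<close>, of squared
  Hilbert-Schmidt norm at most \<open>n\<close>, with \<open>\<phi> \<otimes> \<phi>\<close>, and the form
  \<open>\<Sum>\<^sub>a\<^sub>b \<langle>\<phi>\<^sub>a \<phi>\<^sub>b, g\<rangle>\<^sup>2\<close> has rotation invariant kernel, hence is diagonal with respect to the degree,
  with value at most \<open>2 (2/l)\<^bsup>d\<^esup> m |g|\<^sup>2\<close> on degree \<open>l\<close> by Bessel's inequality.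
\<close>

text \<open>The gain of (ln n)^(1/2) comes from spreading the features over many degrees. The
  integral of f is of order m, while its squared norm in the degrees l >= 1 is at most of order n m
  (ln n)^(2 \<beta>): the rank of P enters once and m only linearly. The ratio is of order (m /
  n)^(1/2) (ln n)^(-\<beta>), which turns a lower bound on m into the claim. The window of degrees
  is long enough for the sum of 1/k to reach ln n, yet short enough that every logarithm in the norm
  stays comparable to ln n. The weight k^(-d) of a squared feature also balances the smoothness: a
  product of features of degrees j and k meets degree l only if j + k >= l, so one of the two
  weights is at most (2/l)^d, which cancels the growth l^d of the squared norm weight. The obstacle
  is that f depends on arbitrary nodes through products of harmonics. Expansions of such products
  are avoided: infinitesimal rotations are skew for the form, so the Casimir operator is symmetric
  for it, and its distinct eigenvalues separate the degrees.\<close>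

section \<open>The normalized surface measure\<close>

text \<open>The library proves this only for well-ordered index types. Here it follows from translation
  invariance alone, by evaluating \<open>\<integral>\<integral> 1\<^sub>b(x) 1\<^sub>B(T y + x) dx dy\<close> for the unit ball \<open>b\<close> in both orders.\<close>
lemma emeasure_lborel_orthogonal_vimage:
  fixes T :: "real^'n \<Rightarrow> real^'n"
  assumes T: "orthogonal_transformation T" and B[measurable]: "B \<in> sets borel"
  shows "emeasure lborel (T -` B) = emeasure lborel B"
proof -
  let ?b = "ball (0::real^'n) 1"
  have bl: "bounded_linear T"
    using T orthogonal_transformation_linear linear_conv_bounded_linear by blast
  have mT[measurable]: "T \<in> borel_measurable borel"
    using bl by (intro borel_measurable_continuous_onI linear_continuous_on)
  have T_surj: "\<exists>y. T y = x" for x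
    using orthogonal_transformation_surj[OF T] by (metis surjD)
  have shift: "(\<integral>\<^sup>+y. f (y + a) \<partial>lborel) = (\<integral>\<^sup>+y. f y \<partial>lborel)"
    if [measurable]: "f \<in> borel_measurable borel" for f :: "real^'n \<Rightarrow> ennreal" and a
  proof -
    have "(\<integral>\<^sup>+y. f y \<partial>lborel) = (\<integral>\<^sup>+y. f y \<partial>distr lborel borel ((+) a))"
      by (simp add: lborel_distr_plus)
    also have "\<dots> = (\<integral>\<^sup>+y. f (a + y) \<partial>lborel)"
      by (subst nn_integral_distr) auto
    finally show ?thesis by (simp add: add.commute)
  qed
  have [measurable]: "?b \<in> sets borel" by simp
  have Tplus: "(\<lambda>z. T (fst z) + snd z) \<in> borel_measurable (lborel \<Otimes>\<^sub>M lborel)"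
    by (intro borel_measurable_add measurable_compose[OF _ mT]) auto
  have indT: "(\<lambda>z. indicator B (T (fst z) + snd z) :: ennreal) \<in> borel_measurable (lborel \<Otimes>\<^sub>M lborel)"
    using measurable_compose[OF Tplus borel_measurable_indicator[OF B]] .
  have "(\<lambda>z. snd z - T (fst z)) \<in> borel_measurable (lborel \<Otimes>\<^sub>M lborel)"
    by (intro borel_measurable_diff measurable_compose[OF _ mT]) auto
  from measurable_compose[OF this borel_measurable_indicator[of ?b borel]]
  have indb: "(\<lambda>z. indicator ?b (snd z - T (fst z)) :: ennreal) \<in> borel_measurable (lborel \<Otimes>\<^sub>M lborel)"
    by simp
  have mset: "T -` B \<in> sets borel"
    using measurable_sets[OF mT B] by simp
  have "emeasure lborel ?b * emeasure lborel (T -` B)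
      = (\<integral>\<^sup>+x. (\<integral>\<^sup>+y. indicator ?b x * indicator B (T y) \<partial>lborel) \<partial>lborel)"
  proof -
    have "(\<integral>\<^sup>+y. indicator B (T y) \<partial>lborel) = emeasure lborel (T -` B)"
      using nn_integral_indicator[of "T -` B" lborel] mset by (simp add: indicator_vimage)
    then have "(\<integral>\<^sup>+x. (\<integral>\<^sup>+y. indicator ?b x * indicator B (T y) \<partial>lborel) \<partial>lborel)
        = (\<integral>\<^sup>+x. indicator ?b x * emeasure lborel (T -` B) \<partial>lborel)"
      by (simp add: nn_integral_cmult)
    also have "\<dots> = emeasure lborel ?b * emeasure lborel (T -` B)"
      by (subst nn_integral_multc) (auto intro!: borel_measurable_indicator)
    finally show ?thesis ..
  qed
  \<comment> \<open>Translating y by the preimage a of x under T turns T y into T y + x.\<close>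
  also have "\<dots> = (\<integral>\<^sup>+x. (\<integral>\<^sup>+y. indicator ?b x * indicator B (T y + x) \<partial>lborel) \<partial>lborel)"
  proof (rule nn_integral_cong)
    fix x :: "real^'n"
    obtain a where a: "T a = x" using T_surj by blast
    have "T y + x = T (y + a)" for y
      using a bounded_linear.linear[OF bl] by (simp add: linear_add)
    then show "(\<integral>\<^sup>+y. indicator ?b x * indicator B (T y) \<partial>lborel)
        = (\<integral>\<^sup>+y. indicator ?b x * indicator B (T y + x) \<partial>lborel)"
      using shift[of "\<lambda>y. indicator ?b x * indicator B (T y)" a] by simp
  qed
  also have "\<dots> = (\<integral>\<^sup>+y. (\<integral>\<^sup>+x. indicator ?b x * indicator B (T y + x) \<partial>lborel) \<partial>lborel)"
    by (rule lborel_pair.Fubini') (use indT in \<open>simp add: split_beta'\<close>)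
  also have "\<dots> = (\<integral>\<^sup>+y. (\<integral>\<^sup>+x. indicator ?b (x - T y) * indicator B x \<partial>lborel) \<partial>lborel)"
  proof (rule nn_integral_cong)
    fix y :: "real^'n"
    show "(\<integral>\<^sup>+x. indicator ?b x * indicator B (T y + x) \<partial>lborel)
        = (\<integral>\<^sup>+x. indicator ?b (x - T y) * indicator B x \<partial>lborel)"
      using shift[of "\<lambda>x. indicator ?b (x - T y) * indicator B x" "T y"]
      by (simp add: add.commute)
  qed
  also have "\<dots> = (\<integral>\<^sup>+x. (\<integral>\<^sup>+y. indicator ?b (x - T y) * indicator B x \<partial>lborel) \<partial>lborel)"
    by (rule lborel_pair.Fubini'[symmetric]) (use indb in \<open>simp add: split_beta'\<close>)
  \<comment> \<open>For fixed x the condition on y describes the unit ball around the preimage of x,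
    because T is an isometry; its volume does not depend on x.\<close>
  also have "\<dots> = (\<integral>\<^sup>+x. emeasure lborel ?b * indicator B x \<partial>lborel)"
  proof (rule nn_integral_cong)
    fix x :: "real^'n"
    obtain a where a: "T a = x" using T_surj by blast
    have "norm (x - T y) = norm (a - y)" for y
      using a orthogonal_transformation_norm[OF T, of "a - y"] bounded_linear.linear[OF bl]
      by (simp add: linear_diff)
    then have "norm (T y - x) = norm (a - y)" for y
      by (metis norm_minus_commute)
    then have "indicator ?b (x - T y) = (indicator (ball a 1) y :: ennreal)" for y
      by (simp add: indicator_def dist_norm)
    then have "(\<integral>\<^sup>+y. indicator ?b (x - T y) \<partial>lborel) = emeasure lborel (ball a 1)"
      by simp
    also have "\<dots> = emeasure lborel ?b"
      by (simp add: emeasure_ball)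
    finally show "(\<integral>\<^sup>+y. indicator ?b (x - T y) * indicator B x \<partial>lborel) = emeasure lborel ?b * indicator B x"
      by (simp add: nn_integral_multc)
  qed
  also have "\<dots> = emeasure lborel ?b * emeasure lborel B"
    by (simp add: nn_integral_cmult)
  \<comment> \<open>The volume of the unit ball is positive and finite, so it cancels.\<close>
  finally show ?thesis
    by (auto simp: ennreal_mult_cancel_left emeasure_ball less_imp_neq[OF unit_ball_vol_pos, symmetric])
qed

lemma emeasure_sphere_measure:
  assumes "A \<in> sets (restrict_space borel (sphere (0::real^'n) 1))"
  shows "emeasure sphere_measure A
    = inverse (emeasure lborel (ball (0::real^'n) 1)) * emeasure lborel {x \<in> ball 0 1 - {0}. x /\<^sub>R norm x \<in> A}"
proof -
  have "(\<lambda>x. x /\<^sub>R norm x) \<in> restrict_space lborel (ball 0 1 - {0}) \<rightarrow>\<^sub>M restrict_space borel (sphere (0::real^'n) 1)"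
    by (rule measurable_restrict_space2) (auto simp: space_restrict_space intro!: measurable_restrict_space1)
  then show ?thesis using assms
    unfolding sphere_measure_def
    by (auto simp: emeasure_distr emeasure_restrict_space space_restrict_space intro!: arg_cong2[where f="(*)"] arg_cong2[where f=emeasure])
qed

lemma space_sphere_measure [simp]: "space (sphere_measure :: (real^'n) measure) = sphere 0 1"
  by (simp add: sphere_measure_def space_scale_measure space_restrict_space)

lemma sets_sphere_measure [measurable_cong]:
  "sets (sphere_measure :: (real^'n) measure) = sets (restrict_space borel (sphere 0 1))"
  by (simp add: sphere_measure_def)

lemma emeasure_sphere_measure_sphere: "emeasure (sphere_measure :: (real^'n) measure) (sphere 0 1) = 1"
proof -
  have "emeasure lborel {x \<in> ball (0::real^'n) 1 - {0}. x /\<^sub>R norm x \<in> sphere 0 1} = emeasure lborel (ball (0::real^'n) 1 - {0})"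
    by (intro arg_cong2[where f=emeasure]) auto
  also have "\<dots> = emeasure lborel (ball (0::real^'n) 1)"
    by (intro emeasure_Diff_null_set) auto
  finally show ?thesis
    by (subst emeasure_sphere_measure)
       (auto simp: sets_restrict_space emeasure_ball unit_ball_vol_pos ennreal_inverse_mult ennreal_mult[symmetric] inverse_ennreal
        less_imp_neq[OF unit_ball_vol_pos, symmetric])
qed

lemma finite_measure_sphere: "finite_measure (sphere_measure :: (real^'n) measure)"
  by (rule finite_measureI) (simp add: emeasure_sphere_measure_sphere)

lemma measure_sphere: "measure (sphere_measure :: (real^'n) measure) (sphere 0 1) = 1"
  by (simp add: measure_def emeasure_sphere_measure_sphere)

lemma sphere_integral_const [simp]: "(\<integral>x. c \<partial>(sphere_measure :: (real^'n) measure)) = (c::real)"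
  by (simp add: measure_sphere)

lemma borel_measurable_sphere:
  fixes f :: "real^'n \<Rightarrow> real"
  assumes "continuous_on (sphere 0 1) f"
  shows "f \<in> borel_measurable sphere_measure"
  using borel_measurable_continuous_on_restrict[OF assms]
  by (simp add: measurable_cong_sets[OF sets_sphere_measure refl])

lemma integrable_sphere:
  fixes f :: "real^'n \<Rightarrow> real"
  assumes "continuous_on (sphere 0 1) f"
  shows "integrable sphere_measure f"
proof -
  have "bounded (f ` sphere 0 1)"
    using assms by (intro compact_imp_bounded compact_continuous_image) auto
  then obtain B where "\<forall>x\<in>sphere 0 1. norm (f x) \<le> B"
    by (auto simp: bounded_iff)
  then show ?thesis
    by (intro finite_measure.integrable_const_bound[OF finite_measure_sphere, of _ B] AE_I2 borel_measurable_sphere assms) auto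
qed

text \<open>The cone over the preimage of \<open>A\<close> under \<open>T\<close> is the preimage of
  the cone over \<open>A\<close>, because \<open>T\<close> is linear and preserves norms. Invariance
  of Lebesgue measure does the rest.\<close>

lemma distr_sphere_measure:
  fixes T :: "real^'n \<Rightarrow> real^'n"
  assumes T: "orthogonal_transformation T"
  shows "distr sphere_measure sphere_measure T = sphere_measure"
proof (rule measure_eqI)
  fix A assume "A \<in> sets (distr sphere_measure sphere_measure T)"
  then have A: "A \<in> sets (restrict_space borel (sphere (0::real^'n) 1))"
    by (simp add: sets_sphere_measure)
  have lin: "linear T" using T orthogonal_transformation_linear by blast
  have [measurable]: "T \<in> borel_measurable borel"
    using lin by (intro borel_measurable_continuous_onI linear_continuous_on) (simp add: linear_conv_bounded_linear)
  have A': "A \<in> sets borel" "A \<subseteq> sphere 0 1"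
    using A by (auto simp: sets_restrict_space_iff)
  note [measurable] = A'(1)
  have TA: "T -` A \<inter> sphere 0 1 \<in> sets borel"
    using measurable_sets[of T borel borel A] A' by auto
  have mT: "T \<in> sphere_measure \<rightarrow>\<^sub>M sphere_measure"
  proof -
    have "T \<in> restrict_space borel (sphere 0 1) \<rightarrow>\<^sub>M restrict_space borel (sphere 0 1)"
      by (rule measurable_restrict_space2)
        (auto simp: space_restrict_space orthogonal_transformation_norm[OF T] intro!: measurable_restrict_space1)
    then show ?thesis
      by (simp add: measurable_cong_sets[OF sets_sphere_measure sets_sphere_measure])
  qed
  have scale: "T (x /\<^sub>R norm x) = T x /\<^sub>R norm x" for x
    using lin by (simp add: linear_scale)
  have T0: "T x = 0 \<longleftrightarrow> x = 0" for x
    using orthogonal_transformation_norm[OF T, of x] by (metis norm_eq_zero)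
  have "emeasure (distr sphere_measure sphere_measure T) A = emeasure sphere_measure (T -` A \<inter> sphere 0 1)"
    using A by (subst emeasure_distr[OF mT]) (auto simp: sets_sphere_measure)
  also have "\<dots> = inverse (emeasure lborel (ball (0::real^'n) 1)) *
      emeasure lborel {x \<in> ball 0 1 - {0}. x /\<^sub>R norm x \<in> T -` A \<inter> sphere 0 1}"
    using TA by (subst emeasure_sphere_measure) (auto simp: sets_restrict_space_iff)
  also have "{x \<in> ball 0 1 - {0}. x /\<^sub>R norm x \<in> T -` A \<inter> sphere 0 1}
      = T -` {x \<in> ball 0 1 - {0}. x /\<^sub>R norm x \<in> A}"
    unfolding vimage_def by (auto simp: scale T0 orthogonal_transformation_norm[OF T])
  also have "emeasure lborel \<dots> = emeasure lborel {x \<in> ball 0 1 - {0}. x /\<^sub>R norm x \<in> A}"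
    by (rule emeasure_lborel_orthogonal_vimage[OF T]) measurable
  finally show "emeasure (distr sphere_measure sphere_measure T) A = emeasure sphere_measure A"
    using A by (simp add: emeasure_sphere_measure)
qed simp

lemma sphere_integral_rotate:
  fixes T :: "real^'n \<Rightarrow> real^'n" and f :: "real^'n \<Rightarrow> real"
  assumes T: "orthogonal_transformation T" and f: "continuous_on (sphere 0 1) f"
  shows "(\<integral>x. f (T x) \<partial>sphere_measure) = (\<integral>x. f x \<partial>sphere_measure)"
proof -
  have lin: "linear T" using T orthogonal_transformation_linear by blast
  have "T \<in> restrict_space borel (sphere 0 1) \<rightarrow>\<^sub>M restrict_space borel (sphere 0 1)"
    by (rule measurable_restrict_space2)
      (use lin in \<open>auto simp: space_restrict_space orthogonal_transformation_norm[OF T] linear_conv_bounded_linear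
        intro!: measurable_restrict_space1 borel_measurable_continuous_onI linear_continuous_on\<close>)
  then have mT: "T \<in> sphere_measure \<rightarrow>\<^sub>M sphere_measure"
    by (simp add: measurable_cong_sets[OF sets_sphere_measure sets_sphere_measure])
  show ?thesis
    using integral_distr[OF mT borel_measurable_sphere[OF f]] by (simp add: distr_sphere_measure[OF T])
qed

text \<open>The cone over the set where \<open>f\<close> does not vanish is open by continuity, so
  if it is nonempty it contains a box of positive volume. The measure of that set is a nonzero
  multiple of the volume of its cone, hence cannot be 0.\<close>

lemma sphere_integral_sq_eq_0:
  fixes f :: "real^'n \<Rightarrow> real"
  assumes f: "continuous_on (sphere 0 1) f" and int: "(\<integral>x. f x * f x \<partial>sphere_measure) = 0"
    and x: "x \<in> sphere 0 1"
  shows "f x = 0"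
proof (rule ccontr)
  assume fx: "f x \<noteq> 0"
  have "integrable sphere_measure (\<lambda>x. f x * f x)"
    by (intro integrable_sphere continuous_intros f)
  then have "AE x in sphere_measure. f x * f x = 0"
    using int by (subst (asm) integral_nonneg_eq_0_iff_AE) auto
  then have AE: "AE x in sphere_measure. f x = 0" by simp
  define A where "A = {x \<in> sphere 0 1. f x \<noteq> 0}"
  have A_eq: "A = f -` (-{0}) \<inter> space sphere_measure"
    by (auto simp: A_def)
  have mA: "A \<in> sets sphere_measure"
    unfolding A_eq by (rule measurable_sets[OF borel_measurable_sphere[OF f]]) auto
  have "emeasure sphere_measure A = 0"
    using AE AE_iff_measurable[OF mA, of "\<lambda>x. f x = 0"] by (auto simp: A_def)
  moreover have "inverse (emeasure lborel (ball (0::real^'n) 1)) \<noteq> 0"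
    by (simp add: emeasure_ball)
  ultimately have null: "emeasure lborel {x \<in> ball 0 1 - {0}. x /\<^sub>R norm x \<in> A} = 0"
    using mA by (subst (asm) emeasure_sphere_measure) (auto simp: sets_sphere_measure)
  define U where "U = {x \<in> ball (0::real^'n) 1 - {0}. x /\<^sub>R norm x \<in> A}"
  have cont: "continuous_on (ball 0 1 - {0}) (\<lambda>x. f (x /\<^sub>R norm x))"
    by (intro continuous_on_compose2[OF f] continuous_intros) (auto simp: field_simps split: if_splits)
  have U_eq: "U = (ball (0::real^'n) 1 - {0}) \<inter> (\<lambda>x. f (x /\<^sub>R norm x)) -` (-{0})"
    by (auto simp: U_def A_def field_simps)
  have "open U"
    unfolding U_eq by (rule continuous_open_preimage[OF cont]) auto
  \<comment> \<open>The factor 1/2 puts the point on the ray through \<open>x\<close> inside the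
    open punctured ball.\<close>
  moreover have "(1/2) *\<^sub>R x \<in> U"
    using x fx by (auto simp: U_def A_def)
  ultimately obtain a b where ab: "(1/2) *\<^sub>R x \<in> box a b" "box a b \<subseteq> U"
    using open_contains_box by (metis open_contains_box)
  have "emeasure lborel (box a b) \<le> emeasure lborel U"
    using ab \<open>open U\<close> by (intro emeasure_mono) auto
  then have "emeasure lborel (box a b) = 0"
    using null by (simp add: U_def)
  moreover have "emeasure lborel (box a b) \<noteq> 0"
    using ab(1) by (auto simp: emeasure_lborel_box_eq mem_box prod_nonneg algebra_simps
      intro!: prod_pos)
  ultimately show False by simp
qed

section \<open>Partial derivatives of polynomial functions\<close>

definition pd :: "'n \<Rightarrow> (real^'n::finite \<Rightarrow> real) \<Rightarrow> real^'n \<Rightarrow> real" where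
  "pd i p x = deriv (\<lambda>t. p (x + t *\<^sub>R axis i 1)) 0"

text \<open>The induction carries polynomiality of the partial derivatives along with
  differentiability, so that derivatives can be iterated. That the \<open>q i\<close> are the
  functions \<open>pd i p\<close> is read off afterwards.\<close>

lemma rpf_gradient:
  fixes p :: "real^'n \<Rightarrow> real"
  assumes "real_polynomial_function p"
  shows "\<exists>q. (\<forall>i. real_polynomial_function (q i)) \<and> (\<forall>x. (p has_derivative (\<lambda>v. \<Sum>i\<in>UNIV. v $ i * q i x)) (at x))"
  using assms
proof induction
  case (linear f)
  have "f v = (\<Sum>i\<in>UNIV. v $ i * f (axis i 1))" for v
  proof -
    have "f v = f (\<Sum>i\<in>UNIV. v $ i *\<^sub>R axis i 1)"
      by (simp add: basis_expansion scalar_mult_eq_scaleR[symmetric])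
    also have "\<dots> = (\<Sum>i\<in>UNIV. v $ i * f (axis i 1))"
      using bounded_linear.linear[OF linear] by (simp add: linear_sum linear_scale)
    finally show ?thesis .
  qed
  then have eq: "f = (\<lambda>v. \<Sum>i\<in>UNIV. v $ i * f (axis i 1))" by (rule ext)
  have "(f has_derivative (\<lambda>v. \<Sum>i\<in>UNIV. v $ i * f (axis i 1))) (at x)" for x
    using bounded_linear_imp_has_derivative[OF linear] by (simp only: eq[symmetric])
  then show ?case
    by (intro exI[of _ "\<lambda>i x. f (axis i 1)"]) auto
next
  case (const c)
  then show ?case
    by (intro exI[of _ "\<lambda>i x. 0"]) auto
next
  case (add f g)
  then obtain qf qg where
    "\<forall>i. real_polynomial_function (qf i)" "\<forall>x. (f has_derivative (\<lambda>v. \<Sum>i\<in>UNIV. v $ i * qf i x)) (at x)"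
    "\<forall>i. real_polynomial_function (qg i)" "\<forall>x. (g has_derivative (\<lambda>v. \<Sum>i\<in>UNIV. v $ i * qg i x)) (at x)"
    by blast
  then show ?case
    by (intro exI[of _ "\<lambda>i x. qf i x + qg i x"])
       (auto simp: distrib_left sum.distrib intro!: has_derivative_add)
next
  case (mult f g)
  then obtain qf qg where q:
    "\<forall>i. real_polynomial_function (qf i)" "\<forall>x. (f has_derivative (\<lambda>v. \<Sum>i\<in>UNIV. v $ i * qf i x)) (at x)"
    "\<forall>i. real_polynomial_function (qg i)" "\<forall>x. (g has_derivative (\<lambda>v. \<Sum>i\<in>UNIV. v $ i * qg i x)) (at x)"
    by blast
  have "((\<lambda>x. f x * g x) has_derivative (\<lambda>v. \<Sum>i\<in>UNIV. v $ i * (f x * qg i x + qf i x * g x))) (at x)" for x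
    using has_derivative_mult[OF q(2)[rule_format, of x] q(4)[rule_format, of x]]
    by (simp add: algebra_simps sum.distrib sum_distrib_left)
  with q(1,3) mult.hyps show ?case
    by (intro exI[of _ "\<lambda>i x. f x * qg i x + qf i x * g x"])
       (auto intro!: real_polynomial_function.intros(3) real_polynomial_function.intros(4))
qed

lemma line_derivative:
  fixes p :: "real^'n \<Rightarrow> real"
  assumes "(p has_derivative (\<lambda>v. \<Sum>i\<in>UNIV. v $ i * q i (x + s *\<^sub>R axis i0 1))) (at (x + s *\<^sub>R axis i0 1))"
  shows "((\<lambda>t. p (x + t *\<^sub>R axis i0 1)) has_field_derivative q i0 (x + s *\<^sub>R axis i0 1)) (at s)"
proof -
  have eq: "(\<Sum>i\<in>UNIV. (t *\<^sub>R axis i0 1 :: real^'n) $ i * c i) = c i0 * t" for t c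
    by (simp add: axis_def if_distrib[of "\<lambda>z. _ * z"] if_distrib[of "\<lambda>z. z * _"] sum.delta' mult.commute
        cong: if_cong)
  have "((\<lambda>t. x + t *\<^sub>R axis i0 1) has_derivative (\<lambda>t. t *\<^sub>R axis i0 1)) (at s)"
    by (auto intro!: derivative_eq_intros)
  from has_derivative_compose[OF this assms]
  show ?thesis
    unfolding has_field_derivative_def eq .
qed

lemma
  fixes p :: "real^'n \<Rightarrow> real"
  assumes "real_polynomial_function p"
  shows rpf_pd [intro, simp]: "real_polynomial_function (pd i p)"
    and has_derivative_pd: "(p has_derivative (\<lambda>v. \<Sum>i\<in>UNIV. v $ i * pd i p x)) (at x)"
proof -
  obtain q where q: "\<And>i. real_polynomial_function (q i)"
    "\<And>x. (p has_derivative (\<lambda>v. \<Sum>i\<in>UNIV. v $ i * q i x)) (at x)"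
    using rpf_gradient[OF assms] by blast
  have "pd i p = q i" for i
    unfolding pd_def using line_derivative[of p q _ 0 i, OF q(2)] by (intro ext DERIV_imp_deriv) simp
  with q show "real_polynomial_function (pd i p)"
    "(p has_derivative (\<lambda>v. \<Sum>i\<in>UNIV. v $ i * pd i p x)) (at x)" by auto
qed

lemma pd_eqI:
  fixes p :: "real^'n \<Rightarrow> real"
  assumes "(p has_derivative (\<lambda>v. \<Sum>i\<in>UNIV. v $ i * q i)) (at x)"
  shows "pd i p x = q i"
  unfolding pd_def using line_derivative[of p "\<lambda>i x. q i" x 0 i] assms by (intro DERIV_imp_deriv) simp

text \<open>The inner \<open>deriv\<close> is taken at every point \<open>s\<close> of the line,
  where it is \<open>pd i p\<close> at the shifted point; this replaces the nested derivatives of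
  the definition by iterated \<open>pd\<close>.\<close>

lemma laplacian_eq_pd:
  fixes p :: "real^'n \<Rightarrow> real"
  assumes "real_polynomial_function p"
  shows "laplacian p x = (\<Sum>i\<in>UNIV. pd i (pd i p) x)"
proof -
  have "deriv (\<lambda>t. p (x + t *\<^sub>R axis i 1)) s = pd i p (x + s *\<^sub>R axis i 1)" for i s
    using line_derivative[of p "\<lambda>i. pd i p", OF has_derivative_pd[OF assms]] by (rule DERIV_imp_deriv)
  then show ?thesis by (simp add: laplacian_def pd_def)
qed

lemma pd_add:
  fixes f g :: "real^'n \<Rightarrow> real"
  assumes "real_polynomial_function f" "real_polynomial_function g"
  shows "pd i (\<lambda>x. f x + g x) x = pd i f x + pd i g x"
  using has_derivative_add[OF has_derivative_pd[OF assms(1), of x] has_derivative_pd[OF assms(2), of x]]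
  by (intro pd_eqI[where q="\<lambda>i. pd i f x + pd i g x"]) (simp add: distrib_left sum.distrib)

lemma pd_diff:
  fixes f g :: "real^'n \<Rightarrow> real"
  assumes "real_polynomial_function f" "real_polynomial_function g"
  shows "pd i (\<lambda>x. f x - g x) x = pd i f x - pd i g x"
  using has_derivative_diff[OF has_derivative_pd[OF assms(1), of x] has_derivative_pd[OF assms(2), of x]]
  by (intro pd_eqI[where q="\<lambda>i. pd i f x - pd i g x"]) (simp add: right_diff_distrib sum_subtractf)

lemma pd_mult:
  fixes f g :: "real^'n \<Rightarrow> real"
  assumes "real_polynomial_function f" "real_polynomial_function g"
  shows "pd i (\<lambda>x. f x * g x) x = f x * pd i g x + pd i f x * g x"
  using has_derivative_mult[OF has_derivative_pd[OF assms(1), of x] has_derivative_pd[OF assms(2), of x]]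
  by (intro pd_eqI[where q="\<lambda>i. f x * pd i g x + pd i f x * g x"])
     (simp add: algebra_simps sum.distrib sum_distrib_left)

lemma pd_const: "pd i (\<lambda>x::real^'n. c) x = 0"
  by (simp add: pd_def)

lemma pd_cmult:
  fixes f :: "real^'n \<Rightarrow> real"
  assumes "real_polynomial_function f"
  shows "pd i (\<lambda>x. c * f x) x = c * pd i f x"
  using pd_mult[OF real_polynomial_function.intros(2) assms] by (simp add: pd_const)

lemma pd_sum:
  fixes f :: "'a \<Rightarrow> real^'n \<Rightarrow> real"
  assumes "finite A" "\<And>a. a \<in> A \<Longrightarrow> real_polynomial_function (f a)"
  shows "pd i (\<lambda>x. \<Sum>a\<in>A. f a x) x = (\<Sum>a\<in>A. pd i (f a) x)"
  using assms
  by (induction A rule: finite_induct) (auto simp: pd_const pd_add real_polynomial_function_sum)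

lemma rpf_nth [intro, simp]: "real_polynomial_function (\<lambda>x::real^'n. x $ i)"
  by (intro real_polynomial_function.intros(1) bounded_linear_vec_nth)

lemma pd_nth: "pd i (\<lambda>x::real^'n. x $ j) x = (if i = j then 1 else 0)"
  by (rule pd_eqI[where q="\<lambda>i. if i = j then 1 else 0"])
    (simp add: if_distrib[of "\<lambda>z. _ * z"] bounded_linear_imp_has_derivative bounded_linear_vec_nth cong: if_cong)

lemma laplacian_add:
  fixes f g :: "real^'n \<Rightarrow> real"
  assumes "real_polynomial_function f" "real_polynomial_function g"
  shows "laplacian (\<lambda>x. f x + g x) x = laplacian f x + laplacian g x"
proof -
  have "pd i (\<lambda>x. f x + g x) = (\<lambda>x. pd i f x + pd i g x)" for i
    using pd_add[OF assms] by auto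
  then show ?thesis
    using assms by (simp add: laplacian_eq_pd real_polynomial_function.intros(3) pd_add sum.distrib)
qed

lemma laplacian_cmult:
  fixes f :: "real^'n \<Rightarrow> real"
  assumes "real_polynomial_function f"
  shows "laplacian (\<lambda>x. c * f x) x = c * laplacian f x"
proof -
  have "pd i (\<lambda>x. c * f x) = (\<lambda>x. c * pd i f x)" for i
    using pd_cmult[OF assms] by auto
  then show ?thesis
    using assms by (simp add: laplacian_eq_pd real_polynomial_function.intros(4) real_polynomial_function.intros(2)
        pd_cmult sum_distrib_left)
qed

lemma rpf_cmult [intro]: "real_polynomial_function f \<Longrightarrow> real_polynomial_function (\<lambda>x. c * f x)"
  by (intro real_polynomial_function.intros(4) real_polynomial_function.intros(2))

lemma laplacian_sum:
  fixes f :: "'a \<Rightarrow> real^'n \<Rightarrow> real"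
  assumes "finite A" "\<And>a. a \<in> A \<Longrightarrow> real_polynomial_function (f a)"
  shows "laplacian (\<lambda>x. \<Sum>a\<in>A. f a x) x = (\<Sum>a\<in>A. laplacian (f a) x)"
  using assms
proof (induction A rule: finite_induct)
  case empty
  then show ?case by (simp add: laplacian_def)
next
  case (insert a A)
  then show ?case by (simp add: laplacian_add real_polynomial_function_sum)
qed

lemma rpf_laplacian [intro]:
  fixes p :: "real^'n \<Rightarrow> real"
  assumes "real_polynomial_function p"
  shows "real_polynomial_function (laplacian p)"
proof -
  have "laplacian p = (\<lambda>x. \<Sum>i\<in>UNIV. pd i (pd i p) x)"
    using laplacian_eq_pd[OF assms] by auto
  then show ?thesis using assms by (simp add: real_polynomial_function_sum)
qed

lemma rpf_continuous_on: "real_polynomial_function p \<Longrightarrow> continuous_on S p"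
  for p :: "real^'n \<Rightarrow> real"
  by (simp add: continuous_on_polymonial_function real_polynomial_function_eq)

lemma rpf_compose_linear:
  fixes p :: "real^'n \<Rightarrow> real" and T :: "real^'n \<Rightarrow> real^'n"
  assumes "real_polynomial_function p" "linear T"
  shows "real_polynomial_function (\<lambda>x. p (T x))"
proof -
  have "polynomial_function T"
    by (rule polynomial_function_bounded_linear) (use assms linear_conv_bounded_linear in blast)
  from real_polynomial_function_compose[OF this assms(1)] show ?thesis by (simp add: o_def)
qed

text \<open>Two applications of the chain rule contract the second derivatives of \<open>p\<close>
  with products of matrix entries of \<open>T\<close>; summing over the differentiation index leaves
  the identity, since the rows of the matrix are orthonormal.\<close>

lemma laplacian_orthogonal:
  fixes p :: "real^'n \<Rightarrow> real" and T :: "real^'n \<Rightarrow> real^'n"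
  assumes p: "real_polynomial_function p" and T: "orthogonal_transformation T"
  shows "laplacian (\<lambda>x. p (T x)) x = laplacian p (T x)"
proof -
  have lin: "linear T" using T orthogonal_transformation_linear by blast
  define a where "a = (\<lambda>i j. T (axis i 1) $ j)"
  have Tv: "T v $ j = (\<Sum>i\<in>UNIV. v $ i * a i j)" for v j
  proof -
    have "T v $ j = T (\<Sum>i\<in>UNIV. v $ i *\<^sub>R axis i 1) $ j"
      by (simp add: basis_expansion scalar_mult_eq_scaleR[symmetric])
    also have "\<dots> = (\<Sum>i\<in>UNIV. v $ i * a i j)"
      using lin by (simp add: linear_sum linear_scale a_def)
    finally show ?thesis .
  qed
  have pdT: "pd i (\<lambda>x. f (T x)) x = (\<Sum>j\<in>UNIV. a i j * pd j f (T x))"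
    if f: "real_polynomial_function f" for f i x
  proof (rule pd_eqI)
    have "((\<lambda>x. f (T x)) has_derivative (\<lambda>v. \<Sum>j\<in>UNIV. T v $ j * pd j f (T x))) (at x)"
      using has_derivative_compose[OF linear_imp_has_derivative[OF lin] has_derivative_pd[OF f]] .
    moreover have "(\<Sum>j\<in>UNIV. T v $ j * pd j f (T x)) = (\<Sum>i\<in>UNIV. v $ i * (\<Sum>j\<in>UNIV. a i j * pd j f (T x)))" for v
      unfolding Tv sum_distrib_right sum_distrib_left by (subst sum.swap) (simp add: mult.assoc)
    ultimately show "((\<lambda>x. f (T x)) has_derivative (\<lambda>v. \<Sum>i\<in>UNIV. v $ i * (\<Sum>j\<in>UNIV. a i j * pd j f (T x)))) (at x)"
      by simp
  qed
  have orth: "(\<Sum>i\<in>UNIV. a i j * a i k) = (if j = k then 1 else 0)" for j k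
  proof -
    have "orthogonal_matrix (matrix T)"
      using T by (simp add: orthogonal_transformation_matrix)
    then have "matrix T ** transpose (matrix T) = mat 1"
      by (simp add: orthogonal_matrix_def)
    then have "(matrix T ** transpose (matrix T)) $ j $ k = (mat 1 :: real^'n^'n) $ j $ k" by simp
    then show ?thesis
      by (simp add: matrix_matrix_mult_def transpose_def matrix_def mat_def a_def)
  qed
  have fT: "real_polynomial_function (\<lambda>x. p (T x))"
    by (rule rpf_compose_linear[OF p lin])
  have "pd i (\<lambda>x. p (T x)) = (\<lambda>x. \<Sum>j\<in>UNIV. a i j * pd j p (T x))" for i
    using pdT[OF p] by auto
  then have "laplacian (\<lambda>x. p (T x)) x = (\<Sum>i\<in>UNIV. pd i (\<lambda>x. \<Sum>j\<in>UNIV. a i j * pd j p (T x)) x)"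
    by (simp add: laplacian_eq_pd[OF fT])
  also have "\<dots> = (\<Sum>i\<in>UNIV. \<Sum>j\<in>UNIV. a i j * (\<Sum>k\<in>UNIV. a i k * pd k (pd j p) (T x)))"
  proof (rule sum.cong[OF refl])
    fix i
    have r: "real_polynomial_function (\<lambda>x. pd j p (T x))" for j
      by (rule rpf_compose_linear[OF rpf_pd[OF p] lin])
    have "pd i (\<lambda>x. \<Sum>j\<in>UNIV. a i j * pd j p (T x)) x = (\<Sum>j\<in>UNIV. pd i (\<lambda>x. a i j * pd j p (T x)) x)"
      by (rule pd_sum) (auto intro: r)
    then show "pd i (\<lambda>x. \<Sum>j\<in>UNIV. a i j * pd j p (T x)) x
        = (\<Sum>j\<in>UNIV. a i j * (\<Sum>k\<in>UNIV. a i k * pd k (pd j p) (T x)))"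
      by (simp only: pd_cmult[OF r] pdT[OF rpf_pd[OF p]])
  qed
  also have "\<dots> = (\<Sum>i\<in>UNIV. \<Sum>j\<in>UNIV. \<Sum>k\<in>UNIV. a i j * a i k * pd k (pd j p) (T x))"
    by (simp add: sum_distrib_left mult.assoc)
  also have "\<dots> = (\<Sum>j\<in>UNIV. \<Sum>k\<in>UNIV. (\<Sum>i\<in>UNIV. a i j * a i k) * pd k (pd j p) (T x))"
    unfolding sum_distrib_right
    by (subst sum.swap, rule sum.cong[OF refl], rule sum.swap)
  also have "\<dots> = laplacian p (T x)"
    by (simp add: orth laplacian_eq_pd[OF p] if_distrib[of "\<lambda>z. z * _"] cong: if_cong)
  finally show ?thesis .
qed

section \<open>Homogeneous polynomials and spherical harmonics\<close>

lemma rpf_monom [intro, simp]: "real_polynomial_function (monom k :: real^'n \<Rightarrow> real)"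
proof -
  have "monom k = (\<lambda>x::real^'n. \<Prod>i\<in>UNIV. (x $ i) ^ k i)"
    by (simp add: monom_def fun_eq_iff)
  then show ?thesis
    by (simp add: real_polynomial_function_prod real_polynomial_function_power)
qed

lemma monom_scale: "monom k (t *\<^sub>R x) = t ^ sum k UNIV * monom k (x::real^'n)"
  by (simp add: monom_def power_mult_distrib prod.distrib power_sum)

lemma monom_plus: "monom k x * monom k' x = monom (\<lambda>i. k i + k' i) x"
  by (simp add: monom_def power_add prod.distrib)

lemma sum_monom_group:
  fixes g :: "'a \<Rightarrow> 'n::finite \<Rightarrow> nat"
  assumes "finite A"
  shows "(\<Sum>a\<in>A. c a * monom (g a) x) = (\<Sum>k\<in>g ` A. (\<Sum>a\<in>{a\<in>A. g a = k}. c a) * monom k x)"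
proof -
  have "(\<Sum>a\<in>A. c a * monom (g a) x) = (\<Sum>k\<in>g ` A. \<Sum>a\<in>{a\<in>A. g a = k}. c a * monom (g a) x)"
    by (rule sum.image_gen[OF assms])
  also have "\<dots> = (\<Sum>k\<in>g ` A. (\<Sum>a\<in>{a\<in>A. g a = k}. c a) * monom k x)"
    by (intro sum.cong refl) (simp add: sum_distrib_right)
  finally show ?thesis .
qed

text \<open>Sums and products of expansions produce repeated exponents, whereas
  \<open>hom_poly\<close> sums over a set of exponents. Here any finite index set is allowed and
  equal exponents are collected.\<close>

lemma monom_sum_reindex:
  fixes p :: "real^'n \<Rightarrow> real"
  assumes "finite A" "\<And>x. p x = (\<Sum>a\<in>A. c a * monom (g a) x)"
  shows "\<exists>S c. finite S \<and> p = (\<lambda>x. \<Sum>k\<in>S. c k * monom k x)"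
  using assms sum_monom_group[OF assms(1), of c g]
  by (intro exI[of _ "g ` A"] exI[of _ "\<lambda>k. \<Sum>a\<in>{a\<in>A. g a = k}. c a"]) auto

lemma rpf_monom_sum:
  fixes p :: "real^'n \<Rightarrow> real"
  assumes "real_polynomial_function p"
  shows "\<exists>S c. finite S \<and> p = (\<lambda>x. \<Sum>k\<in>S. c k * monom k x)"
  using assms
proof induction
    case (linear f)
    have "f x = (\<Sum>i\<in>UNIV. f (axis i 1) * monom (\<lambda>j. if j = i then 1 else 0) x)" for x
    proof -
      have "f x = f (\<Sum>i\<in>UNIV. x $ i *\<^sub>R axis i 1)"
        by (simp add: basis_expansion scalar_mult_eq_scaleR[symmetric])
      also have "\<dots> = (\<Sum>i\<in>UNIV. x $ i * f (axis i 1))"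
        using bounded_linear.linear[OF linear] by (simp add: linear_sum linear_scale)
      also have "\<dots> = (\<Sum>i\<in>UNIV. f (axis i 1) * monom (\<lambda>j. if j = i then 1 else 0) x)"
        by (intro sum.cong refl) (simp add: monom_def if_distrib[of "\<lambda>z. _ ^ z"] cong: if_cong)
      finally show ?thesis .
    qed
    from monom_sum_reindex[OF _ this] show ?case by simp
  next
    case (const c)
    show ?case
      by (rule monom_sum_reindex[of "{()}" _ "\<lambda>_. c" "\<lambda>_ _. 0"]) (auto simp: monom_def)
  next
    case (add f g)
    then obtain S c S' c' where *: "finite S" "f = (\<lambda>x. \<Sum>k\<in>S. c k * monom k x)"
      "finite S'" "g = (\<lambda>x. \<Sum>k\<in>S'. c' k * monom k x)" by blast
    have "f x + g x = (\<Sum>a\<in>S <+> S'. case_sum c c' a * monom (case_sum id id a) x)" for x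
      using *(1,3) by (simp add: *(2,4) sum.Plus)
    from monom_sum_reindex[OF _ this] show ?case using *(1,3) by simp
  next
    case (mult f g)
    then obtain S c S' c' where *: "finite S" "f = (\<lambda>x. \<Sum>k\<in>S. c k * monom k x)"
      "finite S'" "g = (\<lambda>x. \<Sum>k\<in>S'. c' k * monom k x)" by blast
    have "f x * g x = (\<Sum>a\<in>S \<times> S'. (c (fst a) * c' (snd a)) * monom (\<lambda>i. fst a i + snd a i) x)" for x
      unfolding *(2,4) sum_product sum.cartesian_product
      by (intro sum.cong refl) (auto simp: monom_plus[symmetric] algebra_simps)
    from monom_sum_reindex[OF _ this] show ?case using *(1,3) by simp
  qed

lemma hom_poly_imp_rpf: "hom_poly l p \<Longrightarrow> real_polynomial_function p"
  by (auto simp: hom_poly_def intro!: real_polynomial_function_sum rpf_cmult)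

lemma hom_poly_scale: "hom_poly l p \<Longrightarrow> p (t *\<^sub>R x) = t ^ l * p x"
  by (auto simp: hom_poly_def monom_scale sum_distrib_left intro!: sum.cong)

text \<open>Along a ray both sides are polynomials in \<open>t\<close>; agreeing for all
  \<open>t > 0\<close>, they have equal coefficients, so \<open>p\<close> is its own part of degree
  \<open>l\<close>. Later homogeneity claims rest on this scaling test instead of on
  exponents.\<close>

lemma hom_polyI:
  fixes p :: "real^'n \<Rightarrow> real"
  assumes p: "real_polynomial_function p" and hom: "\<And>t x. t > 0 \<Longrightarrow> p (t *\<^sub>R x) = t ^ l * p x"
  shows "hom_poly l p"
proof -
  obtain S c where S: "finite S" "p = (\<lambda>x. \<Sum>k\<in>S. c k * monom k x)"
    using rpf_monom_sum[OF p] by blast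
  define N where "N = Max (insert l ((\<lambda>k. sum k UNIV) ` S))"
  have N: "l \<le> N" "k \<in> S \<Longrightarrow> sum k UNIV \<le> N" for k
    using S(1) by (auto simp: N_def)
  define a where "a = (\<lambda>j x. \<Sum>k\<in>{k\<in>S. sum k UNIV = j}. c k * monom k x)"
  have expand: "p (t *\<^sub>R x) = (\<Sum>j\<le>N. a j x * t ^ j)" for t x
  proof -
    have "p (t *\<^sub>R x) = (\<Sum>k\<in>S. t ^ sum k UNIV * (c k * monom k x))"
      by (simp add: S(2) monom_scale algebra_simps)
    also have "\<dots> = (\<Sum>j\<le>N. \<Sum>k\<in>{k\<in>S. sum k UNIV = j}. t ^ sum k UNIV * (c k * monom k x))"
      using S(1) N(2) by (intro sum.group[symmetric]) auto
    also have "\<dots> = (\<Sum>j\<le>N. a j x * t ^ j)"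
      by (intro sum.cong refl) (simp add: a_def sum_distrib_left sum_distrib_right mult.commute)
    finally show ?thesis .
  qed
  have "p x = a l x" for x
  proof -
    define b where "b = (\<lambda>j. a j x - (if j = l then p x else 0))"
    have "(\<Sum>j\<le>N. b j * t ^ j) = 0" if "t > 0" for t
    proof -
      have "(\<Sum>j\<le>N. b j * t ^ j) = p (t *\<^sub>R x) - t ^ l * p x"
        using N(1) by (simp add: b_def expand left_diff_distrib sum_subtractf if_distrib[of "\<lambda>z. z * _"] cong: if_cong)
      then show ?thesis using hom[OF that] by simp
    qed
    then have "{0<..} \<subseteq> {t. (\<Sum>j\<le>N. b j * t ^ j) = 0}" by auto
    then have "infinite {t::real. (\<Sum>j\<le>N. b j * t ^ j) = 0}"
      using infinite_Ioi infinite_super by blast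
    then have "b l = 0"
      using polyfun_finite_roots[of b N] N(1) by blast
    then show ?thesis by (simp add: b_def)
  qed
  then have "p = (\<lambda>x. \<Sum>k\<in>{k\<in>S. sum k UNIV = l}. c k * monom k x)"
    by (auto simp: a_def)
  then show ?thesis
    unfolding hom_poly_def using S(1) by (intro exI[of _ "{k\<in>S. sum k UNIV = l}"] exI[of _ c]) auto
qed

lemma hom_poly_add: "hom_poly l p \<Longrightarrow> hom_poly l q \<Longrightarrow> hom_poly l (\<lambda>x. p x + q x)"
  by (intro hom_polyI real_polynomial_function.intros(3)) (auto intro: hom_poly_imp_rpf simp: hom_poly_scale algebra_simps)

lemma hom_poly_cmult: "hom_poly l p \<Longrightarrow> hom_poly l (\<lambda>x. c * p x)"
  by (intro hom_polyI rpf_cmult) (auto intro: hom_poly_imp_rpf simp: hom_poly_scale algebra_simps)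

lemma hom_poly_monom: "sum k UNIV = l \<Longrightarrow> hom_poly l (monom k)"
  by (intro hom_polyI) (auto simp: monom_scale)

lemma hom_poly_sum:
  "finite A \<Longrightarrow> (\<And>a. a \<in> A \<Longrightarrow> hom_poly l (f a)) \<Longrightarrow> hom_poly l (\<lambda>x. \<Sum>a\<in>A. f a x)"
  by (intro hom_polyI real_polynomial_function_sum)
    (auto intro: hom_poly_imp_rpf simp: hom_poly_scale sum_distrib_left intro!: sum.cong)

lemma sph_harm_rpf: "p \<in> sph_harm l \<Longrightarrow> real_polynomial_function p"
  by (auto simp: sph_harm_def intro: hom_poly_imp_rpf)

lemma sph_harm_add: "p \<in> sph_harm l \<Longrightarrow> q \<in> sph_harm l \<Longrightarrow> (\<lambda>x. p x + q x) \<in> sph_harm l"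
  by (auto simp: sph_harm_def hom_poly_add laplacian_add[OF hom_poly_imp_rpf hom_poly_imp_rpf])

lemma sph_harm_cmult: "p \<in> sph_harm l \<Longrightarrow> (\<lambda>x. c * p x) \<in> sph_harm l"
  by (auto simp: sph_harm_def hom_poly_cmult laplacian_cmult[OF hom_poly_imp_rpf])

lemma sph_harm_diff: "p \<in> sph_harm l \<Longrightarrow> q \<in> sph_harm l \<Longrightarrow> (\<lambda>x. p x - q x) \<in> sph_harm l"
  using sph_harm_add[of p l "\<lambda>x. (-1) * q x"] sph_harm_cmult[of q l "-1"] by simp

lemma sph_harm_sum:
  assumes "finite A" "\<And>a. a \<in> A \<Longrightarrow> f a \<in> sph_harm l"
  shows "(\<lambda>x. \<Sum>a\<in>A. f a x) \<in> sph_harm l"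
proof -
  have "hom_poly l (\<lambda>x. \<Sum>a\<in>A. f a x)"
    using assms by (intro hom_poly_sum) (auto simp: sph_harm_def)
  moreover have "laplacian (\<lambda>x. \<Sum>a\<in>A. f a x) x = 0" for x
    using assms by (subst laplacian_sum) (auto simp: sph_harm_def intro: hom_poly_imp_rpf)
  ultimately show ?thesis by (simp add: sph_harm_def)
qed

lemma sph_harm_orthogonal:
  fixes p :: "real^'n \<Rightarrow> real" and T :: "real^'n \<Rightarrow> real^'n"
  assumes "p \<in> sph_harm l" "orthogonal_transformation T"
  shows "(\<lambda>x. p (T x)) \<in> sph_harm l"
proof -
  have lin: "linear T" using assms orthogonal_transformation_linear by blast
  have p: "hom_poly l p" "\<And>x. laplacian p x = 0" using assms by (auto simp: sph_harm_def)
  have r: "real_polynomial_function p" using p(1) by (rule hom_poly_imp_rpf)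
  have "hom_poly l (\<lambda>x. p (T x))"
  proof (rule hom_polyI)
    show "real_polynomial_function (\<lambda>x. p (T x))" by (rule rpf_compose_linear[OF r lin])
    show "p (T (t *\<^sub>R x)) = t ^ l * p (T x)" for t x
      unfolding linear_scale[OF lin] by (rule hom_poly_scale[OF p(1)])
  qed
  moreover have "laplacian (\<lambda>x. p (T x)) x = 0" for x
    unfolding laplacian_orthogonal[OF r assms(2)] by (rule p(2))
  ultimately show ?thesis by (simp add: sph_harm_def)
qed

section \<open>Derivatives of homogeneous polynomials and the angular operators\<close>

lemma pd_compose_scale:
  fixes p :: "real^'n \<Rightarrow> real"
  assumes "real_polynomial_function p"
  shows "pd i (\<lambda>x. p (t *\<^sub>R x)) x = t * pd i p (t *\<^sub>R x)"
proof (rule pd_eqI)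
  have "((\<lambda>x. t *\<^sub>R x) has_derivative (\<lambda>v::real^'n. t *\<^sub>R v)) (at x)"
    by (auto intro!: derivative_eq_intros)
  from has_derivative_compose[OF this has_derivative_pd[OF assms]]
  show "((\<lambda>x. p (t *\<^sub>R x)) has_derivative (\<lambda>v. \<Sum>i\<in>UNIV. v $ i * (t * pd i p (t *\<^sub>R x)))) (at x)"
    by (simp add: algebra_simps)
qed

text \<open>Differentiate \<open>p (t x) = t ^ l * p x\<close> twice in \<open>x\<close>. Keeping
  \<open>t ^ 2\<close> on the left avoids the exponent \<open>l - 2\<close>, so degrees 0 and 1 are
  covered as well.\<close>

lemma laplacian_hom:
  fixes p :: "real^'n \<Rightarrow> real"
  assumes p: "hom_poly l p"
  shows "t ^ 2 * laplacian p (t *\<^sub>R x) = t ^ l * laplacian p x"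
proof -
  have r: "real_polynomial_function p" using p by (rule hom_poly_imp_rpf)
  have rt: "real_polynomial_function (\<lambda>x. f (t *\<^sub>R x))" if "real_polynomial_function f" for f :: "real^'n \<Rightarrow> real"
    by (rule rpf_compose_linear[OF that]) (simp add: linear_iff algebra_simps)
  have eq: "t * pd i p (t *\<^sub>R x) = t ^ l * pd i p x" for i x
  proof -
    have "(\<lambda>x. p (t *\<^sub>R x)) = (\<lambda>x. t ^ l * p x)" using hom_poly_scale[OF p] by auto
    then have "pd i (\<lambda>x. p (t *\<^sub>R x)) x = pd i (\<lambda>x. t ^ l * p x) x" by simp
    then show ?thesis by (simp only: pd_compose_scale[OF r] pd_cmult[OF r])
  qed
  have "t ^ 2 * pd i (pd i p) (t *\<^sub>R x) = t ^ l * pd i (pd i p) x" for i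
  proof -
    have "(\<lambda>x. t * pd i p (t *\<^sub>R x)) = (\<lambda>x. t ^ l * pd i p x)" using eq by auto
    then have "pd i (\<lambda>x. t * pd i p (t *\<^sub>R x)) x = pd i (\<lambda>x. t ^ l * pd i p x) x" by simp
    then show ?thesis
      by (simp only: pd_compose_scale[OF rpf_pd[OF r]] pd_cmult[OF rpf_pd[OF r]] pd_cmult[OF rt[OF rpf_pd[OF r]]])
        (simp add: power2_eq_square)
  qed
  then show ?thesis by (simp add: laplacian_eq_pd[OF r] sum_distrib_left)
qed

lemma hom_poly_laplacian:
  fixes p :: "real^'n \<Rightarrow> real"
  assumes p: "hom_poly (l + 2) p"
  shows "hom_poly l (laplacian p)"
proof (rule hom_polyI)
  fix t :: real and x :: "real^'n" assume "t > 0"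
  moreover have "t ^ 2 * laplacian p (t *\<^sub>R x) = t ^ 2 * (t ^ l * laplacian p x)"
    using laplacian_hom[OF p, of t x] by (simp only: power_add ac_simps)
  ultimately show "laplacian p (t *\<^sub>R x) = t ^ l * laplacian p x" by simp
qed (use p in \<open>auto intro: hom_poly_imp_rpf\<close>)

text \<open>Cancelling \<open>t ^ l\<close> in \<open>laplacian_hom\<close> gives
  \<open>t ^ (2 - l) * laplacian p (t x) = laplacian p x\<close> for \<open>t > 0\<close>, and the
  left side tends to 0 as \<open>t\<close> decreases to 0.\<close>

lemma laplacian_low_degree:
  fixes p :: "real^'n \<Rightarrow> real"
  assumes p: "hom_poly l p" and l: "l < 2"
  shows "laplacian p x = 0"
proof -
  have r: "real_polynomial_function p" using p by (rule hom_poly_imp_rpf)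
  have "continuous_on UNIV (\<lambda>t. t ^ (2 - l) * laplacian p (t *\<^sub>R x))"
    by (intro continuous_intros continuous_on_compose2[OF rpf_continuous_on[OF rpf_laplacian[OF r], of UNIV]]) auto
  then have "isCont (\<lambda>t. t ^ (2 - l) * laplacian p (t *\<^sub>R x)) 0"
    by (simp add: continuous_on_eq_continuous_at)
  then have "((\<lambda>t. t ^ (2 - l) * laplacian p (t *\<^sub>R x)) \<longlongrightarrow> 0 ^ (2 - l) * laplacian p (0 *\<^sub>R x)) (at_right 0)"
    unfolding isCont_def by (rule tendsto_mono[OF at_le, rotated]) simp
  moreover have "\<forall>\<^sub>F t in at_right 0. t ^ (2 - l) * laplacian p (t *\<^sub>R x) = laplacian p x"
  proof (rule eventually_at_right_less[THEN eventually_mono])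
    fix t :: real assume "0 < t"
    moreover have "t ^ l * (t ^ (2 - l) * laplacian p (t *\<^sub>R x)) = t ^ l * laplacian p x"
      using laplacian_hom[OF p, of t x] l by (simp flip: mult.assoc power_add)
    ultimately show "t ^ (2 - l) * laplacian p (t *\<^sub>R x) = laplacian p x" by simp
  qed
  ultimately have lim: "((\<lambda>t::real. laplacian p x) \<longlongrightarrow> 0 ^ (2 - l) * laplacian p (0 *\<^sub>R x)) (at_right 0)"
    by (rule Lim_transform_eventually)
  then show ?thesis
    using l tendsto_unique[OF _ lim tendsto_const] by (simp add: power_0_left)
qed

text \<open>Euler's identity: both sides are the derivative of \<open>p (t x) = t ^ l * p x\<close>
  at \<open>t = 1\<close>.\<close>

lemma hom_poly_euler:
  fixes p :: "real^'n \<Rightarrow> real"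
  assumes p: "hom_poly l p"
  shows "(\<Sum>i\<in>UNIV. x $ i * pd i p x) = real l * p x"
proof -
  have r: "real_polynomial_function p" using p by (rule hom_poly_imp_rpf)
  have "((\<lambda>t. t *\<^sub>R x) has_derivative (\<lambda>t. t *\<^sub>R x)) (at (1::real))"
    by (auto intro!: derivative_eq_intros)
  from has_derivative_compose[OF this has_derivative_pd[OF r]]
  have "((\<lambda>t. p (t *\<^sub>R x)) has_derivative (\<lambda>t. (\<Sum>i\<in>UNIV. x $ i * pd i p x) * t)) (at 1)"
    by (simp add: sum_distrib_right sum_distrib_left algebra_simps)
  then have 1: "((\<lambda>t. p (t *\<^sub>R x)) has_field_derivative (\<Sum>i\<in>UNIV. x $ i * pd i p x)) (at 1)"
    by (simp add: has_field_derivative_def)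
  have "((\<lambda>t. t ^ l * p x) has_field_derivative (real l * p x)) (at 1)"
    by (auto intro!: derivative_eq_intros)
  then have "((\<lambda>t. p (t *\<^sub>R x)) has_field_derivative (real l * p x)) (at 1)"
    by (simp add: hom_poly_scale[OF p])
  from DERIV_unique[OF 1 this] show ?thesis .
qed

text \<open>The angular momentum operator, which generates the rotations in the plane of the
  coordinates \<open>i\<close> and \<open>j\<close>. It differentiates along centred spheres, so it
  can be integrated by parts on the sphere.\<close>

definition ang_deriv :: "'n \<Rightarrow> 'n \<Rightarrow> (real^'n::finite \<Rightarrow> real) \<Rightarrow> real^'n \<Rightarrow> real" where
  "ang_deriv i j p x = x $ i * pd j p x - x $ j * pd i p x"

lemma rpf_ang_deriv [intro, simp]:
  fixes p :: "real^'n \<Rightarrow> real"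
  assumes "real_polynomial_function p"
  shows "real_polynomial_function (ang_deriv i j p)"
proof -
  have "ang_deriv i j p = (\<lambda>x. x $ i * pd j p x - x $ j * pd i p x)" by (auto simp: ang_deriv_def)
  then show ?thesis using assms
    by (auto intro!: real_polynomial_function_diff real_polynomial_function.intros(4))
qed

lemma ang_deriv_mult:
  fixes f g :: "real^'n \<Rightarrow> real"
  assumes "real_polynomial_function f" "real_polynomial_function g"
  shows "ang_deriv i j (\<lambda>x. f x * g x) x = f x * ang_deriv i j g x + ang_deriv i j f x * g x"
  by (simp add: ang_deriv_def pd_mult[OF assms] algebra_simps)

lemma pd_nth_mult:
  fixes f :: "real^'n \<Rightarrow> real"
  assumes "real_polynomial_function f"
  shows "pd i (\<lambda>x. x $ j * f x) x = x $ j * pd i f x + (if i = j then f x else 0)"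
  using pd_mult[OF rpf_nth assms] by (simp add: pd_nth)

text \<open>The polar decomposition of the Laplacian: with the Euler operator E, |x|^2 times the
  Laplacian is the angular part plus E^2 + (CARD('n) - 2) E, and E multiplies degree
  \<open>l\<close> by \<open>l\<close>. The factor 2 comes from summing over ordered pairs.\<close>

lemma sum_ang_deriv_ang_deriv:
  fixes p :: "real^'n \<Rightarrow> real"
  assumes p: "hom_poly l p"
  shows "(\<Sum>i\<in>UNIV. \<Sum>j\<in>UNIV. ang_deriv i j (ang_deriv i j p) x)
    = 2 * ((norm x)\<^sup>2 * laplacian p x - real l * (real l + real CARD('n) - 2) * p x)"
proof -
  have r: "real_polynomial_function p" using p by (rule hom_poly_imp_rpf)
  note r1 = rpf_pd[OF r]
  have rm: "real_polynomial_function (\<lambda>x. x $ i * pd j p x)" for i j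
    using r1 by (auto intro!: real_polynomial_function.intros(4))
  have pdL: "pd k (ang_deriv i j p) x = x $ i * pd k (pd j p) x + (if k = i then pd j p x else 0)
      - (x $ j * pd k (pd i p) x + (if k = j then pd i p x else 0))" for i j k
  proof -
    have "ang_deriv i j p = (\<lambda>x. x $ i * pd j p x - x $ j * pd i p x)" by (auto simp: ang_deriv_def)
    then show ?thesis by (simp add: pd_diff[OF rm rm] pd_nth_mult[OF r1])
  qed
  have E: "(\<Sum>i\<in>UNIV. x $ i * pd i p x) = real l * p x" for x
    by (rule hom_poly_euler[OF p])
  \<comment> \<open>Differentiating Euler's identity once more gives l (l - 1) p for the pure
    second-order sum.\<close>
  have E2: "(\<Sum>i\<in>UNIV. \<Sum>j\<in>UNIV. x $ i * (x $ j * pd i (pd j p) x)) = real l * real l * p x - real l * p x"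
  proof -
    have "(\<lambda>x. \<Sum>j\<in>UNIV. x $ j * pd j p x) = (\<lambda>x. real l * p x)" using E by auto
    then have "pd i (\<lambda>x. \<Sum>j\<in>UNIV. x $ j * pd j p x) x = pd i (\<lambda>x. real l * p x) x" for i by simp
    then have *: "(\<Sum>j\<in>UNIV. x $ j * pd i (pd j p) x) + pd i p x = real l * pd i p x" for i
      using rm by (subst (asm) pd_sum) (auto simp: pd_cmult[OF r] pd_nth_mult[OF r1] sum.distrib)
    have "(\<Sum>i\<in>UNIV. x $ i * ((\<Sum>j\<in>UNIV. x $ j * pd i (pd j p) x) + pd i p x)) = real l * (real l * p x)"
      unfolding * E[symmetric] sum_distrib_left by (simp add: mult.left_commute)
    then show ?thesis
      by (simp add: distrib_left sum.distrib E sum_distrib_left)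
  qed
  have E2': "(\<Sum>i\<in>UNIV. \<Sum>j\<in>UNIV. x $ i * (x $ j * pd j (pd i p) x)) = real l * real l * p x - real l * p x"
    unfolding E2[symmetric] by (subst sum.swap) (simp add: mult.left_commute)
  have N: "(\<Sum>i\<in>UNIV. x $ i * x $ i) = (norm x)\<^sup>2"
    by (simp add: power2_norm_eq_inner inner_vec_def)
  have lap1: "(\<Sum>i\<in>UNIV. \<Sum>j\<in>UNIV. x $ i * (x $ i * pd j (pd j p) x)) = (norm x)\<^sup>2 * laplacian p x"
    unfolding N[symmetric] laplacian_eq_pd[OF r] sum_product by (simp add: mult.assoc)
  have lap2: "(\<Sum>i\<in>UNIV. \<Sum>j\<in>UNIV. x $ j * (x $ j * pd i (pd i p) x)) = (norm x)\<^sup>2 * laplacian p x"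
    unfolding lap1[symmetric] by (rule sum.swap)
  have LL: "ang_deriv i j (ang_deriv i j p) x =
      x $ i * (x $ i * pd j (pd j p) x) + x $ j * (x $ j * pd i (pd i p) x)
      - x $ i * (x $ j * pd j (pd i p) x) - x $ i * (x $ j * pd i (pd j p) x)
      + (if i = j then 2 * (x $ i * pd i p x) else 0) - x $ i * pd i p x - x $ j * pd j p x" for i j
    unfolding ang_deriv_def[of i j "ang_deriv i j p"] pdL by (simp add: algebra_simps)
  have "(\<Sum>i\<in>UNIV. \<Sum>j\<in>UNIV. ang_deriv i j (ang_deriv i j p) x) =
      (norm x)\<^sup>2 * laplacian p x + (norm x)\<^sup>2 * laplacian p x
      - (real l * real l * p x - real l * p x) - (real l * real l * p x - real l * p x)
      + 2 * (real l * p x) - real CARD('n) * (real l * p x) - real CARD('n) * (real l * p x)"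
    unfolding LL sum.distrib sum_subtractf lap1 lap2 E2 E2' by (simp add: sum_distrib_left[symmetric] E)
  then show ?thesis by (simp add: algebra_simps)
qed

section \<open>Rotations and orthogonality of harmonics\<close>

text \<open>Written as the identity plus a correction, so that the derivative in \<theta> can be
  taken term by term. It is a rotation only for distinct \<open>i\<close> and \<open>j\<close>; the
  case \<open>i = j\<close> is treated separately, where \<open>ang_deriv i i\<close>
  vanishes.\<close>

definition rot :: "'n \<Rightarrow> 'n \<Rightarrow> real \<Rightarrow> real^'n::finite \<Rightarrow> real^'n" where
  "rot i j \<theta> x = x + ((cos \<theta> - 1) * x $ i - sin \<theta> * x $ j) *\<^sub>R axis i 1
                   + ((cos \<theta> - 1) * x $ j + sin \<theta> * x $ i) *\<^sub>R axis j 1"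

lemma rot_nth:
  assumes "i \<noteq> j"
  shows "rot i j \<theta> x $ k = (if k = i then cos \<theta> * x $ i - sin \<theta> * x $ j
    else if k = j then cos \<theta> * x $ j + sin \<theta> * x $ i else x $ k)"
  using assms by (auto simp: rot_def axis_def algebra_simps)

lemma orthogonal_rot:
  assumes "i \<noteq> j"
  shows "orthogonal_transformation (rot i j \<theta>)"
proof -
  have "linear (rot i j \<theta>)"
    by (rule linearI) (auto simp: vec_eq_iff rot_nth[OF assms] algebra_simps)
  moreover have "norm (rot i j \<theta> v) = norm v" for v
  proof -
    have split: "(\<Sum>k\<in>UNIV. f k) = f i + f j + (\<Sum>k\<in>UNIV - {i, j}. f k)" for f :: "_ \<Rightarrow> real"
      using assms by (subst sum.subset_diff[of "{i, j}" UNIV]) auto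
    have "rot i j \<theta> v \<bullet> rot i j \<theta> v = v \<bullet> v"
    proof -
      have "rot i j \<theta> v \<bullet> rot i j \<theta> v = (cos \<theta> * v $ i - sin \<theta> * v $ j)\<^sup>2 + (cos \<theta> * v $ j + sin \<theta> * v $ i)\<^sup>2
          + (\<Sum>k\<in>UNIV - {i, j}. v $ k * v $ k)"
        using assms by (simp add: inner_vec_def split rot_nth power2_eq_square)
      also have "(cos \<theta> * v $ i - sin \<theta> * v $ j)\<^sup>2 + (cos \<theta> * v $ j + sin \<theta> * v $ i)\<^sup>2
          = ((cos \<theta>)\<^sup>2 + (sin \<theta>)\<^sup>2) * ((v $ i)\<^sup>2 + (v $ j)\<^sup>2)"
        by algebra
      finally show ?thesis
        by (simp add: inner_vec_def split power2_eq_square)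
    qed
    then show ?thesis by (simp add: norm_eq_sqrt_inner)
  qed
  ultimately show ?thesis by (simp add: orthogonal_transformation)
qed

text \<open>Stated at every angle, with the derivative evaluated at the rotated point, because the
  mean value theorem is later applied along the whole orbit.\<close>

lemma rot_derivative:
  fixes W :: "real^'n \<Rightarrow> real"
  assumes W: "real_polynomial_function W" and ij: "i \<noteq> j"
  shows "((\<lambda>\<theta>. W (rot i j \<theta> x)) has_field_derivative ang_deriv i j W (rot i j \<theta> x)) (at \<theta>)"
proof -
  have "((\<lambda>\<theta>. rot i j \<theta> x) has_derivative
      (\<lambda>h. (- (sin \<theta> * h) * x $ i - cos \<theta> * h * x $ j) *\<^sub>R axis i 1
         + (- (sin \<theta> * h) * x $ j + cos \<theta> * h * x $ i) *\<^sub>R axis j 1)) (at \<theta>)"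
    unfolding rot_def by (auto intro!: derivative_eq_intros simp: algebra_simps)
  also have "(\<lambda>h. (- (sin \<theta> * h) * x $ i - cos \<theta> * h * x $ j) *\<^sub>R axis i 1
         + (- (sin \<theta> * h) * x $ j + cos \<theta> * h * x $ i) *\<^sub>R axis j 1 :: real^'n)
      = (\<lambda>h. h *\<^sub>R (- (rot i j \<theta> x $ j) *\<^sub>R axis i 1 + (rot i j \<theta> x $ i) *\<^sub>R axis j 1))"
    using ij by (auto simp: rot_nth fun_eq_iff vec_eq_iff axis_def algebra_simps)
  finally have "((\<lambda>\<theta>. rot i j \<theta> x) has_derivative
      (\<lambda>h. h *\<^sub>R (- (rot i j \<theta> x $ j) *\<^sub>R axis i 1 + (rot i j \<theta> x $ i) *\<^sub>R axis j 1))) (at \<theta>)" .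
  from has_derivative_compose[OF this has_derivative_pd[OF W]]
  have "((\<lambda>\<theta>. W (rot i j \<theta> x)) has_derivative
      (\<lambda>h. \<Sum>k\<in>UNIV. (h *\<^sub>R (- (rot i j \<theta> x $ j) *\<^sub>R axis i 1 + (rot i j \<theta> x $ i) *\<^sub>R axis j 1)) $ k
        * pd k W (rot i j \<theta> x))) (at \<theta>)" .
  also have "(\<lambda>h. \<Sum>k\<in>UNIV. (h *\<^sub>R (- (rot i j \<theta> x $ j) *\<^sub>R axis i 1 + (rot i j \<theta> x $ i) *\<^sub>R axis j 1)) $ k
        * pd k W (rot i j \<theta> x)) = (\<lambda>h. ang_deriv i j W (rot i j \<theta> x) * h)"
  proof
    fix h
    define y where "y = rot i j \<theta> x"
    have "(\<Sum>k\<in>UNIV. (h *\<^sub>R (- (y $ j) *\<^sub>R axis i 1 + (y $ i) *\<^sub>R axis j 1)) $ k * pd k W y)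
        = (\<Sum>k\<in>UNIV. (if k = i then - (h * y $ j * pd k W y) else 0) + (if k = j then h * y $ i * pd k W y else 0))"
      using ij by (intro sum.cong refl) (auto simp: axis_def)
    also have "\<dots> = ang_deriv i j W y * h"
      by (simp add: sum.distrib ang_deriv_def algebra_simps)
    finally show "(\<Sum>k\<in>UNIV. (h *\<^sub>R (- (rot i j \<theta> x $ j) *\<^sub>R axis i 1 + (rot i j \<theta> x $ i) *\<^sub>R axis j 1)) $ k
        * pd k W (rot i j \<theta> x)) = ang_deriv i j W (rot i j \<theta> x) * h"
      by (simp add: y_def)
  qed
  finally show ?thesis by (simp add: has_field_derivative_def)
qed

lemma rot_0 [simp]: "rot i j 0 x = x"
  by (simp add: rot_def)

text \<open>Integrals of rotated functions do not depend on the angle, so the difference quotients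
  of \<open>W\<close> along rotations integrate to 0. They converge to the angular derivative, and
  dominated convergence passes to the limit.\<close>

lemma sphere_integral_ang_deriv:
  fixes W :: "real^'n \<Rightarrow> real"
  assumes W: "real_polynomial_function W"
  shows "(\<integral>x. ang_deriv i j W x \<partial>sphere_measure) = 0"
proof (cases "i = j")
  case True
  then show ?thesis by (simp add: ang_deriv_def)
next
  case ij: False
  have rL: "real_polynomial_function (ang_deriv i j W)" using W by simp
  have "bounded (ang_deriv i j W ` sphere 0 1)"
    by (intro compact_imp_bounded compact_continuous_image rpf_continuous_on rL) auto
  then obtain B where "\<forall>y\<in>ang_deriv i j W ` sphere 0 1. norm y \<le> B"
    by (meson bounded_iff)
  then have B: "\<And>x. x \<in> sphere 0 1 \<Longrightarrow> \<bar>ang_deriv i j W x\<bar> \<le> B"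
    by auto
  define h where "h = (\<lambda>n::nat. 1 / (real n + 1))"
  have h: "h n > 0" for n by (simp add: h_def)
  have h0: "h \<longlonglongrightarrow> 0"
    unfolding h_def using LIMSEQ_inverse_real_of_nat by (simp only: inverse_eq_divide of_nat_Suc add.commute)
  define s where "s = (\<lambda>n x. (W (rot i j (h n) x) - W x) / h n)"
  have contr: "continuous_on (sphere 0 1) (\<lambda>x. W (rot i j \<theta> x))" for \<theta>
    by (rule rpf_continuous_on[OF rpf_compose_linear[OF W orthogonal_transformation_linear[OF orthogonal_rot[OF ij]]]])
  have lim: "(\<lambda>n. s n x) \<longlonglongrightarrow> ang_deriv i j W x" for x
  proof -
    have "((\<lambda>\<theta>. (W (rot i j \<theta> x) - W x) / \<theta>) \<longlongrightarrow> ang_deriv i j W x) (at 0)"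
      using rot_derivative[OF W ij, of x 0] by (simp add: has_field_derivative_iff)
    moreover have "filterlim h (at 0) sequentially"
      using h0 h by (auto simp: filterlim_at intro!: always_eventually less_imp_neq[symmetric])
    ultimately show ?thesis
      unfolding s_def by (rule filterlim_compose)
  qed
  \<comment> \<open>By the mean value theorem the quotient is the angular derivative at another
    point of the same orbit, hence of the sphere, where it is at most \<open>B\<close>.\<close>
  have bound: "norm (s n x) \<le> B" if x: "x \<in> sphere 0 1" for n x
  proof -
    have "\<exists>z>0. z < h n \<and> W (rot i j (h n) x) - W (rot i j 0 x) = (h n - 0) * ang_deriv i j W (rot i j z x)"
      using h by (intro MVT2 rot_derivative W ij)
    then obtain z where z: "W (rot i j (h n) x) - W x = h n * ang_deriv i j W (rot i j z x)" by auto
    have "\<bar>ang_deriv i j W (rot i j z x)\<bar> \<le> B"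
      using x orthogonal_transformation_norm[OF orthogonal_rot[OF ij]] by (intro B) simp
    then show ?thesis using h[of n] by (simp add: s_def z)
  qed
  have conts: "continuous_on (sphere 0 1) (s n)" for n
    unfolding s_def using h[of n] by (intro continuous_intros contr rpf_continuous_on W) auto
  have "(\<lambda>n. \<integral>x. s n x \<partial>sphere_measure) \<longlonglongrightarrow> (\<integral>x. ang_deriv i j W x \<partial>sphere_measure)"
    by (rule integral_dominated_convergence[where w="\<lambda>_. B"])
       (auto intro!: borel_measurable_sphere rpf_continuous_on rL conts integrable_sphere continuous_intros lim
          bound[simplified] AE_I2)
  moreover have "(\<integral>x. s n x \<partial>sphere_measure) = 0" for n
  proof -
    have "(\<integral>x. W (rot i j (h n) x) \<partial>sphere_measure) = (\<integral>x. W x \<partial>sphere_measure)"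
      by (intro sphere_integral_rotate orthogonal_rot ij rpf_continuous_on W)
    then show ?thesis
      unfolding s_def
      by (simp add: Bochner_Integration.integral_diff integrable_sphere contr rpf_continuous_on W)
  qed
  ultimately have "(\<lambda>n::nat. 0) \<longlonglongrightarrow> (\<integral>x. ang_deriv i j W x \<partial>sphere_measure)"
    by (simp only:)
  then show ?thesis by (simp add: LIMSEQ_const_iff)
qed

section \<open>The inner product on the sphere and the Casimir operator\<close>

definition sip :: "(real^'n::finite \<Rightarrow> real) \<Rightarrow> (real^'n \<Rightarrow> real) \<Rightarrow> real" where
  "sip f g = (\<integral>x. f x * g x \<partial>sphere_measure)"

lemma sip_commute: "sip f g = sip g f"
  by (simp add: sip_def mult.commute)

lemma rpf_integrable_sphere: "real_polynomial_function p \<Longrightarrow> integrable sphere_measure p"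
  for p :: "real^'n \<Rightarrow> real"
  by (intro integrable_sphere rpf_continuous_on)

lemma rpf_mult: "real_polynomial_function f \<Longrightarrow> real_polynomial_function g \<Longrightarrow> real_polynomial_function (\<lambda>x. f x * g x)"
  by (rule real_polynomial_function.intros(4))

lemma sip_add:
  fixes f g h :: "real^'n \<Rightarrow> real"
  assumes "real_polynomial_function f" "real_polynomial_function g" "real_polynomial_function h"
  shows "sip (\<lambda>x. f x + g x) h = sip f h + sip g h"
  using assms by (simp add: sip_def distrib_right rpf_integrable_sphere rpf_mult)

lemma sip_diff:
  fixes f g h :: "real^'n \<Rightarrow> real"
  assumes "real_polynomial_function f" "real_polynomial_function g" "real_polynomial_function h"
  shows "sip (\<lambda>x. f x - g x) h = sip f h - sip g h"
  using assms by (simp add: sip_def left_diff_distrib rpf_integrable_sphere rpf_mult)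

lemma sip_cmult: "sip (\<lambda>x. c * f x) h = c * sip f h"
  by (simp add: sip_def mult.assoc)

lemma sip_sum:
  fixes f :: "'a \<Rightarrow> real^'n \<Rightarrow> real"
  assumes "finite A" "\<And>a. a \<in> A \<Longrightarrow> real_polynomial_function (f a)" "real_polynomial_function h"
  shows "sip (\<lambda>x. \<Sum>a\<in>A. f a x) h = (\<Sum>a\<in>A. sip (f a) h)"
  using assms by (simp add: sip_def sum_distrib_right rpf_integrable_sphere rpf_mult)

lemma sip_sum_cmult:
  fixes f :: "'a \<Rightarrow> real^'n \<Rightarrow> real"
  assumes "finite A" "\<And>a. a \<in> A \<Longrightarrow> real_polynomial_function (f a)" "real_polynomial_function h"
  shows "sip (\<lambda>x. \<Sum>a\<in>A. c a * f a x) h = (\<Sum>a\<in>A. c a * sip (f a) h)"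
proof -
  have "sip (\<lambda>x. \<Sum>a\<in>A. c a * f a x) h = (\<Sum>a\<in>A. sip (\<lambda>x. c a * f a x) h)"
    using assms by (intro sip_sum rpf_cmult)
  then show ?thesis by (simp only: sip_cmult)
qed

lemma sip_nonneg: "sip f f \<ge> 0"
  by (simp add: sip_def)

lemma sip_cong: "(\<And>x. x \<in> sphere 0 1 \<Longrightarrow> f x = f' x) \<Longrightarrow> (\<And>x. x \<in> sphere 0 1 \<Longrightarrow> g x = g' x) \<Longrightarrow> sip f g = sip f' g'"
  unfolding sip_def by (intro Bochner_Integration.integral_cong) auto

lemma sip_eq_0:
  fixes f :: "real^'n \<Rightarrow> real"
  assumes "real_polynomial_function f" "sip f f = 0" "x \<in> sphere 0 1"
  shows "f x = 0"
  by (rule sphere_integral_sq_eq_0[OF rpf_continuous_on[OF assms(1)] assms(2)[unfolded sip_def] assms(3)])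

lemma sip_rotate:
  fixes f g :: "real^'n \<Rightarrow> real" and T :: "real^'n \<Rightarrow> real^'n"
  assumes "real_polynomial_function f" "real_polynomial_function g" "orthogonal_transformation T"
  shows "sip (\<lambda>x. f (T x)) (\<lambda>x. g (T x)) = sip f g"
  unfolding sip_def by (rule sphere_integral_rotate[OF assms(3) rpf_continuous_on[OF rpf_mult[OF assms(1,2)]]])

text \<open>Integration by parts: the angular derivative of the product integrates to 0, and the
  Leibniz rule splits it.\<close>

lemma sip_ang_deriv:
  fixes f g :: "real^'n \<Rightarrow> real"
  assumes f: "real_polynomial_function f" and g: "real_polynomial_function g"
  shows "sip (ang_deriv i j f) g = - sip f (ang_deriv i j g)"
proof -
  have "(\<integral>x. ang_deriv i j (\<lambda>x. f x * g x) x \<partial>sphere_measure) = sip f (ang_deriv i j g) + sip (ang_deriv i j f) g"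
    using f g by (simp add: ang_deriv_mult sip_def rpf_integrable_sphere rpf_mult)
  moreover have "(\<integral>x. ang_deriv i j (\<lambda>x. f x * g x) x \<partial>sphere_measure) = 0"
    by (rule sphere_integral_ang_deriv[OF rpf_mult[OF f g]])
  ultimately show ?thesis by simp
qed

text \<open>Summing over all ordered pairs \<open>(i, j)\<close> gives twice the spherical Laplacian.\<close>
definition casimir :: "(real^'n::finite \<Rightarrow> real) \<Rightarrow> real^'n \<Rightarrow> real" where
  "casimir p x = (\<Sum>i\<in>UNIV. \<Sum>j\<in>UNIV. ang_deriv i j (ang_deriv i j p) x)"

lemma sip_casimir:
  fixes f g :: "real^'n \<Rightarrow> real"
  assumes f: "real_polynomial_function f" and g: "real_polynomial_function g"
  shows "sip (casimir f) g = sip f (casimir g)"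
proof -
  have a: "sip (casimir f) g = (\<Sum>i\<in>UNIV. \<Sum>j\<in>UNIV. sip (ang_deriv i j (ang_deriv i j f)) g)"
    if "real_polynomial_function f" "real_polynomial_function g" for f g :: "real^'n \<Rightarrow> real"
  proof -
    have "sip (casimir f) g = (\<Sum>i\<in>UNIV. sip (\<lambda>x. \<Sum>j\<in>UNIV. ang_deriv i j (ang_deriv i j f) x) g)"
      unfolding casimir_def[abs_def] using that
      by (intro sip_sum) (auto intro!: real_polynomial_function_sum)
    also have "\<dots> = (\<Sum>i\<in>UNIV. \<Sum>j\<in>UNIV. sip (ang_deriv i j (ang_deriv i j f)) g)"
      using that by (intro sum.cong refl sip_sum) auto
    finally show ?thesis .
  qed
  have "sip (ang_deriv i j (ang_deriv i j f)) g = sip (ang_deriv i j (ang_deriv i j g)) f" for i j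
    using sip_ang_deriv[of "ang_deriv i j f" g i j] sip_ang_deriv[of f "ang_deriv i j g" i j] f g by (simp add: sip_commute)
  then show ?thesis
    by (subst (2) sip_commute) (simp add: a f g)
qed

text \<open>With d = CARD('n) - 1 this is -2 l (l + d - 1), twice the eigenvalue of the spherical
  Laplacian on degree \<open>l\<close>.\<close>

definition casimir_ev :: "'n::finite itself \<Rightarrow> nat \<Rightarrow> real" where
  "casimir_ev _ l = - 2 * (real l * (real l + real CARD('n) - 2))"

lemma casimir_hom:
  fixes p :: "real^'n \<Rightarrow> real"
  assumes "hom_poly l p" "x \<in> sphere 0 1"
  shows "casimir p x = 2 * laplacian p x + casimir_ev TYPE('n) l * p x"
  using sum_ang_deriv_ang_deriv[OF assms(1), of x] assms(2) by (simp add: casimir_def casimir_ev_def algebra_simps)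

lemma casimir_sph_harm:
  fixes p :: "real^'n \<Rightarrow> real"
  assumes "p \<in> sph_harm l" "x \<in> sphere 0 1"
  shows "casimir p x = casimir_ev TYPE('n) l * p x"
  using casimir_hom[of l p x] assms by (simp add: sph_harm_def)

text \<open>A coincidence would mean (k - l) (k + l + d - 1) = 0 with d = CARD('n) - 1, and the
  second factor is positive for d >= 2.\<close>

lemma casimir_ev_inj:
  assumes "k \<noteq> l" "CARD('n::finite) \<ge> 3"
  shows "casimir_ev TYPE('n) k \<noteq> casimir_ev TYPE('n) l"
proof
  assume "casimir_ev TYPE('n) k = casimir_ev TYPE('n) l"
  then have "(real k - real l) * (real k + real l + (real CARD('n) - 2)) = 0"
    by (simp add: casimir_ev_def algebra_simps)
  then show False using assms by auto
qed

text \<open>Self-adjointness of the Casimir operator reduces the pairing with \<open>q\<close> to the pairing with its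
  Laplacian, which has smaller degree.\<close>
lemma sph_harm_orth_lower:
  fixes p q :: "real^'n \<Rightarrow> real"
  assumes n3: "CARD('n) \<ge> 3" and p: "p \<in> sph_harm l" and "hom_poly k q" "k < l"
  shows "sip q p = 0"
  using assms(3,4)
proof (induction k arbitrary: q rule: less_induct)
  case (less k)
  have rp: "real_polynomial_function p" using p by (rule sph_harm_rpf)
  have rq: "real_polynomial_function q" using less.prems(1) by (rule hom_poly_imp_rpf)
  have rl: "real_polynomial_function (laplacian q)" using rq by auto
  have lap: "sip (laplacian q) p = 0"
  proof (cases "k < 2")
    case True
    then show ?thesis using laplacian_low_degree[OF less.prems(1)] by (simp add: sip_def)
  next
    case False
    then have "k - 2 + 2 = k" by simp
    with less.prems(1) have "hom_poly (k - 2) (laplacian q)"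
      by (intro hom_poly_laplacian) (simp only:)
    from less.IH[OF _ this] show ?thesis using False less.prems(2) by simp
  qed
  have "sip (casimir q) p = sip (\<lambda>x. 2 * laplacian q x + casimir_ev TYPE('n) k * q x) p"
    by (intro sip_cong casimir_hom less.prems) auto
  also have "\<dots> = casimir_ev TYPE('n) k * sip q p"
    using rq rp rl by (simp add: sip_add sip_cmult rpf_cmult lap)
  finally have 1: "sip (casimir q) p = casimir_ev TYPE('n) k * sip q p" .
  have "sip q (casimir p) = sip q (\<lambda>x. casimir_ev TYPE('n) l * p x)"
    by (intro sip_cong casimir_sph_harm p) auto
  also have "\<dots> = casimir_ev TYPE('n) l * sip q p"
    by (subst (1 2) sip_commute) (rule sip_cmult)
  finally have "casimir_ev TYPE('n) k * sip q p = casimir_ev TYPE('n) l * sip q p"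
    using 1 sip_casimir[OF rq rp] by (simp only:)
  then show ?case using casimir_ev_inj[of k l] n3 less.prems(2) by auto
qed

lemma sph_harm_orth:
  fixes p q :: "real^'n \<Rightarrow> real"
  assumes "CARD('n) \<ge> 3" "p \<in> sph_harm l" "q \<in> sph_harm k" "k \<noteq> l"
  shows "sip q p = 0"
proof (cases "k < l")
  case True
  then show ?thesis using sph_harm_orth_lower assms by (auto simp: sph_harm_def)
next
  case False
  then have "sip p q = 0" using sph_harm_orth_lower[of q k l p] assms by (auto simp: sph_harm_def)
  then show ?thesis by (simp add: sip_commute)
qed

section \<open>Orthonormal bases of harmonics and their dimension\<close>

text \<open>Elimination of one equation at a time: a pivot \<open>b\<close> removes equation
  \<open>e\<close> from the other columns, and the value of the solution at \<open>b\<close> is then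
  determined by \<open>e\<close>. Both the existence of orthonormal bases and the dimension bound
  rest on this count.\<close>

lemma homogeneous_system_nontrivial:
  fixes c :: "'a \<Rightarrow> 'b \<Rightarrow> real"
  assumes "finite E" "finite A" "card E < card A"
  shows "\<exists>t. (\<exists>a\<in>A. t a \<noteq> 0) \<and> (\<forall>i\<in>E. (\<Sum>a\<in>A. t a * c a i) = 0)"
  using assms
proof (induction E arbitrary: A c rule: finite_induct)
  case empty
  then have "A \<noteq> {}" by auto
  then show ?case by (intro exI[of _ "\<lambda>_. 1"]) auto
next
  case (insert e E)
  show ?case
  proof (cases "\<forall>a\<in>A. c a e = 0")
    case True
    have "card E < card A" using insert by auto
    then obtain t where "\<exists>a\<in>A. t a \<noteq> 0" "\<forall>i\<in>E. (\<Sum>a\<in>A. t a * c a i) = 0"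
      using insert.IH[OF insert.prems(1), of c] by blast
    with True show ?thesis by (intro exI[of _ t]) auto
  next
    case False
    then obtain b where b: "b \<in> A" "c b e \<noteq> 0" by auto
    define A' where "A' = A - {b}"
    have A': "finite A'" "card E < card A'" "A = Set.insert b A'" "b \<notin> A'"
      using insert b by (auto simp: A'_def)
    obtain t where t: "\<exists>a\<in>A'. t a \<noteq> 0"
      "\<And>i. i \<in> E \<Longrightarrow> (\<Sum>a\<in>A'. t a * (c a i - c a e / c b e * c b i)) = 0"
      using insert.IH[OF A'(1,2), of "\<lambda>a i. c a i - c a e / c b e * c b i"] by blast
    define t' where "t' = t (b := - (\<Sum>a\<in>A'. t a * c a e) / c b e)"
    have sum': "(\<Sum>a\<in>A. t' a * c a i) = (\<Sum>a\<in>A'. t a * c a i) - (\<Sum>a\<in>A'. t a * c a e) / c b e * c b i" for i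
    proof -
      have "(\<Sum>a\<in>A'. t' a * c a i) = (\<Sum>a\<in>A'. t a * c a i)"
        using A'(4) by (intro sum.cong) (auto simp: t'_def)
      then show ?thesis using A' by (simp add: t'_def)
    qed
    have "(\<Sum>a\<in>A. t' a * c a i) = 0" if "i \<in> Set.insert e E" for i
    proof (cases "i = e")
      case True
      then show ?thesis using b by (simp add: sum')
    next
      case False
      with that have "i \<in> E" by auto
      from t(2)[OF this] show ?thesis
        by (simp add: sum' right_diff_distrib sum_subtractf sum_distrib_left sum_distrib_right sum_divide_distrib
            mult_ac)
    qed
    moreover have "\<exists>a\<in>A. t' a \<noteq> 0"
      using t(1) A'(3,4) by (auto simp: t'_def)
    ultimately show ?thesis by blast
  qed
qed

text \<open>A longest orthonormal system exists, since one longer than \<open>card G\<close> would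
  be linearly dependent, and maximality forces every residual to have length 0. \<open>B\<close> is
  only semidefinite, so the conclusion concerns the length of the residual. This form serves
  integrals over the sphere as well as sums over a part of an index set.\<close>

lemma finite_onb:
  fixes V :: "('a \<Rightarrow> real) set" and B :: "('a \<Rightarrow> real) \<Rightarrow> ('a \<Rightarrow> real) \<Rightarrow> real"
    and g :: "'b \<Rightarrow> 'a \<Rightarrow> real"
  assumes G: "finite G" and span: "\<And>v. v \<in> V \<Longrightarrow> \<exists>c. \<forall>x. v x = (\<Sum>j\<in>G. c j * g j x)"
    and zero: "(\<lambda>x. 0) \<in> V"
    and add: "\<And>u v. u \<in> V \<Longrightarrow> v \<in> V \<Longrightarrow> (\<lambda>x. u x + v x) \<in> V"
    and cmult: "\<And>c v. v \<in> V \<Longrightarrow> (\<lambda>x. c * v x) \<in> V"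
    and B_sym: "\<And>u v. u \<in> V \<Longrightarrow> v \<in> V \<Longrightarrow> B u v = B v u"
    and B_add: "\<And>u v w. u \<in> V \<Longrightarrow> v \<in> V \<Longrightarrow> w \<in> V \<Longrightarrow> B (\<lambda>x. u x + v x) w = B u w + B v w"
    and B_cmult: "\<And>c v w. v \<in> V \<Longrightarrow> w \<in> V \<Longrightarrow> B (\<lambda>x. c * v x) w = c * B v w"
    and B_nonneg: "\<And>v. v \<in> V \<Longrightarrow> B v v \<ge> 0"
  obtains r e where "r \<le> card G" "\<And>s. s < r \<Longrightarrow> e s \<in> V"
    "\<And>s t. s < r \<Longrightarrow> t < r \<Longrightarrow> B (e s) (e t) = (if s = t then 1 else 0)"
    "\<And>v. v \<in> V \<Longrightarrow> B (\<lambda>x. v x - (\<Sum>s<r. B v (e s) * e s x)) (\<lambda>x. v x - (\<Sum>s<r. B v (e s) * e s x)) = 0"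
proof -
  have V_sum: "(\<lambda>x. \<Sum>a\<in>A. c a * f a x) \<in> V" if "finite A" "\<And>a. a \<in> A \<Longrightarrow> f a \<in> V"
    for A :: "nat set" and c f
    using that by (induction A rule: finite_induct) (auto simp: zero intro!: add cmult)
  have B_zero: "B (\<lambda>x. 0) w = 0" if "w \<in> V" for w
    using B_cmult[OF that that, of 0] by simp
  have B_sum: "B (\<lambda>x. \<Sum>a\<in>A. c a * f a x) w = (\<Sum>a\<in>A. c a * B (f a) w)"
    if "finite A" "\<And>a. a \<in> A \<Longrightarrow> f a \<in> V" "w \<in> V" for A :: "nat set" and c f w
    using that
  proof (induction A rule: finite_induct)
    case empty
    then show ?case by (simp add: B_zero)
  next
    case (insert a A)
    have "(\<lambda>x. \<Sum>a\<in>A. c a * f a x) \<in> V" using insert by (intro V_sum) auto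
    then show ?case using insert by (simp add: B_add B_cmult cmult)
  qed
  define P where "P = (\<lambda>r::nat. \<exists>e. (\<forall>s<r. e s \<in> V) \<and> (\<forall>s<r. \<forall>t<r. B (e s) (e t) = (if s = t then 1 else 0)))"
  have bound: "r \<le> card G" if "P r" for r :: nat
  proof (rule ccontr)
    assume r: "\<not> r \<le> card G"
    from that obtain e where e: "\<And>s. s < r \<Longrightarrow> e s \<in> V"
      "\<And>s t. s < r \<Longrightarrow> t < r \<Longrightarrow> B (e s) (e t) = (if s = t then 1 else 0)"
      unfolding P_def by blast
    have "\<forall>s\<in>{..<r}. \<exists>c. \<forall>x. e s x = (\<Sum>j\<in>G. c j * g j x)" using span e(1) by blast
    then obtain a where a: "\<And>s x. s < r \<Longrightarrow> e s x = (\<Sum>j\<in>G. a s j * g j x)"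
      by (auto dest!: bchoice)
    obtain t s0 where t: "s0 < r" "t s0 \<noteq> 0" "\<And>j. j \<in> G \<Longrightarrow> (\<Sum>s<r. t s * a s j) = 0"
      using homogeneous_system_nontrivial[of G "{..<r}" a] G r by auto
    have "(\<Sum>s<r. t s * e s x) = 0" for x
    proof -
      have "(\<Sum>s<r. t s * e s x) = (\<Sum>s<r. \<Sum>j\<in>G. t s * a s j * g j x)"
        by (intro sum.cong refl) (simp add: a sum_distrib_left mult.assoc)
      also have "\<dots> = (\<Sum>j\<in>G. (\<Sum>s<r. t s * a s j) * g j x)"
        by (subst sum.swap) (simp add: sum_distrib_right)
      finally show ?thesis by (simp add: t(3))
    qed
    then have "B (\<lambda>x. \<Sum>s<r. t s * e s x) (e s0) = 0"
      using B_zero e(1) t(1) by simp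
    moreover have "B (\<lambda>x. \<Sum>s<r. t s * e s x) (e s0) = (\<Sum>s<r. t s * B (e s) (e s0))"
      using e(1) t(1) by (intro B_sum) auto
    moreover have "\<dots> = (\<Sum>s<r. if s = s0 then t s else 0)"
      using e(2) t(1) by (intro sum.cong) auto
    ultimately show False using t(1,2) by simp
  qed
  have "P 0" by (simp add: P_def)
  define r where "r = Greatest P"
  have "P r" unfolding r_def using \<open>P 0\<close> bound by (rule GreatestI_nat)
  have r_max: "\<not> P (Suc r)"
    using Greatest_le_nat[of P "Suc r" "card G"] bound unfolding r_def by auto
  from \<open>P r\<close> obtain e where e: "\<And>s. s < r \<Longrightarrow> e s \<in> V"
    "\<And>s t. s < r \<Longrightarrow> t < r \<Longrightarrow> B (e s) (e t) = (if s = t then 1 else 0)"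
    unfolding P_def by blast
  show thesis
  proof (rule that[OF bound[OF \<open>P r\<close>] e])
    fix v assume v: "v \<in> V"
    define p where "p = (\<lambda>x. \<Sum>s<r. B v (e s) * e s x)"
    define w where "w = (\<lambda>x. v x - (\<Sum>s<r. B v (e s) * e s x))"
    have p: "p \<in> V" unfolding p_def using e(1) by (intro V_sum) auto
    have w_eq: "w = (\<lambda>x. v x + (-1) * p x)" by (simp add: w_def p_def)
    have w: "w \<in> V" unfolding w_eq by (intro add cmult v p)
    have we: "B w (e s) = 0" if s: "s < r" for s
    proof -
      have "B p (e s) = (\<Sum>t<r. B v (e t) * B (e t) (e s))"
        unfolding p_def using e(1) s by (intro B_sum) auto
      also have "\<dots> = (\<Sum>t<r. if t = s then B v (e t) else 0)"
        using e(2) s by (intro sum.cong) auto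
      finally have "B p (e s) = B v (e s)" using s by simp
      moreover have "B w (e s) = B v (e s) + (-1) * B p (e s)"
        unfolding w_eq using v p e(1)[OF s] by (simp only: B_add B_cmult cmult)
      ultimately show ?thesis by simp
    qed
    have "B w w = 0"
    proof (rule ccontr)
      assume "B w w \<noteq> 0"
      with B_nonneg[OF w] have pos: "B w w > 0" by simp
      \<comment> \<open>A residual of positive length, once normalized, would prolong the system to
        length \<open>Suc r\<close>.\<close>
      define u where "u = (\<lambda>x. (1 / sqrt (B w w)) * w x)"
      have u: "u \<in> V" unfolding u_def by (intro cmult w)
      have Bu: "B u z = 1 / sqrt (B w w) * B w z" if "z \<in> V" for z
        unfolding u_def by (rule B_cmult[OF w that])
      have ue: "B u (e s) = 0" if "s < r" for s
        using Bu[OF e(1)[OF that]] we[OF that] by simp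
      have "B u u = 1 / sqrt (B w w) * (1 / sqrt (B w w) * B w w)"
        using Bu[OF u] Bu[OF w] B_sym[OF u w] by simp
      then have uu: "B u u = 1" using pos by (simp add: real_sqrt_mult_self field_simps)
      have "P (Suc r)"
        unfolding P_def
      proof (intro exI[of _ "e(r := u)"] conjI allI impI)
        fix s t assume "s < Suc r" "t < Suc r"
        then show "B ((e(r := u)) s) ((e(r := u)) t) = (if s = t then 1 else 0)"
          using e ue uu B_sym[OF u e(1)] by (auto simp: less_Suc_eq)
      qed (use u e(1) in \<open>auto simp: less_Suc_eq\<close>)
      with r_max show False by simp
    qed
    then show "B (\<lambda>x. v x - (\<Sum>s<r. B v (e s) * e s x)) (\<lambda>x. v x - (\<Sum>s<r. B v (e s) * e s x)) = 0"
      by (simp add: w_def)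
  qed
qed

text \<open>Induction on the set of variables that may occur. With the others fixed, the sum is a
  polynomial in the new variable \<open>j\<close>; its coefficient at the exponent of
  \<open>k0\<close> vanishes identically and no longer involves \<open>j\<close>.\<close>

lemma monom_independent_aux:
  fixes c :: "('n::finite \<Rightarrow> nat) \<Rightarrow> real"
  assumes "finite I" "finite S" "\<And>k i. k \<in> S \<Longrightarrow> i \<notin> I \<Longrightarrow> k i = 0"
    "\<And>x. (\<Sum>k\<in>S. c k * monom k x) = 0" "k0 \<in> S"
  shows "c k0 = 0"
  using assms
proof (induction I arbitrary: S c k0 rule: finite_induct)
  case empty
  then have "k = (\<lambda>_. 0)" if "k \<in> S" for k using that by auto
  then have "S = {\<lambda>_. 0}" "k0 = (\<lambda>_. 0)" using empty.prems(4) by auto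
  then show ?case using empty.prems(3)[of 0] by (simp add: monom_def)
next
  case (insert j I)
  define m where "m = k0 j"
  define N where "N = Max ((\<lambda>k. k j) ` S)"
  have N: "k j \<le> N" if "k \<in> S" for k using insert.prems(1) that by (auto simp: N_def)
  define Sm where "Sm = {k\<in>S. k j = m}"
  have sub: "monom k (\<chi> i. if i = j then t else x $ i) = t ^ k j * monom (k(j := 0)) x" for k t and x :: "real^'n"
  proof -
    have "monom k (\<chi> i. if i = j then t else x $ i) = t ^ k j * (\<Prod>i\<in>UNIV - {j}. (x $ i) ^ k i)"
      unfolding monom_def by (subst prod.remove[of UNIV j]) auto
    also have "(\<Prod>i\<in>UNIV - {j}. (x $ i) ^ k i) = monom (k(j := 0)) x"
      unfolding monom_def by (subst prod.remove[of UNIV j]) auto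
    finally show ?thesis .
  qed
  have zero: "(\<Sum>k\<in>Sm. c k * monom (k(j := 0)) x) = 0" for x
  proof -
    define b where "b = (\<lambda>q. \<Sum>k\<in>{k\<in>S. k j = q}. c k * monom (k(j := 0)) x)"
    have "(\<Sum>q\<le>N. b q * t ^ q) = 0" for t
    proof -
      have "(\<Sum>q\<le>N. b q * t ^ q) = (\<Sum>q\<le>N. \<Sum>k\<in>{k\<in>S. k j = q}. c k * monom k (\<chi> i. if i = j then t else x $ i))"
        by (intro sum.cong refl) (auto simp: b_def sum_distrib_right sub intro!: sum.cong)
      also have "\<dots> = (\<Sum>k\<in>S. c k * monom k (\<chi> i. if i = j then t else x $ i))"
        using insert.prems(1) N by (intro sum.group) auto
      finally show ?thesis by (simp add: insert.prems(3))
    qed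
    then have "\<forall>q\<le>N. b q = 0" using polyfun_eq_0[of b N] by blast
    then have "b m = 0" using N[OF insert.prems(4)] by (simp add: m_def)
    then show ?thesis by (simp add: b_def Sm_def)
  qed
  have inj: "inj_on (\<lambda>k. k(j := 0)) Sm"
    by (rule inj_on_inverseI[where g="\<lambda>k. k(j := m)"]) (auto simp: Sm_def)
  have "(\<lambda>k. c (k(j := m))) (k0(j := 0)) = 0"
  proof (rule insert.IH[of "(\<lambda>k. k(j := 0)) ` Sm" "\<lambda>k. c (k(j := m))" "k0(j := 0)"])
    show "(\<Sum>k\<in>(\<lambda>k. k(j := 0)) ` Sm. c (k(j := m)) * monom k x) = 0" for x
    proof -
      have "(\<Sum>k\<in>(\<lambda>k. k(j := 0)) ` Sm. c (k(j := m)) * monom k x) = (\<Sum>k\<in>Sm. c k * monom (k(j := 0)) x)"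
        unfolding sum.reindex[OF inj] o_def by (intro sum.cong refl) (auto simp: Sm_def)
      then show ?thesis by (simp add: zero)
    qed
    show "k0(j := 0) \<in> (\<lambda>k. k(j := 0)) ` Sm"
      using insert.prems(4) by (intro imageI) (simp add: Sm_def m_def)
    show "k i = 0" if "k \<in> (\<lambda>k. k(j := 0)) ` Sm" "i \<notin> I" for k i
      using that insert.prems(2) by (auto simp: Sm_def)
  qed (use insert.prems(1) in \<open>simp add: Sm_def\<close>)
  then show ?case by (simp add: m_def)
qed

lemma monom_independent:
  fixes c :: "('n::finite \<Rightarrow> nat) \<Rightarrow> real"
  assumes "finite S" "\<And>x. (\<Sum>k\<in>S. c k * monom k x) = 0" "k0 \<in> S"
  shows "c k0 = 0"
  using monom_independent_aux[of UNIV S c k0] assms by simp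

section \<open>Multi-indices, bases of harmonics and their reproducing kernels\<close>

definition multi_index :: "nat \<Rightarrow> ('n::finite \<Rightarrow> nat) set" where
  "multi_index l = {k. sum k UNIV = l}"

lemma finite_multi_index: "finite (multi_index l :: ('n::finite \<Rightarrow> nat) set)"
proof (rule finite_subset)
  have "k i \<le> sum k UNIV" for k :: "'n \<Rightarrow> nat" and i by (rule member_le_sum) auto
  then show "multi_index l \<subseteq> PiE (UNIV::'n set) (\<lambda>_. {..l})"
    by (auto simp: multi_index_def PiE_def extensional_def)
qed (simp add: finite_PiE)

lemma hom_poly_coeffs:
  assumes "hom_poly l (p :: real^'n \<Rightarrow> real)"
  shows "\<exists>c. \<forall>x. p x = (\<Sum>k\<in>multi_index l. c k * monom k x)"
proof -
  obtain S c where S: "finite S" "\<forall>k\<in>S. sum k UNIV = l" "p = (\<lambda>x. \<Sum>k\<in>S. c k * monom k x)"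
    using assms unfolding hom_poly_def by blast
  have "p x = (\<Sum>k\<in>multi_index l. (if k \<in> S then c k else 0) * monom k x)" for x
    unfolding S(3) using S(1,2) by (intro sum.mono_neutral_cong_left finite_multi_index) (auto simp: multi_index_def)
  then show ?thesis by (intro exI[of _ "\<lambda>k. if k \<in> S then c k else 0"]) blast
qed

text \<open>The number \<open>r\<close> is the dimension of the harmonics of degree
  \<open>k\<close>, kept as a parameter and estimated from below in \<open>onb_dim\<close>. The
  expansion is asked for on the sphere, the only place that \<open>sip\<close> sees.\<close>

definition is_onb :: "nat \<Rightarrow> nat \<Rightarrow> (nat \<Rightarrow> real^'n::finite \<Rightarrow> real) \<Rightarrow> bool" where
  "is_onb k r e \<longleftrightarrow> (\<forall>i<r. e i \<in> sph_harm k) \<and> (\<forall>i<r. \<forall>j<r. sip (e i) (e j) = (if i = j then 1 else 0))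
     \<and> (\<forall>p\<in>sph_harm k. \<forall>x\<in>sphere 0 1. p x = (\<Sum>i<r. sip p (e i) * e i x))"

lemma is_onb_exists: "\<exists>r e. is_onb k r (e :: nat \<Rightarrow> real^'n \<Rightarrow> real)"
proof -
  have z: "(\<lambda>x::real^'n. 0) \<in> sph_harm k"
    by (auto simp: sph_harm_def laplacian_def intro!: hom_polyI real_polynomial_function.intros(2))
  obtain r e where e: "r \<le> card (multi_index k :: ('n \<Rightarrow> nat) set)"
    "\<And>s. s < r \<Longrightarrow> e s \<in> (sph_harm k :: (real^'n \<Rightarrow> real) set)"
    "\<And>s t. s < r \<Longrightarrow> t < r \<Longrightarrow> sip (e s) (e t) = (if s = t then 1 else 0)"
    "\<And>v. v \<in> sph_harm k \<Longrightarrow> sip (\<lambda>x. v x - (\<Sum>s<r. sip v (e s) * e s x)) (\<lambda>x. v x - (\<Sum>s<r. sip v (e s) * e s x)) = 0"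
  proof (rule finite_onb[of "multi_index k :: ('n \<Rightarrow> nat) set" "sph_harm k :: (real^'n \<Rightarrow> real) set" "monom" sip])
    show "\<exists>c. \<forall>x. v x = (\<Sum>j\<in>multi_index k. c j * monom j x)" if "v \<in> sph_harm k" for v :: "real^'n \<Rightarrow> real"
      using that by (intro hom_poly_coeffs) (auto simp: sph_harm_def)
  qed (auto intro: z sph_harm_add sph_harm_cmult finite_multi_index sip_commute sip_add sip_cmult sip_nonneg sph_harm_rpf)
  have "p x = (\<Sum>i<r. sip p (e i) * e i x)" if p: "p \<in> sph_harm k" and x: "x \<in> sphere 0 1" for p x
  proof -
    have "real_polynomial_function (\<lambda>x. p x - (\<Sum>i<r. sip p (e i) * e i x))"
      using p e(2) by (intro real_polynomial_function_diff real_polynomial_function_sum rpf_cmult) (auto intro: sph_harm_rpf)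
    from sip_eq_0[OF this e(4)[OF p] x] show ?thesis by simp
  qed
  with e(2,3) show ?thesis unfolding is_onb_def by blast
qed

context
  fixes k r and e :: "nat \<Rightarrow> real^'n::finite \<Rightarrow> real"
  assumes onb: "is_onb k r e"
begin

lemma onb_sph_harm: "i < r \<Longrightarrow> e i \<in> sph_harm k"
  using onb by (simp add: is_onb_def)

lemma onb_rpf: "i < r \<Longrightarrow> real_polynomial_function (e i)"
  by (rule sph_harm_rpf[OF onb_sph_harm])

lemma onb_orthonormal: "i < r \<Longrightarrow> j < r \<Longrightarrow> sip (e i) (e j) = (if i = j then 1 else 0)"
  using onb by (simp add: is_onb_def)

lemma onb_expand: "p \<in> sph_harm k \<Longrightarrow> x \<in> sphere 0 1 \<Longrightarrow> p x = (\<Sum>i<r. sip p (e i) * e i x)"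
  using onb unfolding is_onb_def by blast

text \<open>Here and below the sum of \<open>e i y * e i x\<close> is the reproducing kernel of the
  harmonics of degree \<open>k\<close>, the zonal harmonic with pole \<open>y\<close>.\<close>

lemma onb_kernel_sph_harm: "(\<lambda>x. \<Sum>i<r. e i y * e i x) \<in> sph_harm k"
  by (intro sph_harm_sum sph_harm_cmult onb_sph_harm) auto

lemma onb_reproducing:
  assumes "p \<in> sph_harm k" "y \<in> sphere 0 1"
  shows "sip (\<lambda>x. \<Sum>i<r. e i y * e i x) p = p y"
proof -
  have "sip (\<lambda>x. \<Sum>i<r. e i y * e i x) p = (\<Sum>i<r. e i y * sip (e i) p)"
    by (intro sip_sum_cmult onb_rpf sph_harm_rpf[OF assms(1)]) auto
  also have "\<dots> = p y"
    unfolding onb_expand[OF assms] by (intro sum.cong refl) (simp add: sip_commute)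
  finally show ?thesis .
qed

text \<open>The reproducing property determines the kernel: pairing the rotated kernel with a
  harmonic \<open>w\<close> again gives \<open>w y\<close>, once the rotation is undone inside the
  integral. Applied to the difference \<open>w\<close> of the two kernels, this gives
  \<open>sip w w = w y - w y = 0\<close>.\<close>

lemma onb_kernel_rotate:
  fixes T :: "real^'n \<Rightarrow> real^'n"
  assumes T: "orthogonal_transformation T" and x: "x \<in> sphere 0 1" and y: "y \<in> sphere 0 1"
  shows "(\<Sum>i<r. e i (T y) * e i (T x)) = (\<Sum>i<r. e i y * e i x)"
proof -
  define K where "K = (\<lambda>y x. \<Sum>i<r. e i y * e i x)"
  have K: "K y \<in> sph_harm k" for y unfolding K_def by (rule onb_kernel_sph_harm)
  have K_rep: "sip (K y) p = p y" if "p \<in> sph_harm k" "y \<in> sphere 0 1" for p y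
    unfolding K_def by (rule onb_reproducing[OF that])
  define w where "w = (\<lambda>x. K (T y) (T x) - K y x)"
  have KT: "(\<lambda>x. K (T y) (T x)) \<in> sph_harm k" by (rule sph_harm_orthogonal[OF K T])
  have w: "w \<in> sph_harm k" unfolding w_def by (rule sph_harm_diff[OF KT K])
  have Ti: "orthogonal_transformation (inv T)" by (rule orthogonal_transformation_inv[OF T])
  have inv: "inv T (T z) = z" for z by (simp add: orthogonal_transformation_inj[OF T])
  have wi: "(\<lambda>x. w (inv T x)) \<in> sph_harm k" by (rule sph_harm_orthogonal[OF w Ti])
  have Ty: "T y \<in> sphere 0 1" using y orthogonal_transformation_norm[OF T] by simp
  have "sip (\<lambda>x. K (T y) (T x)) w = sip (\<lambda>x. K (T y) (T x)) (\<lambda>x. (\<lambda>x. w (inv T x)) (T x))"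
    by (simp add: inv)
  also have "\<dots> = sip (K (T y)) (\<lambda>x. w (inv T x))"
    by (rule sip_rotate[OF sph_harm_rpf[OF K] sph_harm_rpf[OF wi] T])
  also have "\<dots> = w y"
    using K_rep[OF wi Ty] by (simp add: inv)
  finally have 1: "sip (\<lambda>x. K (T y) (T x)) w = w y" .
  have "sip w w = sip (\<lambda>x. K (T y) (T x)) w - sip (K y) w"
    by (subst (1) w_def) (rule sip_diff[OF sph_harm_rpf[OF KT] sph_harm_rpf[OF K] sph_harm_rpf[OF w]])
  also have "\<dots> = 0" using 1 K_rep[OF w y] by simp
  finally have "w x = 0"
    using sip_eq_0[OF sph_harm_rpf[OF w] _ x] by simp
  then show ?thesis by (simp add: w_def K_def)
qed

text \<open>The addition theorem on the diagonal. Orthogonal maps act transitively on the sphere, so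
  invariance of the kernel makes the sum constant, and its mean is the sum of \<open>r\<close>
  squared norms equal to 1.\<close>

lemma onb_addition:
  assumes x: "x \<in> sphere 0 1"
  shows "(\<Sum>i<r. (e i x)\<^sup>2) = real r"
proof -
  have const: "(\<Sum>i<r. e i y * e i y) = (\<Sum>i<r. e i x * e i x)" if y: "y \<in> sphere 0 1" for y
  proof -
    obtain T where T: "orthogonal_transformation T" "T x = y"
      using orthogonal_transformation_exists_1[of x y] x y by auto
    show ?thesis using onb_kernel_rotate[OF T(1) x x] T(2) by simp
  qed
  have "real r = (\<Sum>i<r. sip (e i) (e i))" by (simp add: onb_orthonormal)
  also have "\<dots> = (\<integral>y. (\<Sum>i<r. e i y * e i y) \<partial>sphere_measure)"
    unfolding sip_def by (subst Bochner_Integration.integral_sum) (auto intro!: rpf_integrable_sphere rpf_mult onb_rpf)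
  also have "\<dots> = (\<integral>y. (\<Sum>i<r. e i x * e i x) \<partial>(sphere_measure :: (real^'n) measure))"
    by (intro Bochner_Integration.integral_cong refl const) simp
  also have "\<dots> = (\<Sum>i<r. e i x * e i x)" by (rule sphere_integral_const)
  finally show ?thesis by (simp add: power2_eq_square)
qed

end

text \<open>The multi-indices of degree \<open>k\<close> with entry at least 2 at a fixed position correspond to those of
  degree \<open>k - 2\<close>; among the others, those with entry 0 there contain a box of side \<open>k div d\<close>.\<close>
lemma card_multi_index_diff:
  assumes n2: "CARD('n::finite) \<ge> 2"
  shows "card {b :: 'n \<Rightarrow> nat. sum b UNIV + 2 = k} + (k div (CARD('n) - 1) + 1) ^ (CARD('n) - 2)
    \<le> card (multi_index k :: ('n \<Rightarrow> nat) set)"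
proof -
  obtain i0 :: 'n where True by blast
  have "card (UNIV - {i0}) > 0"
    using n2 by (simp add: card_Diff_singleton)
  then have "UNIV - {i0} \<noteq> {}"
    unfolding card_gt_0_iff by (rule conjunct1)
  then obtain i1 where i1: "i1 \<noteq> i0" by auto
  define J where "J = UNIV - {i0, i1}"
  define d where "d = CARD('n) - 1"
  define q where "q = k div d"
  define E where "E = {b :: 'n \<Rightarrow> nat. sum b UNIV + 2 = k}"
  have cardJ: "card J = d - 1"
    unfolding J_def d_def using i1 by (subst card_Diff_subset) auto
  have J: "finite J" "i0 \<notin> J" "i1 \<notin> J" by (auto simp: J_def)
  have UNIV_eq: "UNIV = Set.insert i0 (Set.insert i1 J)" by (auto simp: J_def)
  have split: "sum f UNIV = f i0 + (f i1 + sum f J)" for f :: "'n \<Rightarrow> nat"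
    unfolding UNIV_eq using J i1 by simp
  \<comment> \<open>A point of the box gives the entries on \<open>J\<close>; entry 0 at
    \<open>i0\<close> and the remaining degree at \<open>i1\<close> complete it. The side of the box
    is chosen so that the subtraction never truncates.\<close>
  define F where "F = (\<lambda>f i. if i = i0 then 0 else if i = i1 then k - sum f J else f i :: nat)"
  define S where "S = (\<lambda>b :: 'n \<Rightarrow> nat. b(i0 := b i0 + 2))"
  have sumle: "sum f J \<le> k" if "f \<in> PiE J (\<lambda>_. {..q})" for f
  proof -
    have "sum f J \<le> card J * q" using that by (intro sum_bounded_above[of J f q, simplified]) auto
    also have "\<dots> \<le> d * q" using cardJ by simp
    also have "\<dots> \<le> k" by (simp add: q_def)
    finally show ?thesis .
  qed
  have FJ: "sum (F f) J = sum f J" for f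
    using J by (intro sum.cong) (auto simp: F_def)
  have F_mem: "F f \<in> multi_index k" if "f \<in> PiE J (\<lambda>_. {..q})" for f
    using sumle[OF that] i1 unfolding multi_index_def mem_Collect_eq split FJ by (simp add: F_def)
  have F_inj: "inj_on F (PiE J (\<lambda>_. {..q}))"
  proof (rule inj_onI)
    fix f g assume fg: "f \<in> PiE J (\<lambda>_. {..q})" "g \<in> PiE J (\<lambda>_. {..q})" "F f = F g"
    show "f = g"
    proof
      fix i
      show "f i = g i"
      proof (cases "i \<in> J")
        case True
        then have "F f i = f i" "F g i = g i" using J by (auto simp: F_def)
        with fg(3) show ?thesis by simp
      next
        case False
        then show ?thesis using fg by (simp add: PiE_arb[of _ J])
      qed
    qed
  qed
  have S_mem: "S b \<in> multi_index k" if "b \<in> E" for b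
  proof -
    have "sum (S b) J = sum b J" using J by (intro sum.cong) (auto simp: S_def)
    then show ?thesis using that i1 unfolding multi_index_def E_def mem_Collect_eq split by (simp add: S_def)
  qed
  have S_inj: "inj_on S E"
    by (rule inj_on_inverseI[where g="\<lambda>b. b(i0 := b i0 - 2)"]) (simp add: S_def)
  have disj: "S ` E \<inter> F ` PiE J (\<lambda>_. {..q}) = {}"
  proof -
    have "S b i0 \<noteq> F f i0" for b f by (simp add: S_def F_def)
    then have "S b \<noteq> F f" for b f by metis
    then show ?thesis by auto
  qed
  have "finite E"
    using finite_subset[OF _ finite_multi_index, of "S ` E" k] S_mem finite_image_iff[OF S_inj] by blast
  have "card E + (q + 1) ^ (d - 1) = card (S ` E) + card (F ` PiE J (\<lambda>_. {..q}))"
    using J by (simp add: card_image[OF S_inj] card_image[OF F_inj] card_PiE cardJ)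
  also have "\<dots> = card (S ` E \<union> F ` PiE J (\<lambda>_. {..q}))"
    using \<open>finite E\<close> J disj by (intro card_Un_disjoint[symmetric] finite_imageI finite_PiE) auto
  also have "\<dots> \<le> card (multi_index k :: ('n \<Rightarrow> nat) set)"
    using S_mem F_mem by (intro card_mono finite_multi_index) auto
  also have "d - 1 = CARD('n) - 2" by (simp add: d_def)
  finally show ?thesis unfolding E_def q_def d_def .
qed

text \<open>If the dimension were smaller, the linear conditions "harmonic" and "orthogonal to all \<open>e i\<close>" would
  have a nonzero homogeneous solution of degree \<open>k\<close>.\<close>
lemma onb_dim:
  fixes e :: "nat \<Rightarrow> real^'n \<Rightarrow> real"
  assumes n2: "CARD('n) \<ge> 2" and onb: "is_onb k r e"
  shows "(real k / real (CARD('n) - 1)) ^ (CARD('n) - 2) \<le> real r"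
proof -
  define E where "E = {b :: 'n \<Rightarrow> nat. sum b UNIV + 2 = k}"
  define P where "P = (multi_index k :: ('n \<Rightarrow> nat) set)"
  have fP: "finite P" by (simp add: P_def finite_multi_index)
  have E_eq: "E = (if k < 2 then {} else multi_index (k - 2))"
    by (auto simp: E_def multi_index_def)
  then have fE: "finite E" by (simp add: finite_multi_index)
  have "\<exists>c. \<forall>x. laplacian (monom a :: real^'n \<Rightarrow> real) x = (\<Sum>b\<in>E. c b * monom b x)" if "a \<in> P" for a
  proof -
    have hom: "hom_poly k (monom a :: real^'n \<Rightarrow> real)" using that by (intro hom_poly_monom) (simp add: P_def multi_index_def)
    show ?thesis
    proof (cases "k < 2")
      case True
      then show ?thesis using laplacian_low_degree[OF hom True] by (simp add: E_eq)
    next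
      case False
      then have "k - 2 + 2 = k" by simp
      with hom have "hom_poly (k - 2) (laplacian (monom a) :: real^'n \<Rightarrow> real)"
        by (intro hom_poly_laplacian) (simp only:)
      from hom_poly_coeffs[OF this] False show ?thesis by (simp add: E_eq)
    qed
  qed
  then obtain L where L: "\<And>a x. a \<in> P \<Longrightarrow> laplacian (monom a) (x::real^'n) = (\<Sum>b\<in>E. L a b * monom b x)"
    using bchoice[of P "\<lambda>a c. \<forall>x. laplacian (monom a :: real^'n \<Rightarrow> real) x = (\<Sum>b\<in>E. c b * monom b x)"] by blast
  have "card P \<le> card E + r"
  proof (rule ccontr)
    assume less: "\<not> card P \<le> card E + r"
    \<comment> \<open>One equation for each monomial of the Laplacian and one for each basis
      function; the unknowns are the coefficients of the monomials of degree
      \<open>k\<close>.\<close>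
    define c where "c = (\<lambda>a. case_sum (L a) (\<lambda>i. sip (monom a) (e i)))"
    have "card (E <+> {..<r}) < card P"
      using less fE by (simp add: card_Plus)
    then obtain t a0 where t: "a0 \<in> P" "t a0 \<noteq> 0" "\<And>i. i \<in> E <+> {..<r} \<Longrightarrow> (\<Sum>a\<in>P. t a * c a i) = 0"
      using homogeneous_system_nontrivial[of "E <+> {..<r}" P c] fE fP by (auto simp: finite_Plus)
    define p where "p = (\<lambda>x::real^'n. \<Sum>a\<in>P. t a * monom a x)"
    have hom: "hom_poly k p"
      unfolding p_def by (intro hom_poly_sum hom_poly_cmult hom_poly_monom fP) (simp add: P_def multi_index_def)
    have "laplacian p x = 0" for x
    proof -
      have "laplacian p x = (\<Sum>a\<in>P. laplacian (\<lambda>x. t a * monom a x) x)"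
        unfolding p_def by (rule laplacian_sum[OF fP]) (auto intro: rpf_cmult)
      also have "\<dots> = (\<Sum>a\<in>P. t a * (\<Sum>b\<in>E. L a b * monom b x))"
        by (intro sum.cong refl) (simp add: laplacian_cmult L)
      also have "\<dots> = (\<Sum>b\<in>E. (\<Sum>a\<in>P. t a * c a (Inl b)) * monom b x)"
        unfolding sum_distrib_left sum_distrib_right by (subst sum.swap) (simp add: c_def mult.assoc)
      also have "\<dots> = 0"
        by (intro sum.neutral) (simp add: t(3) InlI)
      finally show ?thesis .
    qed
    with hom have p: "p \<in> sph_harm k" by (simp add: sph_harm_def)
    have "sip p (e i) = 0" if i: "i < r" for i
    proof -
      have "sip p (e i) = (\<Sum>a\<in>P. t a * sip (monom a) (e i))"
        unfolding p_def by (intro sip_sum_cmult fP rpf_monom onb_rpf[OF onb i])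
      also have "\<dots> = (\<Sum>a\<in>P. t a * c a (Inr i))" by (simp add: c_def)
      finally show ?thesis using t(3)[of "Inr i"] i by (simp add: InrI)
    qed
    then have p0: "p x = 0" if "x \<in> sphere 0 1" for x
      using onb_expand[OF onb p that] by simp
    obtain u :: "real^'n" where u: "norm u = 1" using vector_choose_size[of 1] by auto
    have "p x = 0" for x
    proof -
      \<comment> \<open>\<open>u\<close> is a default direction at the origin, so that every point
        is a multiple of a point of the sphere and homogeneity spreads the vanishing to the whole
        space.\<close>
      define y where "y = (if x = 0 then u else x /\<^sub>R norm x)"
      have "x = norm x *\<^sub>R y" "norm y = 1" using u by (auto simp: y_def)
      then show ?thesis
        using hom_poly_scale[OF hom, of "norm x" y] p0[of y] by simp
    qed
    then have "t a0 = 0"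
      using monom_independent[OF fP _ t(1), of t] by (simp add: p_def)
    with t(2) show False by simp
  qed
  then have "(k div (CARD('n) - 1) + 1) ^ (CARD('n) - 2) \<le> r"
    using card_multi_index_diff[OF n2, of k] by (simp add: E_def P_def)
  then have "real ((k div (CARD('n) - 1) + 1) ^ (CARD('n) - 2)) \<le> real r"
    by (simp only: of_nat_le_iff)
  moreover have "real k / real (CARD('n) - 1) \<le> real (k div (CARD('n) - 1) + 1)"
  proof -
    define d where "d = CARD('n) - 1"
    have d: "d > 0" using n2 by (simp add: d_def)
    have "k \<le> d * (k div d + 1)"
      using dividend_less_times_div[OF d, of k] by simp
    then have "real k \<le> real (d * (k div d + 1))"
      by (simp only: of_nat_le_iff)
    then have "real k / real d \<le> real (k div d + 1)"
      using d by (simp add: pos_divide_le_eq algebra_simps)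
    then show ?thesis by (simp only: d_def)
  qed
  then have "(real k / real (CARD('n) - 1)) ^ (CARD('n) - 2) \<le> real (k div (CARD('n) - 1) + 1) ^ (CARD('n) - 2)"
    by (intro power_mono) auto
  ultimately show ?thesis by (simp only: of_nat_power)
qed

section \<open>The fooling function\<close>

text \<open>With \<open>g\<close> the projection of \<open>f\<close> onto the system, both
  \<open>sip g f\<close> and \<open>sip g g\<close> equal the sum of squares; expand the squared
  norm of \<open>f - g\<close>.\<close>

lemma bessel:
  fixes y :: "'a \<Rightarrow> real^'n \<Rightarrow> real"
  assumes I: "finite I" and y: "\<And>a. a \<in> I \<Longrightarrow> real_polynomial_function (y a)"
    and orth: "\<And>a b. a \<in> I \<Longrightarrow> b \<in> I \<Longrightarrow> sip (y a) (y b) = (if a = b then 1 else 0)"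
    and f: "real_polynomial_function f"
  shows "(\<Sum>a\<in>I. (sip f (y a))\<^sup>2) \<le> sip f f"
proof -
  define g where "g = (\<lambda>x. \<Sum>a\<in>I. sip f (y a) * y a x)"
  have g: "real_polynomial_function g"
    unfolding g_def using I y by (intro real_polynomial_function_sum rpf_cmult)
  have gh: "sip g h = (\<Sum>a\<in>I. sip f (y a) * sip (y a) h)" if "real_polynomial_function h" for h
    unfolding g_def using I y that by (rule sip_sum_cmult)
  have gf: "sip g f = (\<Sum>a\<in>I. (sip f (y a))\<^sup>2)"
    unfolding gh[OF f] by (simp add: sip_commute power2_eq_square)
  have "sip g (y b) = sip f (y b)" if b: "b \<in> I" for b
  proof -
    have "sip g (y b) = (\<Sum>a\<in>I. if a = b then sip f (y a) else 0)"
      unfolding gh[OF y[OF b]] using orth b by (intro sum.cong) auto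
    then show ?thesis using I b by simp
  qed
  then have "sip (y b) g = sip f (y b)" if "b \<in> I" for b
    using that sip_commute[of "y b" g] by (simp only:)
  then have gg: "sip g g = (\<Sum>a\<in>I. (sip f (y a))\<^sup>2)"
    unfolding gh[OF g] by (intro sum.cong refl) (simp only: power2_eq_square)
  have fg: "real_polynomial_function (\<lambda>x. f x - g x)" using f g by auto
  have "0 \<le> sip (\<lambda>x. f x - g x) (\<lambda>x. f x - g x)" by (rule sip_nonneg)
  also have "\<dots> = (sip f f - sip g f) - (sip f g - sip g g)"
    unfolding sip_diff[OF f g fg] sip_commute[of _ "\<lambda>x. f x - g x"] sip_diff[OF f g f] sip_diff[OF f g g] ..
  finally show ?thesis using gf gg sip_commute[of f g] by linarith
qed

context
  fixes D :: "nat \<Rightarrow> nat" and Y :: "nat \<Rightarrow> nat \<Rightarrow> real^'n::finite \<Rightarrow> real"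
  assumes n3: "CARD('n) \<ge> 3" and onb: "\<And>k. is_onb k (D k) (Y k)"
begin

section \<open>Projections onto the harmonics of one degree\<close>

definition harm_proj :: "nat \<Rightarrow> (real^'n \<Rightarrow> real) \<Rightarrow> real^'n \<Rightarrow> real" where
  "harm_proj l f x = (\<Sum>i<D l. sip f (Y l i) * Y l i x)"

lemma harm_proj_sph_harm: "harm_proj l f \<in> sph_harm l"
  unfolding harm_proj_def[abs_def] by (intro sph_harm_sum sph_harm_cmult onb_sph_harm[OF onb]) auto

lemma sip_harm_proj:
  assumes f: "real_polynomial_function f" and v: "v \<in> sph_harm l"
  shows "sip (harm_proj l f) v = sip f v"
proof -
  have rv: "real_polynomial_function v" by (rule sph_harm_rpf[OF v])
  have "sip (harm_proj l f) v = (\<Sum>i<D l. sip f (Y l i) * sip (Y l i) v)"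
    unfolding harm_proj_def[abs_def] by (intro sip_sum_cmult onb_rpf[OF onb] rv) auto
  also have "\<dots> = (\<Sum>i<D l. sip v (Y l i) * sip (Y l i) f)"
    by (intro sum.cong refl) (simp add: sip_commute mult.commute)
  also have "\<dots> = sip (\<lambda>x. \<Sum>i<D l. sip v (Y l i) * Y l i x) f"
    by (intro sip_sum_cmult[symmetric] onb_rpf[OF onb] f) auto
  also have "\<dots> = sip v f"
    by (intro sip_cong refl onb_expand[OF onb v, symmetric])
  finally show ?thesis by (simp add: sip_commute)
qed

lemma is_Hproj_harm_proj:
  assumes f: "real_polynomial_function f"
  shows "is_Hproj l f (harm_proj l f)"
  unfolding is_Hproj_def
proof (intro conjI ballI harm_proj_sph_harm)
  fix v :: "real^'n \<Rightarrow> real" assume v: "v \<in> sph_harm l"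
  have "sip (\<lambda>x. f x - harm_proj l f x) v = 0"
    using sip_diff[OF f sph_harm_rpf[OF harm_proj_sph_harm[of l f]] sph_harm_rpf[OF v]] sip_harm_proj[OF f v] by simp
  then show "(\<integral>x. (f x - harm_proj l f x) * v x \<partial>sphere_measure) = 0" by (simp add: sip_def)
qed

text \<open>\<open>Hproj_norm2\<close> is a definite description of a number, so it suffices that
  all projections of \<open>f\<close> have the same norm. The defining orthogonality, used for
  \<open>g\<close> and for \<open>harm_proj l f\<close> in turn, shows this without comparing the
  two polynomials.\<close>

lemma Hproj_norm2_eq:
  assumes f: "real_polynomial_function f"
  shows "Hproj_norm2 l f = sip (harm_proj l f) (harm_proj l f)"
  unfolding Hproj_norm2_def
proof (rule the_equality)
  show "\<exists>g. is_Hproj l f g \<and> sip (harm_proj l f) (harm_proj l f) = (\<integral>x. (g x)\<^sup>2 \<partial>sphere_measure)"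
    using is_Hproj_harm_proj[OF f] by (auto simp: sip_def power2_eq_square)
next
  fix r assume "\<exists>g. is_Hproj l f g \<and> r = (\<integral>x. (g x)\<^sup>2 \<partial>sphere_measure)"
  then obtain g where g: "is_Hproj l f g" "r = sip g g" by (auto simp: sip_def power2_eq_square)
  have gs: "g \<in> sph_harm l" using g(1) by (simp add: is_Hproj_def)
  have eq: "sip g v = sip f v" if v: "v \<in> sph_harm l" for v
  proof -
    have "sip (\<lambda>x. f x - g x) v = 0" using g(1) v by (simp add: is_Hproj_def sip_def)
    then show ?thesis using sip_diff[OF f sph_harm_rpf[OF gs] sph_harm_rpf[OF v]] by simp
  qed
  have "sip g g = sip f g" by (rule eq[OF gs])
  also have "\<dots> = sip (harm_proj l f) g" by (rule sip_harm_proj[OF f gs, symmetric])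
  also have "\<dots> = sip f (harm_proj l f)" using eq[OF harm_proj_sph_harm[of l f]] by (simp add: sip_commute)
  also have "\<dots> = sip (harm_proj l f) (harm_proj l f)" by (rule sip_harm_proj[OF f harm_proj_sph_harm, symmetric])
  finally show "r = sip (harm_proj l f) (harm_proj l f)" using g(2) by simp
qed

lemma sip_harm_proj_self: "real_polynomial_function f \<Longrightarrow> sip (harm_proj l f) (harm_proj l f) = sip f (harm_proj l f)"
  by (rule sip_harm_proj[OF _ harm_proj_sph_harm])

text \<open>A harmonic of degree 0 is a constant \<open>c\<close>, and orthogonality gives that c^2
  is \<open>c\<close> times the integral of \<open>f\<close>. Both solutions for \<open>c\<close>
  satisfy the inequality.\<close>

lemma Hproj_norm2_0_le:
  fixes f :: "real^'n \<Rightarrow> real"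
  assumes f: "real_polynomial_function f"
  shows "Hproj_norm2 0 f \<le> (\<integral>x. f x \<partial>sphere_measure)\<^sup>2"
proof -
  define c where "c = harm_proj 0 f 0"
  have "harm_proj 0 f x = c" for x
    using harm_proj_sph_harm[of 0 f] hom_poly_scale[of 0 "harm_proj 0 f" 0 x] by (simp add: sph_harm_def c_def)
  then have harm_proj: "harm_proj 0 f = (\<lambda>x. c)" by auto
  have 1: "sip (harm_proj 0 f) (harm_proj 0 f) = c\<^sup>2"
    unfolding harm_proj by (simp add: sip_def measure_sphere power2_eq_square)
  have "sip f (harm_proj 0 f) = c * (\<integral>x. f x \<partial>sphere_measure)"
    unfolding harm_proj by (simp add: sip_def mult.commute)
  with 1 sip_harm_proj_self[OF f, of 0] have "c\<^sup>2 = c * (\<integral>x. f x \<partial>sphere_measure)" by simp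
  then have "c = 0 \<or> c = (\<integral>x. f x \<partial>sphere_measure)" by (simp add: power2_eq_square)
  then show ?thesis using 1 by (auto simp: Hproj_norm2_eq[OF f])
qed

section \<open>Weighted features and the invariant quadratic form\<close>

context
  fixes K :: "nat set" and u :: "nat \<Rightarrow> real"
  assumes K: "finite K" and u_nonneg: "\<And>k. u k \<ge> 0"
begin

definition harm_index :: "(nat \<times> nat) set" where "harm_index = Sigma K (\<lambda>k. {..<D k})"
definition harm_basis :: "nat \<times> nat \<Rightarrow> real^'n \<Rightarrow> real" where "harm_basis a = Y (fst a) (snd a)"
definition feature :: "nat \<times> nat \<Rightarrow> real^'n \<Rightarrow> real" where "feature a x = sqrt (u (fst a)) * harm_basis a x"
definition feature_prod :: "(nat \<times> nat) \<times> (nat \<times> nat) \<Rightarrow> real^'n \<Rightarrow> real" where "feature_prod c x = feature (fst c) x * feature (snd c) x"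
text \<open>The constant squared length of the feature vector, called \<open>m\<close> in the final
  proof, expressed through the dimensions; \<open>sum_feature_sq\<close> identifies the two.\<close>

definition feature_trace :: real where "feature_trace = (\<Sum>k\<in>K. u k * real (D k))"
text \<open>The bilinear form of the integral operator whose kernel is the square of the sum of
  \<open>feature a x * feature a z\<close>. Written over pairs of indices, it is ready for
  Cauchy-Schwarz against a matrix.\<close>

definition feature_form :: "(real^'n \<Rightarrow> real) \<Rightarrow> (real^'n \<Rightarrow> real) \<Rightarrow> real" where
  "feature_form g h = (\<Sum>c\<in>harm_index \<times> harm_index. sip (feature_prod c) g * sip (feature_prod c) h)"

lemma finite_harm_index: "finite harm_index" using K by (simp add: harm_index_def)

lemma harm_basis_sph_harm: "a \<in> harm_index \<Longrightarrow> harm_basis a \<in> sph_harm (fst a)"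
  by (auto simp: harm_index_def harm_basis_def onb_sph_harm[OF onb])

lemma harm_basis_rpf: "a \<in> harm_index \<Longrightarrow> real_polynomial_function (harm_basis a)"
  by (rule sph_harm_rpf[OF harm_basis_sph_harm])

lemma harm_basis_orthonormal: "a \<in> harm_index \<Longrightarrow> b \<in> harm_index \<Longrightarrow> sip (harm_basis a) (harm_basis b) = (if a = b then 1 else 0)"
proof (cases "fst a = fst b")
  case True
  assume "a \<in> harm_index" "b \<in> harm_index"
  with True show ?thesis
    by (auto simp: harm_index_def harm_basis_def onb_orthonormal[OF onb] prod_eq_iff)
next
  case False
  assume "a \<in> harm_index" "b \<in> harm_index"
  with False show ?thesis
    using sph_harm_orth[OF n3 harm_basis_sph_harm harm_basis_sph_harm] by auto
qed

lemma feature_rpf: "a \<in> harm_index \<Longrightarrow> real_polynomial_function (feature a)"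
  unfolding feature_def[abs_def] by (intro rpf_cmult harm_basis_rpf)

lemma feature_prod_rpf: "c \<in> harm_index \<times> harm_index \<Longrightarrow> real_polynomial_function (feature_prod c)"
  unfolding feature_prod_def[abs_def] by (intro rpf_mult feature_rpf) auto

lemma sum_feature: "(\<Sum>a\<in>harm_index. feature a x * feature a z) = (\<Sum>k\<in>K. u k * (\<Sum>i<D k. Y k i x * Y k i z))"
proof -
  have "(\<Sum>a\<in>harm_index. feature a x * feature a z) = (\<Sum>k\<in>K. \<Sum>i<D k. u k * (Y k i x * Y k i z))"
    unfolding harm_index_def using K u_nonneg
    by (subst sum.Sigma) (auto simp: feature_def harm_basis_def split_beta' intro!: sum.cong)
  then show ?thesis by (simp add: sum_distrib_left)
qed

lemma sum_feature_sq: "x \<in> sphere 0 1 \<Longrightarrow> (\<Sum>a\<in>harm_index. feature a x * feature a x) = feature_trace"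
  unfolding sum_feature feature_trace_def using onb_addition[OF onb] by (simp add: power2_eq_square)

lemma sum_feature_prod: "(\<Sum>c\<in>harm_index \<times> harm_index. feature_prod c x * feature_prod c z) = (\<Sum>a\<in>harm_index. feature a x * feature a z)\<^sup>2"
  unfolding power2_eq_square sum_product sum.cartesian_product feature_prod_def
  by (intro sum.cong) (auto simp: split_beta')

text \<open>The kernel is the square of a weighted sum of the reproducing kernels of the single
  degrees, each of which is rotation invariant.\<close>

lemma sum_feature_prod_rotate:
  fixes T :: "real^'n \<Rightarrow> real^'n"
  assumes "orthogonal_transformation T" "x \<in> sphere 0 1" "z \<in> sphere 0 1"
  shows "(\<Sum>c\<in>harm_index \<times> harm_index. feature_prod c (T x) * feature_prod c (T z)) = (\<Sum>c\<in>harm_index \<times> harm_index. feature_prod c x * feature_prod c z)"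
  unfolding sum_feature_prod sum_feature onb_kernel_rotate[OF onb assms(1,3,2)] ..

text \<open>The infinitesimal form of the invariance: along a simultaneous rotation of
  \<open>x\<close> and \<open>z\<close> the kernel is constant, so its derivative at angle 0
  vanishes.\<close>

lemma sum_ang_deriv_feature_prod:
  assumes x: "x \<in> sphere 0 1" and z: "z \<in> sphere 0 1"
  shows "(\<Sum>c\<in>harm_index \<times> harm_index. ang_deriv i j (feature_prod c) x * feature_prod c z + feature_prod c x * ang_deriv i j (feature_prod c) z) = 0"
proof (cases "i = j")
  case True
  then show ?thesis by (simp add: ang_deriv_def)
next
  case False
  have "((\<lambda>\<theta>. \<Sum>c\<in>harm_index \<times> harm_index. feature_prod c (rot i j \<theta> x) * feature_prod c (rot i j \<theta> z)) has_field_derivative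
      (\<Sum>c\<in>harm_index \<times> harm_index. ang_deriv i j (feature_prod c) (rot i j 0 x) * feature_prod c (rot i j 0 z) + ang_deriv i j (feature_prod c) (rot i j 0 z) * feature_prod c (rot i j 0 x))) (at 0)"
    using False by (intro DERIV_sum DERIV_mult rot_derivative feature_prod_rpf) auto
  moreover have "(\<lambda>\<theta>. \<Sum>c\<in>harm_index \<times> harm_index. feature_prod c (rot i j \<theta> x) * feature_prod c (rot i j \<theta> z)) = (\<lambda>\<theta>. \<Sum>c\<in>harm_index \<times> harm_index. feature_prod c x * feature_prod c z)"
    using sum_feature_prod_rotate[OF orthogonal_rot[OF False] x z] by auto
  ultimately show ?thesis
    using DERIV_unique[OF _ DERIV_const] by (simp add: mult.commute)
qed

text \<open>The infinitesimal invariance of the kernel is integrated against \<open>g\<close> in the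
  first variable and against \<open>h\<close> in the second; integration by parts moves the angular
  derivatives from the feature products to \<open>g\<close> and \<open>h\<close>.\<close>

lemma feature_form_ang_deriv:
  assumes g: "real_polynomial_function g" and h: "real_polynomial_function h"
  shows "feature_form (ang_deriv i j g) h = - feature_form g (ang_deriv i j h)"
proof -
  have fin: "finite (harm_index \<times> harm_index)" using finite_harm_index by simp
  have zero: "(\<Sum>c\<in>harm_index \<times> harm_index. sip (ang_deriv i j (feature_prod c)) g * feature_prod c z + sip (feature_prod c) g * ang_deriv i j (feature_prod c) z) = 0"
    if z: "z \<in> sphere 0 1" for z
  proof -
    have "sip (\<lambda>x. \<Sum>c\<in>harm_index \<times> harm_index. feature_prod c z * ang_deriv i j (feature_prod c) x + ang_deriv i j (feature_prod c) z * feature_prod c x) g = sip (\<lambda>x. 0) g"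
      using sum_ang_deriv_feature_prod[OF _ z, of _ i j] by (intro sip_cong) (auto simp: mult.commute)
    moreover have "sip (\<lambda>x. \<Sum>c\<in>harm_index \<times> harm_index. feature_prod c z * ang_deriv i j (feature_prod c) x + ang_deriv i j (feature_prod c) z * feature_prod c x) g
        = (\<Sum>c\<in>harm_index \<times> harm_index. sip (\<lambda>x. feature_prod c z * ang_deriv i j (feature_prod c) x + ang_deriv i j (feature_prod c) z * feature_prod c x) g)"
      by (rule sip_sum[OF fin _ g]) (intro real_polynomial_function.intros(3) rpf_cmult rpf_ang_deriv feature_prod_rpf, assumption+)
    moreover have "sip (\<lambda>x. feature_prod c z * ang_deriv i j (feature_prod c) x + ang_deriv i j (feature_prod c) z * feature_prod c x) g
        = sip (ang_deriv i j (feature_prod c)) g * feature_prod c z + sip (feature_prod c) g * ang_deriv i j (feature_prod c) z" if "c \<in> harm_index \<times> harm_index" for c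
      by (simp add: sip_add[OF rpf_cmult[OF rpf_ang_deriv[OF feature_prod_rpf[OF that]]] rpf_cmult[OF feature_prod_rpf[OF that]] g] sip_cmult)
    ultimately show ?thesis by (simp add: sip_def)
  qed
  have "sip (\<lambda>z. \<Sum>c\<in>harm_index \<times> harm_index. sip (ang_deriv i j (feature_prod c)) g * feature_prod c z + sip (feature_prod c) g * ang_deriv i j (feature_prod c) z) h = sip (\<lambda>x. 0) h"
    using zero by (intro sip_cong) auto
  moreover have "sip (\<lambda>z. \<Sum>c\<in>harm_index \<times> harm_index. sip (ang_deriv i j (feature_prod c)) g * feature_prod c z + sip (feature_prod c) g * ang_deriv i j (feature_prod c) z) h
      = (\<Sum>c\<in>harm_index \<times> harm_index. sip (\<lambda>z. sip (ang_deriv i j (feature_prod c)) g * feature_prod c z + sip (feature_prod c) g * ang_deriv i j (feature_prod c) z) h)"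
    by (rule sip_sum[OF fin _ h]) (intro real_polynomial_function.intros(3) rpf_cmult rpf_ang_deriv feature_prod_rpf, assumption+)
  moreover have "sip (\<lambda>z. sip (ang_deriv i j (feature_prod c)) g * feature_prod c z + sip (feature_prod c) g * ang_deriv i j (feature_prod c) z) h
      = - (sip (feature_prod c) (ang_deriv i j g) * sip (feature_prod c) h) - sip (feature_prod c) g * sip (feature_prod c) (ang_deriv i j h)" if c: "c \<in> harm_index \<times> harm_index" for c
    unfolding sip_add[OF rpf_cmult[OF feature_prod_rpf[OF c]] rpf_cmult[OF rpf_ang_deriv[OF feature_prod_rpf[OF c]]] h] sip_cmult
      sip_ang_deriv[OF feature_prod_rpf[OF c] g] sip_ang_deriv[OF feature_prod_rpf[OF c] h] by simp
  ultimately have "(\<Sum>c\<in>harm_index \<times> harm_index. - (sip (feature_prod c) (ang_deriv i j g) * sip (feature_prod c) h) - sip (feature_prod c) g * sip (feature_prod c) (ang_deriv i j h)) = 0"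
    by (simp add: sip_def)
  then show ?thesis by (simp add: feature_form_def sum_subtractf sum_negf)
qed

lemma feature_form_commute: "feature_form g h = feature_form h g"
  by (simp add: feature_form_def mult.commute)

lemma feature_form_sum_cmult:
  fixes g :: "'a \<Rightarrow> real^'n \<Rightarrow> real"
  assumes "finite A" "\<And>a. a \<in> A \<Longrightarrow> real_polynomial_function (g a)"
  shows "feature_form (\<lambda>x. \<Sum>a\<in>A. t a * g a x) h = (\<Sum>a\<in>A. t a * feature_form (g a) h)"
proof -
  have "sip (feature_prod c) (\<lambda>x. \<Sum>a\<in>A. t a * g a x) = (\<Sum>a\<in>A. t a * sip (feature_prod c) (g a))" if "c \<in> harm_index \<times> harm_index" for c
    using sip_sum_cmult[OF assms(1,2) feature_prod_rpf[OF that], where c=t] by (simp add: sip_commute)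
  then have "feature_form (\<lambda>x. \<Sum>a\<in>A. t a * g a x) h = (\<Sum>c\<in>harm_index \<times> harm_index. \<Sum>a\<in>A. t a * (sip (feature_prod c) (g a) * sip (feature_prod c) h))"
    unfolding feature_form_def by (intro sum.cong refl) (simp add: sum_distrib_right mult.assoc)
  also have "\<dots> = (\<Sum>a\<in>A. t a * feature_form (g a) h)"
    unfolding feature_form_def sum_distrib_left by (rule sum.swap)
  finally show ?thesis .
qed

lemma feature_form_cong: "(\<And>x. x \<in> sphere 0 1 \<Longrightarrow> g x = g' x) \<Longrightarrow> feature_form g h = feature_form g' h"
  unfolding feature_form_def by (intro sum.cong refl arg_cong2[where f="(*)"] sip_cong) auto

lemma feature_form_casimir:
  assumes g: "real_polynomial_function g" and h: "real_polynomial_function h"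
  shows "feature_form (casimir g) h = feature_form g (casimir h)"
proof -
  have exp: "feature_form (casimir g) h = (\<Sum>c\<in>UNIV \<times> UNIV. feature_form (ang_deriv (fst c) (snd c) (ang_deriv (fst c) (snd c) g)) h)"
    if g: "real_polynomial_function g" for g h
  proof -
    have "feature_form (casimir g) h = feature_form (\<lambda>x. \<Sum>c\<in>UNIV \<times> UNIV. 1 * ang_deriv (fst c) (snd c) (ang_deriv (fst c) (snd c) g) x) h"
      by (rule feature_form_cong) (simp add: casimir_def sum.cartesian_product split_beta')
    also have "\<dots> = (\<Sum>c\<in>UNIV \<times> UNIV. 1 * feature_form (ang_deriv (fst c) (snd c) (ang_deriv (fst c) (snd c) g)) h)"
      using g by (intro feature_form_sum_cmult) auto
    finally show ?thesis by simp
  qed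
  have "feature_form (ang_deriv i j (ang_deriv i j g)) h = feature_form (ang_deriv i j (ang_deriv i j h)) g" for i j
    using feature_form_ang_deriv[OF rpf_ang_deriv[OF g, of i j] h, of i j] feature_form_ang_deriv[OF g rpf_ang_deriv[OF h, of i j], of i j]
    by (simp add: feature_form_commute)
  then show ?thesis
    by (subst (2) feature_form_commute) (simp only: exp[OF g] exp[OF h])
qed

text \<open>The Casimir operator is symmetric for \<open>feature_form\<close> as it is for
  \<open>sip\<close>, and different degrees have different eigenvalues.\<close>

lemma feature_form_orth:
  assumes g: "g \<in> sph_harm k" and h: "h \<in> sph_harm l" and kl: "k \<noteq> l"
  shows "feature_form g h = 0"
proof -
  have r: "real_polynomial_function g" "real_polynomial_function h" using g h by (auto intro: sph_harm_rpf)
  have eig: "feature_form (casimir g) h = casimir_ev TYPE('n) k * feature_form g h" if "g \<in> sph_harm k" for g h k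
  proof -
    have "feature_form (casimir g) h = feature_form (\<lambda>x. \<Sum>a\<in>{()}. casimir_ev TYPE('n) k * g x) h"
      using that by (intro feature_form_cong) (simp add: casimir_sph_harm)
    also have "\<dots> = casimir_ev TYPE('n) k * feature_form g h"
      using sph_harm_rpf[OF that] by (subst feature_form_sum_cmult) auto
    finally show ?thesis .
  qed
  have "casimir_ev TYPE('n) k * feature_form g h = feature_form (casimir g) h" by (rule eig[OF g, symmetric])
  also have "\<dots> = feature_form (casimir h) g" using feature_form_casimir[OF r] by (simp only: feature_form_commute[of _ "casimir h"])
  also have "\<dots> = casimir_ev TYPE('n) l * feature_form g h" unfolding eig[OF h] by (simp only: feature_form_commute)
  finally show ?thesis using casimir_ev_inj[OF kl n3] by auto
qed

text \<open>A pair of degrees with sum below \<open>l\<close> contributes nothing, since the product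
  has too low a degree; in any other pair one degree is at least l/2, so its weight is at most
  \<open>q\<close>. Adding both possibilities accounts for the factor 2. Bessel's inequality then
  sums over the index whose weight was replaced, and the constant length of the features over the
  other.\<close>

lemma feature_form_bound:
  assumes g: "g \<in> sph_harm l" and q: "q \<ge> 0" "\<And>k. k \<in> K \<Longrightarrow> l \<le> 2 * k \<Longrightarrow> u k \<le> q"
  shows "feature_form g g \<le> 2 * q * feature_trace * sip g g"
proof -
  have rg: "real_polynomial_function g" by (rule sph_harm_rpf[OF g])
  define X where "X = (\<lambda>a b. (sip (\<lambda>x. harm_basis a x * harm_basis b x) g)\<^sup>2)"
  have Wsq: "sip (feature_prod (a, b)) g * sip (feature_prod (a, b)) g = u (fst a) * u (fst b) * X a b" for a b
  proof -
    have "sip (feature_prod (a, b)) g = sip (\<lambda>x. (sqrt (u (fst a)) * sqrt (u (fst b))) * (harm_basis a x * harm_basis b x)) g"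
      by (intro sip_cong refl) (simp add: feature_prod_def feature_def)
    then have eq: "sip (feature_prod (a, b)) g = sqrt (u (fst a)) * sqrt (u (fst b)) * sip (\<lambda>x. harm_basis a x * harm_basis b x) g"
      by (simp only: sip_cmult)
    have "sip (feature_prod (a, b)) g * sip (feature_prod (a, b)) g = (sqrt (u (fst a)))\<^sup>2 * (sqrt (u (fst b)))\<^sup>2 * X a b"
      unfolding eq X_def by (simp only: power2_eq_square ac_simps)
    then show ?thesis using u_nonneg by simp
  qed
  have term_le: "u (fst a) * u (fst b) * X a b \<le> q * (u (fst a) * X a b + u (fst b) * X b a)"
    if ab: "a \<in> harm_index" "b \<in> harm_index" for a b
  proof -
    have sym: "X b a = X a b" by (simp add: X_def mult.commute)
    have X0: "X a b \<ge> 0" by (simp add: X_def)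
    have k: "fst a \<in> K" "fst b \<in> K" using ab by (auto simp: harm_index_def)
    consider "fst a + fst b < l" | "l \<le> 2 * fst a" | "l \<le> 2 * fst b" by linarith
    then show ?thesis
    proof cases
      case 1
      have hom: "hom_poly (fst a) (harm_basis a)" "hom_poly (fst b) (harm_basis b)"
        using harm_basis_sph_harm ab by (auto simp: sph_harm_def)
      have "hom_poly (fst a + fst b) (\<lambda>x. harm_basis a x * harm_basis b x)"
        by (intro hom_polyI rpf_mult harm_basis_rpf ab) (simp add: hom_poly_scale[OF hom(1)] hom_poly_scale[OF hom(2)] power_add)
      then have "X a b = 0"
        unfolding X_def using sph_harm_orth_lower[OF n3 g _ 1] by simp
      then show ?thesis by (simp add: sym)
    next
      case 2
      then have "u (fst a) * (u (fst b) * X a b) \<le> q * (u (fst b) * X a b)"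
        using q k X0 u_nonneg by (intro mult_right_mono) auto
      moreover have "0 \<le> q * (u (fst a) * X a b)" using q X0 u_nonneg by simp
      ultimately show ?thesis unfolding sym distrib_left by (simp add: mult.assoc)
    next
      case 3
      then have "u (fst b) * (u (fst a) * X a b) \<le> q * (u (fst a) * X a b)"
        using q k X0 u_nonneg by (intro mult_right_mono) auto
      moreover have "0 \<le> q * (u (fst b) * X a b)" using q X0 u_nonneg by simp
      ultimately show ?thesis unfolding sym distrib_left by (simp add: mult_ac)
    qed
  qed
  have half: "(\<Sum>a\<in>harm_index. \<Sum>b\<in>harm_index. u (fst a) * X a b) \<le> feature_trace * sip g g"
  proof -
    have "(\<Sum>a\<in>harm_index. \<Sum>b\<in>harm_index. u (fst a) * X a b) \<le> (\<Sum>a\<in>harm_index. u (fst a) * sip (\<lambda>x. harm_basis a x * g x) (\<lambda>x. harm_basis a x * g x))"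
    proof (rule sum_mono)
      fix a assume a: "a \<in> harm_index"
      have "X a b = (sip (\<lambda>x. harm_basis a x * g x) (harm_basis b))\<^sup>2" for b
        by (simp add: X_def sip_def mult_ac)
      then have "(\<Sum>b\<in>harm_index. X a b) \<le> sip (\<lambda>x. harm_basis a x * g x) (\<lambda>x. harm_basis a x * g x)"
        using bessel[OF finite_harm_index harm_basis_rpf harm_basis_orthonormal rpf_mult[OF harm_basis_rpf[OF a] rg]] by simp
      then show "(\<Sum>b\<in>harm_index. u (fst a) * X a b) \<le> u (fst a) * sip (\<lambda>x. harm_basis a x * g x) (\<lambda>x. harm_basis a x * g x)"
        unfolding sum_distrib_left[symmetric] using u_nonneg by (intro mult_left_mono)
    qed
    also have "\<dots> = (\<Sum>a\<in>harm_index. sip (\<lambda>x. feature a x * feature a x * g x) g)"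
    proof (intro sum.cong refl)
      fix a
      have "sip (\<lambda>x. feature a x * feature a x * g x) g = sip (\<lambda>x. u (fst a) * (harm_basis a x * harm_basis a x * g x)) g"
        using u_nonneg by (intro sip_cong) (auto simp: feature_def algebra_simps)
      also have "\<dots> = u (fst a) * sip (\<lambda>x. harm_basis a x * harm_basis a x * g x) g" by (rule sip_cmult)
      also have "sip (\<lambda>x. harm_basis a x * harm_basis a x * g x) g = sip (\<lambda>x. harm_basis a x * g x) (\<lambda>x. harm_basis a x * g x)"
        by (simp add: sip_def mult_ac)
      finally show "u (fst a) * sip (\<lambda>x. harm_basis a x * g x) (\<lambda>x. harm_basis a x * g x) = sip (\<lambda>x. feature a x * feature a x * g x) g" ..
    qed
    also have "\<dots> = sip (\<lambda>x. \<Sum>a\<in>harm_index. feature a x * feature a x * g x) g"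
      by (rule sip_sum[symmetric, OF finite_harm_index _ rg]) (intro rpf_mult feature_rpf rg, assumption+)
    also have "\<dots> = sip (\<lambda>x. feature_trace * g x) g"
      by (intro sip_cong) (auto simp: sum_feature_sq sum_distrib_right[symmetric])
    also have "\<dots> = feature_trace * sip g g" by (rule sip_cmult)
    finally show ?thesis .
  qed
  have "feature_form g g = (\<Sum>a\<in>harm_index. \<Sum>b\<in>harm_index. u (fst a) * u (fst b) * X a b)"
    unfolding feature_form_def sum.cartesian_product by (intro sum.cong refl) (auto simp: Wsq)
  also have "\<dots> \<le> (\<Sum>a\<in>harm_index. \<Sum>b\<in>harm_index. q * (u (fst a) * X a b + u (fst b) * X b a))"
    by (intro sum_mono term_le)
  also have "\<dots> = q * ((\<Sum>a\<in>harm_index. \<Sum>b\<in>harm_index. u (fst a) * X a b) + (\<Sum>a\<in>harm_index. \<Sum>b\<in>harm_index. u (fst b) * X b a))"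
    by (simp only: distrib_left sum.distrib sum_distrib_left)
  also have "(\<Sum>a\<in>harm_index. \<Sum>b\<in>harm_index. u (fst b) * X b a) = (\<Sum>a\<in>harm_index. \<Sum>b\<in>harm_index. u (fst a) * X a b)"
    by (rule sum.swap)
  also have "q * ((\<Sum>a\<in>harm_index. \<Sum>b\<in>harm_index. u (fst a) * X a b) + (\<Sum>a\<in>harm_index. \<Sum>b\<in>harm_index. u (fst a) * X a b)) \<le> q * (feature_trace * sip g g + feature_trace * sip g g)"
    using half q(1) by (intro mult_left_mono add_mono)
  finally show ?thesis by (simp add: algebra_simps)
qed

text \<open>All weights and bounds stay abstract, which leaves the asymptotics to the final theorem.
  For the norm bound, \<open>h\<close> is tested against the sum \<open>g\<close> of its degree
  parts multiplied by \<open>\<mu> l\<close>: the pairing is the weighted norm \<open>S\<close>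
  itself, while \<open>feature_form g g\<close> is at most \<open>Q * S\<close>. Cauchy-Schwarz
  gives S^2 <= r Q S.\<close>

lemma fooling_function:
  fixes x :: "nat \<Rightarrow> real^'n" and q \<mu> :: "nat \<Rightarrow> real"
  assumes x: "\<And>j. j < n \<Longrightarrow> x j \<in> sphere 0 1"
    and q0: "q0 \<ge> 0" "\<And>k. k \<in> K \<Longrightarrow> u k \<le> q0"
    and M: "\<And>k. k \<in> K \<Longrightarrow> k \<le> M"
    and \<mu>: "\<And>l. \<mu> l \<ge> 0"
    and q: "\<And>l. q l \<ge> 0" "\<And>k l. k \<in> K \<Longrightarrow> 1 \<le> l \<Longrightarrow> l \<le> 2 * k \<Longrightarrow> u k \<le> q l"
    and Q: "Q \<ge> 0" "\<And>l. 1 \<le> l \<Longrightarrow> l \<le> 2 * M \<Longrightarrow> 2 * q l * feature_trace * \<mu> l \<le> Q"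
  obtains f :: "real^'n \<Rightarrow> real" where "real_polynomial_function f" "\<And>j. j < n \<Longrightarrow> f (x j) = 0"
    "feature_trace - real n * q0 \<le> (\<integral>z. f z \<partial>sphere_measure)" "(\<integral>z. f z \<partial>sphere_measure) \<le> feature_trace"
    "\<And>l. l > 2 * M \<Longrightarrow> Hproj_norm2 l f = 0"
    "(\<Sum>l\<in>{1..2*M}. \<mu> l * Hproj_norm2 l f) \<le> real n * Q"
proof -
  \<comment> \<open>Vectors are functions on all index pairs, but \<open>B\<close> sums over
    \<open>harm_index\<close> only; it is semidefinite, and vectors are compared only on
    \<open>harm_index\<close>.\<close>
  define B where "B = (\<lambda>v w. \<Sum>a\<in>harm_index. v a * w a :: real)"
  define V where "V = {w. \<exists>c. \<forall>a. w a = (\<Sum>j<n. c j * feature a (x j))}"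
  obtain r E where E: "r \<le> card {..<n}" "\<And>s. s < r \<Longrightarrow> E s \<in> V"
    "\<And>s t. s < r \<Longrightarrow> t < r \<Longrightarrow> B (E s) (E t) = (if s = t then 1 else 0)"
    "\<And>v. v \<in> V \<Longrightarrow> B (\<lambda>a. v a - (\<Sum>s<r. B v (E s) * E s a)) (\<lambda>a. v a - (\<Sum>s<r. B v (E s) * E s a)) = 0"
  proof (rule finite_onb[of "{..<n}" V "\<lambda>j a. feature a (x j)" B])
    show "(\<lambda>a. 0) \<in> V" unfolding V_def by (auto intro!: exI[of _ "\<lambda>_. 0"])
    show "(\<lambda>a. w a + w' a) \<in> V" if w: "w \<in> V" "w' \<in> V" for w w'
    proof -
      from w obtain c c' where "\<forall>a. w a = (\<Sum>j<n. c j * feature a (x j))" "\<forall>a. w' a = (\<Sum>j<n. c' j * feature a (x j))"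
        unfolding V_def by blast
      then show ?thesis
        unfolding V_def by (auto intro!: exI[of _ "\<lambda>j. c j + c' j"] simp: distrib_right sum.distrib)
    qed
    show "(\<lambda>a. t * w a) \<in> V" if w: "w \<in> V" for t w
    proof -
      from w obtain c where "\<forall>a. w a = (\<Sum>j<n. c j * feature a (x j))" unfolding V_def by blast
      then show ?thesis
        unfolding V_def by (auto intro!: exI[of _ "\<lambda>j. t * c j"] simp: sum_distrib_left mult.assoc)
    qed
    show "B (\<lambda>a. v a + v' a) w = B v w + B v' w" "B (\<lambda>a. t * v a) w = t * B v w" "B v w = B w v" "B v v \<ge> 0"
      for v v' w :: "nat \<times> nat \<Rightarrow> real" and t
      unfolding B_def by (simp_all add: algebra_simps sum.distrib sum_distrib_left sum_nonneg)
  qed (auto simp: V_def)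
  have r: "r \<le> n" using E(1) by simp

  \<comment> \<open>With the orthonormal system \<open>E\<close> of the span,
    \<open>proj s z\<close> is a coordinate of the projected feature vector at \<open>z\<close>,
    \<open>h\<close> is the squared length of that vector, and \<open>A\<close> is the matrix of the
    projection.\<close>
  define proj where "proj = (\<lambda>s z. \<Sum>a\<in>harm_index. E s a * feature a z)"
  define h where "h = (\<lambda>z. \<Sum>s<r. proj s z * proj s z)"
  define A where "A = (\<lambda>c. \<Sum>s<r. E s (fst c) * E s (snd c))"
  define f where "f = (\<lambda>z. feature_trace - h z)"
  have proj_rpf: "real_polynomial_function (proj s)" for s
    unfolding proj_def by (intro real_polynomial_function_sum rpf_cmult feature_rpf finite_harm_index)
  have h_rpf: "real_polynomial_function h"
    unfolding h_def by (intro real_polynomial_function_sum rpf_mult proj_rpf finite_lessThan)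
  have f_rpf: "real_polynomial_function f"
    unfolding f_def by (intro real_polynomial_function_diff real_polynomial_function.intros(2) h_rpf)

  \<comment> \<open>The feature vector of a node lies in the span, so the projection fixes it and
    \<open>h\<close> attains the full squared length.\<close>
  have h_node: "h (x j) = feature_trace" if j: "j < n" for j
  proof -
    define v where "v = (\<lambda>a. feature a (x j))"
    have "v \<in> V"
      unfolding V_def v_def using j
      by (auto intro!: exI[of _ "\<lambda>i. if i = j then 1 else 0"] simp: if_distrib[of "\<lambda>t. t * _"] cong: if_cong)
    then have "B (\<lambda>a. v a - (\<Sum>s<r. B v (E s) * E s a)) (\<lambda>a. v a - (\<Sum>s<r. B v (E s) * E s a)) = 0"
      by (rule E(4))
    then have v_eq: "v a = (\<Sum>s<r. B v (E s) * E s a)" if "a \<in> harm_index" for a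
      using that finite_harm_index by (simp add: B_def sum_nonneg_eq_0_iff)
    have proj_eq: "proj s (x j) = B v (E s)" for s
      by (simp add: proj_def B_def v_def mult.commute)
    have "h (x j) = (\<Sum>s<r. B v (E s) * (\<Sum>a\<in>harm_index. v a * E s a))"
      by (simp add: h_def proj_eq B_def)
    also have "\<dots> = (\<Sum>a\<in>harm_index. v a * (\<Sum>s<r. B v (E s) * E s a))"
      unfolding sum_distrib_left by (subst sum.swap) (simp add: mult_ac)
    also have "\<dots> = (\<Sum>a\<in>harm_index. v a * v a)"
      using v_eq by (intro sum.cong) auto
    also have "\<dots> = feature_trace"
      unfolding v_def by (rule sum_feature_sq[OF x[OF j]])
    finally show ?thesis .
  qed

  have sip_feature: "sip (feature a) (feature b) = (if a = b then u (fst a) else 0)" if "a \<in> harm_index" "b \<in> harm_index" for a b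
  proof -
    have "sip (feature a) (feature b) = sqrt (u (fst a)) * (sqrt (u (fst b)) * sip (harm_basis a) (harm_basis b))"
      unfolding feature_def[abs_def] sip_cmult sip_commute[of _ "\<lambda>x. _ * harm_basis b x"]
      by (simp only: sip_commute[of "harm_basis b" "harm_basis a"])
    then show ?thesis using harm_basis_orthonormal[OF that] u_nonneg by simp
  qed
  have int_h: "(\<integral>z. h z \<partial>sphere_measure) = (\<Sum>s<r. \<Sum>a\<in>harm_index. u (fst a) * (E s a * E s a))"
  proof -
    have "(\<integral>z. h z \<partial>sphere_measure) = (\<Sum>s<r. sip (proj s) (proj s))"
      unfolding h_def sip_def by (intro Bochner_Integration.integral_sum rpf_integrable_sphere rpf_mult proj_rpf)
    also have "\<dots> = (\<Sum>s<r. \<Sum>a\<in>harm_index. u (fst a) * (E s a * E s a))"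
    proof (intro sum.cong refl)
      fix s
      have pf: "sip (proj s) (feature a) = E s a * u (fst a)" if a: "a \<in> harm_index" for a
      proof -
        have "sip (proj s) (feature a) = (\<Sum>b\<in>harm_index. E s b * sip (feature b) (feature a))"
          unfolding proj_def by (rule sip_sum_cmult[OF finite_harm_index feature_rpf feature_rpf[OF a]])
        also have "\<dots> = (\<Sum>b\<in>harm_index. if b = a then E s b * u (fst b) else 0)"
          using a by (intro sum.cong) (auto simp: sip_feature)
        finally show ?thesis using finite_harm_index a by simp
      qed
      have "sip (proj s) (proj s) = (\<Sum>a\<in>harm_index. E s a * sip (feature a) (proj s))"
        by (subst (1) proj_def) (rule sip_sum_cmult[OF finite_harm_index feature_rpf proj_rpf])
      also have "\<dots> = (\<Sum>a\<in>harm_index. u (fst a) * (E s a * E s a))"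
        by (intro sum.cong refl) (simp only: sip_commute[of _ "proj s"] pf ac_simps)
      finally show "sip (proj s) (proj s) = (\<Sum>a\<in>harm_index. u (fst a) * (E s a * E s a))" .
    qed
    finally show ?thesis .
  qed
  \<comment> \<open>Each \<open>E s\<close> is a unit vector, so its squared entries average the
    weights \<open>u\<close>, all at most \<open>q0\<close>; there are \<open>r <= n\<close> such
    vectors.\<close>
  have int_h_le: "(\<integral>z. h z \<partial>sphere_measure) \<le> real n * q0"
  proof -
    have "(\<Sum>a\<in>harm_index. u (fst a) * (E s a * E s a)) \<le> q0" if s: "s < r" for s
    proof -
      have "(\<Sum>a\<in>harm_index. u (fst a) * (E s a * E s a)) \<le> (\<Sum>a\<in>harm_index. q0 * (E s a * E s a))"
        by (intro sum_mono mult_right_mono q0(2)) (auto simp: harm_index_def)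
      also have "\<dots> = q0 * B (E s) (E s)" by (simp add: B_def sum_distrib_left)
      finally show ?thesis using E(3)[OF s s] by simp
    qed
    then have "(\<integral>z. h z \<partial>sphere_measure) \<le> (\<Sum>s<r. q0)"
      unfolding int_h by (intro sum_mono) auto
    also have "\<dots> \<le> real n * q0" using r q0(1) by (simp add: mult_right_mono)
    finally show ?thesis .
  qed
  have int_h_nonneg: "(\<integral>z. h z \<partial>sphere_measure) \<ge> 0"
    unfolding int_h using u_nonneg by (intro sum_nonneg mult_nonneg_nonneg[OF _ zero_le_square])
  have int_f: "(\<integral>z. f z \<partial>sphere_measure) = feature_trace - (\<integral>z. h z \<partial>sphere_measure)"
    unfolding f_def using rpf_integrable_sphere[OF h_rpf]
    by (subst Bochner_Integration.integral_diff) (auto intro!: rpf_integrable_sphere simp: measure_sphere)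

  have h_expand: "h z = (\<Sum>c\<in>harm_index \<times> harm_index. A c * feature_prod c z)" for z
  proof -
    have "h z = (\<Sum>s<r. \<Sum>c\<in>harm_index \<times> harm_index. E s (fst c) * E s (snd c) * feature_prod c z)"
      unfolding h_def proj_def sum_product sum.cartesian_product
      by (intro sum.cong refl) (simp add: feature_prod_def split_beta' mult_ac)
    then show ?thesis by (subst (asm) sum.swap) (simp add: A_def sum_distrib_right)
  qed
  have sip_h: "sip h g = (\<Sum>c\<in>harm_index \<times> harm_index. A c * sip (feature_prod c) g)" if g: "real_polynomial_function g" for g
    using sip_sum_cmult[of "harm_index \<times> harm_index" feature_prod g A] finite_harm_index feature_prod_rpf g by (simp add: h_expand[abs_def])
  \<comment> \<open>The squared Hilbert-Schmidt norm of an orthogonal projection is its rank: by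
    orthonormality only the terms with equal \<open>s\<close> and \<open>t\<close> survive.\<close>
  have A_sq: "(\<Sum>c\<in>harm_index \<times> harm_index. (A c)\<^sup>2) = real r"
  proof -
    have "(\<Sum>c\<in>harm_index \<times> harm_index. (A c)\<^sup>2)
        = (\<Sum>c\<in>harm_index \<times> harm_index. \<Sum>s<r. \<Sum>t<r. (E s (fst c) * E t (fst c)) * (E s (snd c) * E t (snd c)))"
      unfolding A_def power2_eq_square sum_product by (intro sum.cong refl) (simp add: mult_ac)
    also have "\<dots> = (\<Sum>s<r. \<Sum>t<r. \<Sum>c\<in>harm_index \<times> harm_index. (E s (fst c) * E t (fst c)) * (E s (snd c) * E t (snd c)))"
      by (subst sum.swap, rule sum.cong[OF refl], rule sum.swap)
    also have "\<dots> = (\<Sum>s<r. \<Sum>t<r. B (E s) (E t) * B (E s) (E t))"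
      unfolding B_def sum_product sum.cartesian_product by (intro sum.cong refl) (simp add: split_beta')
    also have "\<dots> = (\<Sum>s<r. \<Sum>t<r. if t = s then 1 else 0)"
      by (intro sum.cong refl) (simp add: E(3))
    finally show ?thesis by simp
  qed
  have sip_h_sq: "(sip h g)\<^sup>2 \<le> real r * feature_form g g" if g: "real_polynomial_function g" for g
    unfolding sip_h[OF g] A_sq[symmetric] feature_form_def
    using Cauchy_Schwarz_ineq_sum[of A "\<lambda>c. sip (feature_prod c) g" "harm_index \<times> harm_index"] by (simp add: power2_eq_square)

  \<comment> \<open>In degrees \<open>l >= 1\<close> the constant \<open>feature_trace\<close> is
    invisible, so \<open>f\<close> and \<open>h\<close> have components of equal norm there.\<close>
  have sip_f: "sip f v = - sip h v" if v: "v \<in> sph_harm l" and l: "l \<ge> 1" for v l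
  proof -
    have rv: "real_polynomial_function v" by (rule sph_harm_rpf[OF v])
    have "hom_poly 0 (\<lambda>z::real^'n. feature_trace)" by (intro hom_polyI real_polynomial_function.intros(2)) simp
    from sph_harm_orth_lower[OF n3 v this] l have "sip (\<lambda>z. feature_trace) v = 0" by simp
    then show ?thesis
      unfolding f_def using sip_diff[OF real_polynomial_function.intros(2) h_rpf rv] by simp
  qed
  have norm2_f: "Hproj_norm2 l f = sip (harm_proj l h) (harm_proj l h)" if l: "l \<ge> 1" for l
  proof -
    have "harm_proj l f = (\<lambda>z. (-1) * harm_proj l h z)"
      using l by (simp add: harm_proj_def fun_eq_iff sip_f[OF onb_sph_harm[OF onb]] sum_negf)
    then have "sip (harm_proj l f) (harm_proj l f) = (-1) * ((-1) * sip (harm_proj l h) (harm_proj l h))"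
      by (simp only: sip_cmult sip_commute[of "harm_proj l h" "\<lambda>z. (-1) * harm_proj l h z"])
    then show ?thesis by (simp add: Hproj_norm2_eq[OF f_rpf])
  qed
  have harm_proj_rpf: "real_polynomial_function (harm_proj l h)" for l
    by (rule sph_harm_rpf[OF harm_proj_sph_harm])

  have high: "Hproj_norm2 l f = 0" if l: "l > 2 * M" for l
  proof -
    have "sip (feature_prod c) v = 0" if v: "v \<in> sph_harm l" and c: "c \<in> harm_index \<times> harm_index" for v c
    proof -
      obtain a b where ab: "c = (a, b)" "a \<in> harm_index" "b \<in> harm_index" using c by auto
      have hom: "hom_poly (fst a) (harm_basis a)" "hom_poly (fst b) (harm_basis b)"
        using harm_basis_sph_harm ab by (auto simp: sph_harm_def)
      have "hom_poly (fst a + fst b) (feature_prod c)"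
        by (intro hom_polyI feature_prod_rpf c)
          (simp add: ab(1) feature_prod_def feature_def hom_poly_scale[OF hom(1)] hom_poly_scale[OF hom(2)] power_add)
      moreover have "fst a \<le> M" "fst b \<le> M" using M ab by (auto simp: harm_index_def)
      ultimately show ?thesis using sph_harm_orth_lower[OF n3 v] l by simp
    qed
    then have "sip h (harm_proj l h) = 0"
      using sip_h[OF harm_proj_rpf] harm_proj_sph_harm by simp
    then show ?thesis using l by (simp add: norm2_f sip_harm_proj_self[OF h_rpf])
  qed

  define N where "N = (\<lambda>l. sip (harm_proj l h) (harm_proj l h))"
  define g where "g = (\<lambda>z. \<Sum>l\<in>{1..2*M}. \<mu> l * harm_proj l h z)"
  define S where "S = (\<Sum>l\<in>{1..2*M}. \<mu> l * N l)"
  have g_rpf: "real_polynomial_function g"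
    unfolding g_def by (intro real_polynomial_function_sum rpf_cmult harm_proj_rpf) auto
  have N_nonneg: "N l \<ge> 0" for l by (simp add: N_def sip_nonneg)
  have S_nonneg: "S \<ge> 0" unfolding S_def by (intro sum_nonneg mult_nonneg_nonneg \<mu> N_nonneg)
  have "sip h g = (\<Sum>l\<in>{1..2*M}. \<mu> l * sip (harm_proj l h) h)"
    unfolding sip_commute[of h] g_def by (rule sip_sum_cmult[OF _ harm_proj_rpf h_rpf]) simp
  also have "\<dots> = S"
    unfolding S_def N_def sip_harm_proj_self[OF h_rpf] sip_commute[of h] ..
  finally have hg: "sip h g = S" .
  have kgg: "feature_form g g \<le> Q * S"
  proof -
    have "feature_form g g = (\<Sum>l\<in>{1..2*M}. \<mu> l * feature_form (harm_proj l h) g)"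
      by (subst (1) g_def) (rule feature_form_sum_cmult[OF _ harm_proj_rpf], simp)
    also have "\<dots> \<le> (\<Sum>l\<in>{1..2*M}. \<mu> l * (Q * N l))"
    proof (intro sum_mono mult_left_mono \<mu>)
      fix l assume l: "l \<in> {1..2*M}"
      have "feature_form (harm_proj l h) g = (\<Sum>k\<in>{1..2*M}. \<mu> k * feature_form (harm_proj k h) (harm_proj l h))"
        unfolding feature_form_commute[of "harm_proj l h"] g_def by (rule feature_form_sum_cmult[OF _ harm_proj_rpf]) simp
      also have "\<dots> = (\<Sum>k\<in>{1..2*M}. if k = l then \<mu> l * feature_form (harm_proj l h) (harm_proj l h) else 0)"
        by (intro sum.cong refl) (auto simp: feature_form_orth[OF harm_proj_sph_harm harm_proj_sph_harm])
      also have "\<dots> = \<mu> l * feature_form (harm_proj l h) (harm_proj l h)" using l by simp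
      also have "\<dots> \<le> \<mu> l * (2 * q l * feature_trace * N l)"
        unfolding N_def using l by (intro mult_left_mono[OF feature_form_bound[OF harm_proj_sph_harm]] \<mu> q) auto
      also have "\<dots> = (2 * q l * feature_trace * \<mu> l) * N l" by simp
      also have "\<dots> \<le> Q * N l" using Q(2)[of l] l by (intro mult_right_mono N_nonneg) auto
      finally show "feature_form (harm_proj l h) g \<le> Q * N l" .
    qed
    also have "\<dots> = Q * S" by (simp add: S_def sum_distrib_left mult_ac)
    finally show ?thesis .
  qed
  have S_le: "S \<le> real n * Q"
  proof (cases "S = 0")
    case True
    then show ?thesis using Q(1) by simp
  next
    case False
    then have pos: "S > 0" using S_nonneg by simp
    have "S * S \<le> real r * feature_form g g"
      using sip_h_sq[OF g_rpf] by (simp add: hg power2_eq_square)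
    also have "\<dots> \<le> real r * (Q * S)" using kgg by (intro mult_left_mono) auto
    finally have "S * S \<le> (real r * Q) * S" by (simp add: mult.assoc)
    then have le: "S \<le> real r * Q" using pos by (simp only: mult_le_cancel_right_pos)
    have "real r * Q \<le> real n * Q" using r Q(1) by (intro mult_right_mono) auto
    with le show ?thesis by linarith
  qed

  show thesis
  proof (rule that[OF f_rpf])
    show "f (x j) = 0" if "j < n" for j using h_node[OF that] by (simp add: f_def)
    show "(\<Sum>l\<in>{1..2*M}. \<mu> l * Hproj_norm2 l f) \<le> real n * Q"
      using S_le by (simp add: S_def N_def norm2_f)
  qed (use int_f int_h_le int_h_nonneg high in auto)
qed

end

lemma Hproj_norm2_cmult:
  fixes f :: "real^'n \<Rightarrow> real"
  assumes f: "real_polynomial_function f"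
  shows "Hproj_norm2 l (\<lambda>x. t * f x) = t\<^sup>2 * Hproj_norm2 l f"
proof -
  have "harm_proj l (\<lambda>x. t * f x) = (\<lambda>x. t * harm_proj l f x)"
    by (simp add: harm_proj_def fun_eq_iff sip_cmult sum_distrib_left mult.assoc)
  then have "sip (harm_proj l (\<lambda>x. t * f x)) (harm_proj l (\<lambda>x. t * f x)) = t * (t * sip (harm_proj l f) (harm_proj l f))"
    by (simp only: sip_cmult sip_commute[of "harm_proj l f" "\<lambda>x. t * harm_proj l f x"])
  then show ?thesis
    unfolding Hproj_norm2_eq[OF f] Hproj_norm2_eq[OF rpf_cmult[OF f]] by (simp add: power2_eq_square mult.assoc)
qed

end

section \<open>The lower bound\<close>

text \<open>The inequality ln (1 + 1/k) <= 1/k telescopes.\<close>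

lemma ln_le_harmonic_block:
  assumes "1 \<le> a" "a \<le> b"
  shows "ln (real b + 1) - ln (real a) \<le> (\<Sum>k\<in>{a..b}. 1 / real k)"
  using assms(2)
proof (induction b rule: dec_induct)
  case base
  have "ln (real a + 1) - ln (real a) = ln (1 + 1 / real a)"
    using assms(1) ln_div[of "real a + 1" "real a"] by (simp add: add_divide_distrib)
  also have "\<dots> \<le> 1 / real a" by (rule ln_add_one_self_le_self) simp
  finally show ?case by simp
next
  case (step b)
  have "ln (real b + 2) - ln (real b + 1) = ln (1 + 1 / (real b + 1))"
    using ln_div[of "real b + 2" "real b + 1"] by (simp add: field_simps)
  also have "\<dots> \<le> 1 / (real b + 1)" by (rule ln_add_one_self_le_self) simp
  finally show ?case using step by (simp add: algebra_simps)
qed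

text \<open>This is the weight of degree \<open>l\<close> in the squared norm, cleared of negative
  exponents; it grows like l^d (ln l)^(2 \<beta>).\<close>

lemma inverse_lam_sq:
  assumes "CARD('n::finite) \<ge> 2"
  defines "d \<equiv> real (sdim TYPE('n))"
  shows "1 / (lam TYPE('n) (d / 2) \<beta> l)\<^sup>2
    = (1 + real l * (real l + d - 1)) powr (d / 2) * ln (3 + real l * (real l + d - 1)) powr (2 * \<beta>)"
proof -
  define b where "b = real l * (real l + d - 1)"
  have "d \<ge> 1" using assms by (simp add: sdim_def)
  then have b: "b \<ge> 0" by (simp add: b_def)
  have sq: "(t powr e)\<^sup>2 = t powr (2 * e)" for t e :: real
    by (simp add: power2_eq_square powr_add[symmetric])
  have "(lam TYPE('n) (d / 2) \<beta> l)\<^sup>2 = (1 + b) powr (- (d / 2)) * ln (3 + b) powr (- (2 * \<beta>))"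
    unfolding lam_def d_def[symmetric] b_def[symmetric] power_mult_distrib sq by simp
  then show ?thesis
    unfolding powr_minus b_def divide_inverse inverse_mult_distrib inverse_inverse_eq by simp
qed

theorem theorem1p3:
  fixes \<beta> :: real
  assumes "CARD('n::finite) \<ge> 3"
    and "\<beta> > 1/2"
  shows "\<exists>C>0. \<forall>n::nat\<ge>2.
     quad_err (Hball (real (sdim TYPE('n)) / 2) \<beta> :: (real^'n \<Rightarrow> real) set) n
       \<ge> ereal (C * real n powr (-1/2) * ln (real n) powr (1/2 - \<beta>))"
proof -
  have "\<exists>Y. \<forall>k. \<exists>r. is_onb k r (Y k :: nat \<Rightarrow> real^'n \<Rightarrow> real)"
    using is_onb_exists by metis
  then obtain D and Y :: "nat \<Rightarrow> nat \<Rightarrow> real^'n \<Rightarrow> real" where onb: "\<And>k. is_onb k (D k) (Y k)"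
    by metis
  define d where "d = sdim TYPE('n)"
  have d: "d = CARD('n) - 1" "d \<ge> 2" using assms(1) by (auto simp: d_def sdim_def)
  define \<mu> where "\<mu> = (\<lambda>l. 1 / (lam TYPE('n) (real d / 2) \<beta> l)\<^sup>2)"
  have \<mu>_eq: "\<mu> l = (1 + real l * (real l + real d - 1)) powr (real d / 2)
      * ln (3 + real l * (real l + real d - 1)) powr (2 * \<beta>)" for l
    unfolding \<mu>_def d_def using assms(1) by (intro inverse_lam_sq) simp
  have \<mu>_nonneg: "\<mu> l \<ge> 0" for l by (simp add: \<mu>_def)

  \<comment> \<open>By the dimension bound \<open>onb_dim\<close>, degree \<open>k\<close>
    contributes at least \<open>c / k\<close> to \<open>m\<close>.\<close>
  define c where "c = 1 / real d ^ (d - 1)"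
  have c: "c > 0" using d(2) by (simp add: c_def)
  have ln2: "ln (2::real) > 0" by simp
  \<comment> \<open>Chosen so that 1/A <= c ln 2 / 2, which keeps the loss n / N^d below m/2 already
    for n = 2.\<close>
  obtain A0 :: nat where A0: "2 / (c * ln 2) \<le> real A0" using real_arch_simple by blast
  define A where "A = A0 + 1"
  have A: "A \<ge> 1" "2 / (c * ln 2) \<le> real A" using A0 by (auto simp: A_def)
  \<comment> \<open>For l <= 2 N^2 and N = A n, the argument of the logarithm in the weight is at
    most B n^4. Its logarithm is then at most P ln n, where the summand ln B / ln 2 of
    \<open>P\<close> absorbs ln B because n >= 2.\<close>
  define B where "B = (real d + 3) * 4 * real A ^ 4"
  have B: "B \<ge> 1"
  proof -
    have "1 * 1 \<le> ((real d + 3) * 4) * real A ^ 4" using A(1) by (intro mult_mono one_le_power) auto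
    then show ?thesis by (simp add: B_def)
  qed
  define P where "P = ln B / ln 2 + 4"
  have P: "P > 0" using B by (simp add: P_def add_nonneg_pos)
  \<comment> \<open>The factor 2 of the form bound, the factor 2^d left by
    \<open>q l * real l ^ d\<close>, and the constants from the two factors of
    \<open>\<mu> l\<close>.\<close>
  define C1 where "C1 = 2 * 2 ^ d * (real d + 1) powr (real d / 2) * P powr (2 * \<beta>)"
  have C1: "C1 > 0" using P d(2) by (simp add: C1_def)
  \<comment> \<open>The cost of degree 0 plus that of the other degrees. The power of ln 2
    compensates for \<open>L powr (2 * \<beta> - 1)\<close>, which is below 1 when n = 2.\<close>
  define S0 where "S0 = \<mu> 0 * ln 2 powr (1 - 2 * \<beta>) + C1 / c"
  have S0: "S0 > 0" unfolding S0_def using C1 c \<mu>_nonneg by (intro add_nonneg_pos) auto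
  define C where "C = 1 / (2 * sqrt S0)"
  have C: "C > 0" using S0 by (simp add: C_def)

  have main: "ereal (C * real n powr (-1/2) * ln (real n) powr (1/2 - \<beta>))
      \<le> quad_err (Hball (real (sdim TYPE('n)) / 2) \<beta> :: (real^'n \<Rightarrow> real) set) n" if n: "n \<ge> 2" for n :: nat
  proof -
    define L where "L = ln (real n)"
    have L: "L \<ge> ln 2" "L > 0" using n by (auto simp: L_def)
    define N where "N = A * n"
    have "N \<ge> n" using A(1) by (simp add: N_def)
    then have N: "N \<ge> n" "N \<ge> 2" using n by auto
    define K where "K = {N..N\<^sup>2}"
    define u where "u = (\<lambda>k. 1 / real k ^ d)"
    define q where "q = (\<lambda>l. (2 / real l) ^ d)"
    define m where "m = feature_trace D K u"
    define Q where "Q = C1 * m * L powr (2 * \<beta>)"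
    have u: "u k \<ge> 0" for k by (simp add: u_def)
    \<comment> \<open>The sum of 1/k from N to N^2 is at least 2 ln N - ln N = ln N >= ln n.\<close>
    have m_ge: "m \<ge> c * L"
    proof -
      have "L \<le> ln (real N)" using N n by (simp add: L_def)
      also have "\<dots> = 2 * ln (real N) - ln (real N)" by simp
      also have "2 * ln (real N) = ln (real (N\<^sup>2))" using N by (simp add: ln_realpow)
      also have "\<dots> \<le> ln (real (N\<^sup>2) + 1)"
          by (subst ln_le_cancel_iff) (use N in \<open>auto intro: add_nonneg_pos\<close>)
      also have "ln (real (N\<^sup>2) + 1) - ln (real N) \<le> (\<Sum>k\<in>K. 1 / real k)"
        unfolding K_def using N by (intro ln_le_harmonic_block) (auto simp: power2_eq_square)
      finally have "c * L \<le> c * (\<Sum>k\<in>K. 1 / real k)" using c by (intro mult_left_mono) auto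
      also have "\<dots> = (\<Sum>k\<in>K. c / real k)" by (simp add: sum_distrib_left)
      also have "\<dots> \<le> (\<Sum>k\<in>K. u k * real (D k))"
      proof (rule sum_mono)
        fix k assume "k \<in> K"
        then have k: "k > 0" using N by (auto simp: K_def)
        have dd: "d = Suc (d - 1)" using d(2) by simp
        have "c / real k = u k * (real k / real d) ^ (d - 1)"
          unfolding c_def u_def power_divide using k by (subst (3) dd) (simp add: field_simps)
        also have "(real k / real d) ^ (d - 1) \<le> real (D k)"
          using onb_dim[OF _ onb[of k]] assms(1) d(1) by (simp add: numeral_2_eq_2)
        finally show "c / real k \<le> u k * real (D k)" using u by (simp add: mult_left_mono)
      qed
      also have "\<dots> = m"
        unfolding m_def by (rule feature_trace_def[OF assms(1) onb _ u, symmetric]) (simp add: K_def)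
      finally show ?thesis .
    qed
    then have m_pos: "m > 0" using c L by (meson less_le_trans mult_pos_pos)
    have Q_nonneg: "Q \<ge> 0" unfolding Q_def using C1 m_pos by simp
    \<comment> \<open>Since d >= 2, the left side is at most n / N^2 = 1 / (A N), and the choice of
      \<open>A\<close> finishes.\<close>
    have nq: "real n * (1 / real N ^ d) \<le> m / 2"
    proof -
      have "real N ^ 2 \<le> real N ^ d" using N d(2) by (intro power_increasing) auto
      then have "1 / real N ^ d \<le> 1 / real N ^ 2" using N by (intro divide_left_mono) auto
      then have "real n * (1 / real N ^ d) \<le> real n * (1 / real N ^ 2)" by (intro mult_left_mono) auto
      also have "\<dots> = (1 / real A) * (1 / real N)"
        using n A(1) by (simp add: N_def power2_eq_square field_simps)
      also have "\<dots> \<le> (1 / real A) * 1" using N by (intro mult_left_mono) auto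
      also have "\<dots> \<le> c * ln 2 / 2"
        using A c ln2 by (simp add: field_simps)
      also have "\<dots> \<le> c * L / 2" using L c by simp
      also have "\<dots> \<le> m / 2" using m_ge by simp
      finally show ?thesis .
    qed
    have uq: "u k \<le> q l" if "k \<in> K" "1 \<le> l" "l \<le> 2 * k" for k l
    proof -
      have "1 / real k \<le> 2 / real l"
        using that by (simp add: field_simps)
      then have "(1 / real k) ^ d \<le> (2 / real l) ^ d" by (intro power_mono) auto
      then show ?thesis by (simp add: u_def q_def power_divide)
    qed
    \<comment> \<open>The growth l^d of \<open>\<mu> l\<close> cancels against \<open>q l\<close>,
      so only the logarithmic factor remains, and it is bounded uniformly through the largest
      degree.\<close>
    have Q: "2 * q l * m * \<mu> l \<le> Q" if l: "1 \<le> l" "l \<le> 2 * N\<^sup>2" for l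
    proof -
      define b where "b = real l * (real l + real d - 1)"
      have l1: "1 \<le> real l" using l by simp
      have b0: "b \<ge> 0" using l1 by (simp add: b_def)
      have "real l * 1 \<le> real l * real l" using l1 by (intro mult_left_mono) auto
      then have ll: "real l \<le> (real l)\<^sup>2" by (simp add: power2_eq_square)
      then have l2: "1 \<le> (real l)\<^sup>2" using l1 by linarith
      have "0 \<le> (real d - 1) * ((real l)\<^sup>2 - real l)" using ll d(2) by (intro mult_nonneg_nonneg) auto
      then have b_le: "b \<le> real d * (real l)\<^sup>2"
        by (simp add: b_def algebra_simps power2_eq_square)
      have e1: "(1 + b) powr (real d / 2) \<le> (real d + 1) powr (real d / 2) * real l ^ d"
      proof -
        have "(1 + b) powr (real d / 2) \<le> ((real d + 1) * (real l)\<^sup>2) powr (real d / 2)"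
          using b0 b_le l2 by (intro powr_mono2) (auto simp: algebra_simps)
        also have "\<dots> = (real d + 1) powr (real d / 2) * ((real l)\<^sup>2) powr (real d / 2)"
          by (rule powr_mult)
        also have "((real l)\<^sup>2) powr (real d / 2) = real l ^ d"
        proof -
          have sq: "(real l)\<^sup>2 = real l powr 2" using l1 by (simp add: powr_numeral)
          have "((real l)\<^sup>2) powr (real d / 2) = real l powr real d" unfolding sq powr_powr by simp
          then show ?thesis using l1 by (simp add: powr_realpow)
        qed
        finally show ?thesis .
      qed
      have e2: "ln (3 + b) powr (2 * \<beta>) \<le> P powr (2 * \<beta>) * L powr (2 * \<beta>)"
      proof -
        have "real l \<le> real (2 * N\<^sup>2)" using l(2) by (simp only: of_nat_le_iff)
        then have "(real l)\<^sup>2 \<le> (2 * (real A * real n)\<^sup>2)\<^sup>2"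
          by (intro power_mono) (auto simp: N_def)
        also have "\<dots> = 4 * real A ^ 4 * real n ^ 4" by (simp add: power_mult_distrib power_mult[symmetric])
        finally have l_le: "(real l)\<^sup>2 \<le> 4 * real A ^ 4 * real n ^ 4" .
        have "3 + b \<le> (real d + 3) * (real l)\<^sup>2" using b_le l2 by (simp add: algebra_simps)
        also have "\<dots> \<le> (real d + 3) * (4 * real A ^ 4 * real n ^ 4)" using l_le by (intro mult_left_mono) auto
        also have "\<dots> = B * real n ^ 4" by (simp add: B_def)
        finally have "ln (3 + b) \<le> ln (B * real n ^ 4)" using b0 by simp
        also have "\<dots> = ln B + 4 * L" using B n by (simp add: ln_mult ln_realpow L_def)
        also have "ln B \<le> ln B / ln 2 * L"
        proof -
          have "ln B * 1 \<le> ln B * (L / ln 2)" using B L by (intro mult_left_mono) auto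
          then show ?thesis by simp
        qed
        finally have "ln (3 + b) \<le> P * L" by (simp add: P_def algebra_simps)
        then have "ln (3 + b) powr (2 * \<beta>) \<le> (P * L) powr (2 * \<beta>)"
          using b0 assms(2) by (intro powr_mono2) auto
        also have "\<dots> = P powr (2 * \<beta>) * L powr (2 * \<beta>)" by (rule powr_mult)
        finally show ?thesis .
      qed
      have ql: "q l * real l ^ d = 2 ^ d" using l1 by (simp add: q_def power_divide)
      have "2 * q l * m * \<mu> l \<le> 2 * q l * m *
          (((real d + 1) powr (real d / 2) * real l ^ d) * (P powr (2 * \<beta>) * L powr (2 * \<beta>)))"
        unfolding \<mu>_eq b_def[symmetric] using m_pos e1 e2
        by (intro mult_left_mono mult_mono) (auto simp: q_def)
      also have "\<dots> = 2 * (q l * real l ^ d) * (real d + 1) powr (real d / 2) * P powr (2 * \<beta>) * m * L powr (2 * \<beta>)"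
        by (simp only: mult_ac)
      also have "\<dots> = Q" unfolding ql by (simp add: Q_def C1_def)
      finally show ?thesis .
    qed

    show ?thesis
      unfolding quad_err_def
    proof (rule INF_greatest)
      fix cx :: "(nat \<Rightarrow> real) \<times> (nat \<Rightarrow> real^'n)"
      assume cx: "cx \<in> {(c, x). \<forall>j<n. x j \<in> sphere (0::real^'n) 1}"
      obtain f :: "real^'n \<Rightarrow> real" where f: "real_polynomial_function f" "\<And>j. j < n \<Longrightarrow> f (snd cx j) = 0"
        "m - real n * (1 / real N ^ d) \<le> (\<integral>z. f z \<partial>sphere_measure)" "(\<integral>z. f z \<partial>sphere_measure) \<le> m"
        "\<And>l. l > 2 * N\<^sup>2 \<Longrightarrow> Hproj_norm2 l f = 0"
        "(\<Sum>l\<in>{1..2*N\<^sup>2}. \<mu> l * Hproj_norm2 l f) \<le> real n * Q"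
      proof (rule fooling_function[OF assms(1) onb, of K u n "snd cx" "1 / real N ^ d" "N\<^sup>2" \<mu> q Q])
        show "u k \<le> 1 / real N ^ d" if "k \<in> K" for k
          using that N unfolding u_def K_def by (intro divide_left_mono power_mono) auto
      qed (use cx u \<mu>_nonneg Q_nonneg uq Q in \<open>auto simp: K_def m_def q_def\<close>)
      \<comment> \<open>Fixed so that \<tau> m / 2 is the claimed bound; \<open>\<tau>_sq\<close>
        confirms that the norm budget is then exactly 1.\<close>
      define \<tau> where "\<tau> = 2 * C * real n powr (-1/2) * L powr (1/2 - \<beta>) / m"
      define F where "F = (\<lambda>z. \<tau> * f z)"
      have \<tau>: "\<tau> > 0" using C n L m_pos by (simp add: \<tau>_def)
      have F_rpf: "real_polynomial_function F" unfolding F_def by (rule rpf_cmult[OF f(1)])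
      have norm_F: "Hproj_norm2 l F = \<tau>\<^sup>2 * Hproj_norm2 l f" for l
        unfolding F_def by (rule Hproj_norm2_cmult[OF assms(1) onb f(1)])
      have \<tau>_sq: "\<tau>\<^sup>2 * S0 * m\<^sup>2 * real n * L powr (2 * \<beta> - 1) = 1"
      proof -
        have a: "(real n powr (-1/2))\<^sup>2 = 1 / real n"
          using n by (simp add: power2_eq_square powr_add[symmetric] powr_minus_divide)
        have b: "(L powr (1/2 - \<beta>))\<^sup>2 * L powr (2 * \<beta> - 1) = 1"
          using L by (simp add: power2_eq_square powr_add[symmetric])
        have cc: "(2 * C)\<^sup>2 * S0 = 1" using S0 by (simp add: C_def power_divide)
        have "\<tau>\<^sup>2 * S0 * m\<^sup>2 * real n * L powr (2 * \<beta> - 1)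
            = ((2 * C)\<^sup>2 * S0) * ((real n powr (-1/2))\<^sup>2 * real n) * ((L powr (1/2 - \<beta>))\<^sup>2 * L powr (2 * \<beta> - 1))"
          using m_pos by (simp add: \<tau>_def power_divide power_mult_distrib)
        also have "\<dots> = 1" unfolding b cc a using n by simp
        finally show ?thesis .
      qed
      \<comment> \<open>Degree 0 costs m^2 and is padded by a factor at least 1. The other degrees
        cost a multiple of \<open>n * m * L powr (2 * \<beta>)\<close>, where one factor
        \<open>L\<close> is traded for \<open>m / c\<close> by \<open>m_ge\<close>.\<close>
      have budget: "\<mu> 0 * m\<^sup>2 + real n * Q \<le> S0 * m\<^sup>2 * real n * L powr (2 * \<beta> - 1)"
      proof -
        have "1 \<le> real n * (ln 2 powr (1 - 2 * \<beta>) * L powr (2 * \<beta> - 1))"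
        proof -
          have "ln 2 powr (2 * \<beta> - 1) \<le> L powr (2 * \<beta> - 1)" using L assms(2) by (intro powr_mono2) auto
          then have "ln 2 powr (1 - 2 * \<beta>) * ln 2 powr (2 * \<beta> - 1) \<le> ln 2 powr (1 - 2 * \<beta>) * L powr (2 * \<beta> - 1)"
            by (intro mult_left_mono) auto
          then have "1 \<le> ln 2 powr (1 - 2 * \<beta>) * L powr (2 * \<beta> - 1)" by (simp add: powr_add[symmetric])
          then have "1 * 1 \<le> real n * (ln 2 powr (1 - 2 * \<beta>) * L powr (2 * \<beta> - 1))"
            using n by (intro mult_mono) auto
          then show ?thesis by simp
        qed
        then have "\<mu> 0 * m\<^sup>2 * 1 \<le> \<mu> 0 * m\<^sup>2 * (real n * (ln 2 powr (1 - 2 * \<beta>) * L powr (2 * \<beta> - 1)))"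
          using \<mu>_nonneg by (intro mult_left_mono) auto
        moreover have "real n * Q \<le> C1 / c * m\<^sup>2 * real n * L powr (2 * \<beta> - 1)"
        proof -
          have "L powr (2 * \<beta>) = L * L powr (2 * \<beta> - 1)"
            using L powr_add[of L 1 "2 * \<beta> - 1"] by simp
          then have "real n * Q = (real n * C1 * m * L powr (2 * \<beta> - 1)) * L" by (simp add: Q_def)
          also have "\<dots> \<le> (real n * C1 * m * L powr (2 * \<beta> - 1)) * (m / c)"
            using m_ge c C1 m_pos by (intro mult_left_mono) (auto simp: field_simps)
          finally show ?thesis by (simp only: power2_eq_square divide_inverse mult_ac)
        qed
        ultimately show ?thesis by (simp add: S0_def algebra_simps)
      qed
      have int_f: "(\<integral>z. f z \<partial>sphere_measure) \<ge> m / 2" using f(3) nq by linarith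
      \<comment> \<open>The integral of \<open>f\<close> lies between m/2 and m, so its square,
        which bounds the degree 0 part, is at most m^2.\<close>
      have zero_norm: "Hproj_norm2 0 f \<le> m\<^sup>2"
      proof -
        have "Hproj_norm2 0 f \<le> (\<integral>z. f z \<partial>sphere_measure)\<^sup>2"
          by (rule Hproj_norm2_0_le[OF assms(1) onb f(1)])
        also have "\<dots> \<le> m\<^sup>2" using f(4) int_f m_pos by (intro power_mono) auto
        finally show ?thesis .
      qed
      let ?t = "\<lambda>l. Hproj_norm2 l F / (lam TYPE('n) (real (sdim TYPE('n)) / 2) \<beta> l)\<^sup>2"
      have t_eq: "?t l = \<tau>\<^sup>2 * (\<mu> l * Hproj_norm2 l f)" for l
        by (simp add: norm_F \<mu>_def d_def)
      have t_zero: "?t l = 0" if "l \<notin> {..2 * N\<^sup>2}" for l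
        unfolding t_eq using f(5)[of l] that by simp
      have summable: "summable ?t"
        by (rule summable_finite[of "{..2 * N\<^sup>2}"]) (use t_zero in auto)
      have "(\<Sum>l. ?t l) = (\<Sum>l\<in>{..2 * N\<^sup>2}. ?t l)"
        by (rule suminf_finite) (use t_zero in auto)
      also have "{..2 * N\<^sup>2} = insert 0 {1..2 * N\<^sup>2}" by auto
      also have "(\<Sum>l\<in>insert 0 {1..2 * N\<^sup>2}. ?t l)
          = \<tau>\<^sup>2 * (\<mu> 0 * Hproj_norm2 0 f + (\<Sum>l\<in>{1..2 * N\<^sup>2}. \<mu> l * Hproj_norm2 l f))"
        unfolding t_eq by (simp add: sum_distrib_left distrib_left)
      also have "\<dots> \<le> \<tau>\<^sup>2 * (\<mu> 0 * m\<^sup>2 + real n * Q)"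
        using zero_norm f(6) \<mu>_nonneg by (intro mult_left_mono add_mono) auto
      also have "\<dots> \<le> \<tau>\<^sup>2 * (S0 * m\<^sup>2 * real n * L powr (2 * \<beta> - 1))"
        using budget by (intro mult_left_mono) auto
      also have "\<dots> = 1" using \<tau>_sq by (simp only: mult.assoc)
      finally have F: "F \<in> Hball (real (sdim TYPE('n)) / 2) \<beta>"
        using summable rpf_continuous_on[OF F_rpf] by (simp add: Hball_def)
      have F_nodes: "(\<Sum>j<n. fst cx j * F (snd cx j)) = 0"
        using f(2) by (simp add: F_def)
      have int_F: "(\<integral>z. F z \<partial>sphere_measure) = \<tau> * (\<integral>z. f z \<partial>sphere_measure)" by (simp add: F_def)
      have "C * real n powr (-1/2) * L powr (1/2 - \<beta>) = \<tau> * (m / 2)" using m_pos by (simp add: \<tau>_def)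
      also have "\<dots> \<le> (\<integral>z. F z \<partial>sphere_measure)"
        unfolding int_F using \<tau> int_f by (intro mult_left_mono) auto
      also have "\<dots> \<le> \<bar>(\<integral>z. F z \<partial>sphere_measure) - (\<Sum>j<n. fst cx j * F (snd cx j))\<bar>"
        unfolding F_nodes by simp
      finally have "ereal (C * real n powr (-1/2) * ln (real n) powr (1/2 - \<beta>))
          \<le> ereal \<bar>(\<integral>z. F z \<partial>sphere_measure) - (\<Sum>j<n. fst cx j * F (snd cx j))\<bar>"
        by (simp add: L_def)
      then show "ereal (C * real n powr (-1/2) * ln (real n) powr (1/2 - \<beta>))
          \<le> (SUP f\<in>Hball (real (sdim TYPE('n)) / 2) \<beta>.
            ereal \<bar>(\<integral>y. f y \<partial>sphere_measure) - (\<Sum>j<n. fst cx j * f (snd cx j))\<bar>)"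
        by (rule SUP_upper2[OF F])
    qed
  qed
  show ?thesis using C main by blast
qed

end
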